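(* Let $\mathcal{M}$ be a Riemannian manifold modeled on a Hilbert space, let $\Omega\subset\mathcal{M}$ and $p\in\operatorname{cl}\Omega$. Then the Fréchet subdifferential at $p$ of the distance function $\operatorname{dist}(\cdot;\Omega)$ satisfies $$\hat\partial_{\mathcal{M}}\operatorname{dist}(p;\Omega)=\hat N^{\mathcal{M}}_{\Omega}(p)\cap\mathbb{B}_{T_p^*\mathcal{M}}.$$
   Context: A Riemannian manifold $\mathcal{M}$ here is a $C^\infty$ manifold modeled on a (possibly infinite-dimensional) real Hilbert space, with a smooth Riemannian metric $g$ such that for each $p$ the norm $\|x\|_p=g_p(x,x)^{1/2}$ on $T_p\mathcal{M}$ is equivalent to the model norm. $T_p^*\mathcal{M}$ carries the dual norm, and $\mathbb{B}_{T_p^*\mathcal{M}}$ is its closed unit ball. $d$ is the Riemannian distance and $\operatorname{dist}(u;\Omega):=\inf_{q\in\Omega}d(u,q)$. $\exp_p$ is the exponential map restricted to a sufficiently small neighborhood of $0$ in $T_p\mathcal{M}$, on which it is a diffeomorphism onto a neighborhood of $p$. For a Banach space $E$ and $h$ defined near $x\in E$ with values in $\mathbb{R}\cup\{\infty\}$, $h(x)<\infty$, the Fréchet subdifferential is $\hat\partial h(x)=\{x^*\in E^*:\liminf_{u\to x}\frac{h(u)-h(x)-\langle x^*,u-x\rangle}{\|u-x\|}\ge0\}$. For $A\subset E$ and $x\in\operatorname{cl}A$, the Fréchet normal cone is $\hat N_A(x)=\{x^*\in E^*:\limsup_{u\to x,\,u\in A}\frac{\langle x^*,u-x\rangle}{\|u-x\|}\le0\}$.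 On $\mathcal{M}$: for $f:\mathcal{M}\to\mathbb{R}\cup\{\infty\}$ finite at $p$, $\hat\partial_{\mathcal{M}}f(p):=\hat\partial(f\circ\exp_p)(0)\subset T_p^*\mathcal{M}$; for $p\in\operatorname{cl}\Omega$, $\hat N^{\mathcal{M}}_\Omega(p):=\hat N_{\exp_p^{-1}\Omega_*}(0)\subset T_p^*\mathcal{M}$, where $\Omega_*$ is the intersection of $\Omega$ with a small neighborhood of $p$ on which $\exp_p^{-1}$ is defined. The notation $\hat\partial_{\mathcal{M}}\operatorname{dist}(p;\Omega)$ means the Fréchet subdifferential at $p$ of $u\mapsto\operatorname{dist}(u;\Omega)$. *)

theory Defs
  imports "HOL-Analysis.Analysis"
begin

section \<open>Smooth maps between normed spaces\<close>

definition bounded_multilinear ::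
    "nat \<Rightarrow> ('a::real_normed_vector list \<Rightarrow> 'b::real_normed_vector) \<Rightarrow> bool" where
  "bounded_multilinear k m \<longleftrightarrow>
     (\<forall>vs. length vs = k \<longrightarrow> (\<forall>i<k. linear (\<lambda>v. m (vs[i := v])))) \<and>
     (\<exists>C. \<forall>vs. length vs = k \<longrightarrow> norm (m vs) \<le> C * prod_list (map norm vs))"

text \<open>
  \<^term>\<open>D k x\<close> is the \<open>k\<close>-th Frechet derivative of \<open>f\<close> at \<open>x\<close>, a bounded \<open>k\<close>-linear map whose
  argument list has length \<open>k\<close>. The last clause says that \<^term>\<open>D k\<close>, as a map into the bounded
  \<open>k\<close>-linear maps with their operator norm, is Frechet differentiable at \<open>x\<close> with derivative
  \<^term>\<open>D (Suc k) x\<close>, the direction of differentiation being the first list entry. (Iterating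
  \<^typ>\<open>'a \<Rightarrow>\<^sub>L 'b\<close> would change the type with \<open>k\<close>.)
\<close>
definition smooth_on ::
    "'a::real_normed_vector set \<Rightarrow> ('a \<Rightarrow> 'b::real_normed_vector) \<Rightarrow> bool" where
  "smooth_on S f \<longleftrightarrow> open S \<and>
     (\<exists>D :: nat \<Rightarrow> 'a \<Rightarrow> 'a list \<Rightarrow> 'b.
        (\<forall>x\<in>S. D 0 x [] = f x) \<and>
        (\<forall>k. \<forall>x\<in>S. bounded_multilinear k (D k x)) \<and>
        (\<forall>k. \<forall>x\<in>S. \<forall>\<epsilon>>0. \<exists>\<delta>>0. \<forall>y\<in>S. dist y x < \<delta> \<longrightarrow>
           (\<forall>vs. length vs = k \<longrightarrow>
              norm (D k y vs - D k x vs - D (Suc k) x ((y - x) # vs))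
                \<le> \<epsilon> * norm (y - x) * prod_list (map norm vs))))"


section \<open>Manifolds modeled on a Hilbert space\<close>

text \<open>The manifold is the whole type \<open>'m\<close>, the model space is the type \<open>'e\<close>.\<close>

type_synonym ('m, 'e) chart = "'m set \<times> ('m \<Rightarrow> 'e)"

abbreviation chart_dom :: "('m, 'e) chart \<Rightarrow> 'm set" where
  "chart_dom c \<equiv> fst c"

abbreviation chart_map :: "('m, 'e) chart \<Rightarrow> 'm \<Rightarrow> 'e" where
  "chart_map c \<equiv> snd c"

definition chart_inv :: "('m, 'e) chart \<Rightarrow> 'e \<Rightarrow> 'm" where
  "chart_inv c = inv_into (chart_dom c) (chart_map c)"

locale hilbert_manifold =
  fixes A :: "('m::t2_space, 'e::{real_inner, complete_space}) chart set"
  assumes open_chart_dom: "c \<in> A \<Longrightarrow> open (chart_dom c)"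
    and open_chart_image: "c \<in> A \<Longrightarrow> open (chart_map c ` chart_dom c)"
    and chart_homeomorphism:
      "c \<in> A \<Longrightarrow>
         homeomorphism (chart_dom c) (chart_map c ` chart_dom c) (chart_map c) (chart_inv c)"
    and charts_cover: "(\<Union>c\<in>A. chart_dom c) = UNIV"
    and smooth_transition:
      "c \<in> A \<Longrightarrow> c' \<in> A \<Longrightarrow>
         smooth_on (chart_map c ` (chart_dom c \<inter> chart_dom c')) (chart_map c' \<circ> chart_inv c)"


section \<open>Tangent spaces\<close>

text \<open>
  A tangent vector at \<open>p\<close> is an equivalence class of pairs \<open>(c, v)\<close> of a chart \<open>c\<close> at \<open>p\<close> and a
  model vector \<open>v\<close>, two pairs being identified if the derivative of the transition map takes one
  vector to the other. Such a class is the graph of a function from the charts at \<open>p\<close> to the model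
  space, extended here by \<open>0\<close> to all charts.
\<close>

typedef ('m, 'e) tvec = "UNIV :: (('m, 'e) chart \<Rightarrow> 'e) set"
  morphisms coord Tvec ..

setup_lifting type_definition_tvec

instantiation tvec :: (type, real_vector) real_vector
begin

lift_definition zero_tvec :: "('a, 'b) tvec" is "\<lambda>c. 0" .
lift_definition plus_tvec :: "('a, 'b) tvec \<Rightarrow> ('a, 'b) tvec \<Rightarrow> ('a, 'b) tvec"
  is "\<lambda>u v c. u c + v c" .
lift_definition minus_tvec :: "('a, 'b) tvec \<Rightarrow> ('a, 'b) tvec \<Rightarrow> ('a, 'b) tvec"
  is "\<lambda>u v c. u c - v c" .
lift_definition uminus_tvec :: "('a, 'b) tvec \<Rightarrow> ('a, 'b) tvec" is "\<lambda>u c. - u c" .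
lift_definition scaleR_tvec :: "real \<Rightarrow> ('a, 'b) tvec \<Rightarrow> ('a, 'b) tvec"
  is "\<lambda>r u c. r *\<^sub>R u c" .

instance
  by standard (transfer; simp add: fun_eq_iff algebra_simps)+

end

definition tangent_space ::
    "('m, 'e::real_normed_vector) chart set \<Rightarrow> 'm \<Rightarrow> ('m, 'e) tvec set" where
  "tangent_space A p =
     {v. (\<forall>c\<in>A. \<forall>c'\<in>A. p \<in> chart_dom c \<longrightarrow> p \<in> chart_dom c' \<longrightarrow>
            coord v c' =
              frechet_derivative (chart_map c' \<circ> chart_inv c) (at (chart_map c p)) (coord v c)) \<and>
         (\<forall>c. \<not> (c \<in> A \<and> p \<in> chart_dom c) \<longrightarrow> coord v c = 0)}"

text \<open>The tangent vector at \<open>p\<close> whose coordinate in the chart \<open>c\<close> is \<open>x\<close>.\<close>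
definition of_coord ::
    "('m, 'e::real_normed_vector) chart set \<Rightarrow> ('m, 'e) chart \<Rightarrow> 'm \<Rightarrow> 'e \<Rightarrow> ('m, 'e) tvec" where
  "of_coord A c p x =
     Tvec (\<lambda>c'. if c' \<in> A \<and> p \<in> chart_dom c'
       then frechet_derivative (chart_map c' \<circ> chart_inv c) (at (chart_map c p)) x else 0)"

text \<open>The velocity of a curve defined on the interval \<open>I\<close> (one-sided at end points of \<open>I\<close>).\<close>
definition velocity ::
    "('m, 'e::real_normed_vector) chart set \<Rightarrow> real set \<Rightarrow> (real \<Rightarrow> 'm) \<Rightarrow> real \<Rightarrow> ('m, 'e) tvec" where
  "velocity A I \<gamma> t =
     Tvec (\<lambda>c. if c \<in> A \<and> \<gamma> t \<in> chart_dom c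
       then vector_derivative (chart_map c \<circ> \<gamma>) (at t within I) else 0)"


section \<open>Riemannian metrics\<close>

type_synonym ('m, 'e) metric = "'m \<Rightarrow> ('m, 'e) tvec \<Rightarrow> ('m, 'e) tvec \<Rightarrow> real"

definition tangent_norm :: "('m, 'e) metric \<Rightarrow> 'm \<Rightarrow> ('m, 'e) tvec \<Rightarrow> real" where
  "tangent_norm g p v = sqrt (g p v v)"

text \<open>
  The inner bilinear form is bounded by the norm equivalence required below, so that the two
  applications of \<^const>\<open>Blinfun\<close> are meaningful for \<open>x\<close> in the image of the chart.
\<close>
definition metric_in_chart ::
    "('m, 'e) chart set \<Rightarrow> ('m, 'e) metric \<Rightarrow> ('m, 'e) chart \<Rightarrow>
     'e::real_normed_vector \<Rightarrow> 'e \<Rightarrow>\<^sub>L 'e \<Rightarrow>\<^sub>L real" where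
  "metric_in_chart A g c x =
     Blinfun (\<lambda>v. Blinfun (\<lambda>w.
       g (chart_inv c x) (of_coord A c (chart_inv c x) v) (of_coord A c (chart_inv c x) w)))"

locale riemannian_manifold = hilbert_manifold A
  for A :: "('m::t2_space, 'e::{real_inner, complete_space}) chart set" +
  fixes g :: "('m, 'e) metric"
  assumes metric_add: "\<lbrakk>u \<in> tangent_space A p; v \<in> tangent_space A p; w \<in> tangent_space A p\<rbrakk>
      \<Longrightarrow> g p (u + v) w = g p u w + g p v w"
    and metric_scale: "\<lbrakk>u \<in> tangent_space A p; v \<in> tangent_space A p\<rbrakk>
      \<Longrightarrow> g p (r *\<^sub>R u) v = r * g p u v"
    and metric_sym: "\<lbrakk>u \<in> tangent_space A p; v \<in> tangent_space A p\<rbrakk> \<Longrightarrow> g p u v = g p v u"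
    and metric_pos: "\<lbrakk>v \<in> tangent_space A p; v \<noteq> 0\<rbrakk> \<Longrightarrow> g p v v > 0"
    and norm_equivalent: "\<lbrakk>c \<in> A; p \<in> chart_dom c\<rbrakk> \<Longrightarrow>
      \<exists>a>0. \<exists>b>0. \<forall>v\<in>tangent_space A p.
        a * norm (coord v c) \<le> tangent_norm g p v \<and> tangent_norm g p v \<le> b * norm (coord v c)"
    and metric_smooth: "c \<in> A \<Longrightarrow> smooth_on (chart_map c ` chart_dom c) (metric_in_chart A g c)"


section \<open>Riemannian distance\<close>

text \<open>Continuously differentiable on the closed interval, with one-sided derivatives at its ends.\<close>
definition C1_curve_on ::
    "('m::topological_space, 'e::real_normed_vector) chart set \<Rightarrow> real \<Rightarrow> real \<Rightarrow> (real \<Rightarrow> 'm) \<Rightarrow> bool"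
where
  "C1_curve_on A a b \<gamma> \<longleftrightarrow> continuous_on {a..b} \<gamma> \<and>
     (\<forall>c\<in>A. \<exists>\<gamma>'. continuous_on {t\<in>{a..b}. \<gamma> t \<in> chart_dom c} \<gamma>' \<and>
        (\<forall>t\<in>{a..b}. \<gamma> t \<in> chart_dom c \<longrightarrow>
           ((chart_map c \<circ> \<gamma>) has_vector_derivative \<gamma>' t) (at t within {a..b})))"

definition piecewise_C1_curve ::
    "('m::topological_space, 'e::real_normed_vector) chart set \<Rightarrow> (real \<Rightarrow> 'm) \<Rightarrow> bool" where
  "piecewise_C1_curve A \<gamma> \<longleftrightarrow> continuous_on {0..1} \<gamma> \<and>
     (\<exists>S. finite S \<and>
        (\<forall>a b. 0 \<le> a \<longrightarrow> a < b \<longrightarrow> b \<le> 1 \<longrightarrow> {a<..<b} \<inter> S = {} \<longrightarrow> C1_curve_on A a b \<gamma>))"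

text \<open>
  The finitely many parameters where a piecewise \<open>C\<^sup>1\<close> curve has no velocity do not affect the
  integral.
\<close>
definition curve_length ::
    "('m, 'e::real_normed_vector) chart set \<Rightarrow> ('m, 'e) metric \<Rightarrow> (real \<Rightarrow> 'm) \<Rightarrow> real" where
  "curve_length A g \<gamma> = integral {0..1} (\<lambda>t. tangent_norm g (\<gamma> t) (velocity A {0..1} \<gamma> t))"

text \<open>The manifold need not be connected; the distance between different components is \<open>\<infinity>\<close>.\<close>
definition riem_dist ::
    "('m::topological_space, 'e::real_normed_vector) chart set \<Rightarrow> ('m, 'e) metric \<Rightarrow>
     'm \<Rightarrow> 'm \<Rightarrow> ereal" where
  "riem_dist A g p q =
     (INF \<gamma>\<in>{\<gamma>. piecewise_C1_curve A \<gamma> \<and> \<gamma> 0 = p \<and> \<gamma> 1 = q}. ereal (curve_length A g \<gamma>))"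

definition dist_to_set ::
    "('m::topological_space, 'e::real_normed_vector) chart set \<Rightarrow> ('m, 'e) metric \<Rightarrow>
     'm set \<Rightarrow> 'm \<Rightarrow> ereal" where
  "dist_to_set A g \<Omega> u = (INF q\<in>\<Omega>. riem_dist A g u q)"


section \<open>The exponential map\<close>

text \<open>
  The Christoffel map of the Levi-Civita connection in the chart \<open>c\<close>: the Koszul formula for
  coordinate-constant vector fields determines \<open>u\<close> uniquely, by the Riesz theorem.
\<close>
definition christoffel ::
    "('m, 'e) chart set \<Rightarrow> ('m, 'e) metric \<Rightarrow> ('m, 'e) chart \<Rightarrow>
     'e::real_normed_vector \<Rightarrow> 'e \<Rightarrow> 'e \<Rightarrow> 'e" where
  "christoffel A g c x v w =
     (let G = metric_in_chart A g c; DG = frechet_derivative G (at x) in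
      THE u. \<forall>z. 2 * blinfun_apply (blinfun_apply (G x) u) z =
        blinfun_apply (blinfun_apply (DG v) w) z
        + blinfun_apply (blinfun_apply (DG w) v) z
        - blinfun_apply (blinfun_apply (DG z) v) w)"

definition geodesic_on ::
    "('m::topological_space, 'e::real_normed_vector) chart set \<Rightarrow> ('m, 'e) metric \<Rightarrow>
     real set \<Rightarrow> (real \<Rightarrow> 'm) \<Rightarrow> bool" where
  "geodesic_on A g I \<gamma> \<longleftrightarrow> continuous_on I \<gamma> \<and>
     (\<forall>c\<in>A. \<exists>\<gamma>' \<gamma>''. \<forall>t\<in>I. \<gamma> t \<in> chart_dom c \<longrightarrow>
        ((chart_map c \<circ> \<gamma>) has_vector_derivative \<gamma>' t) (at t within I) \<and>
        (\<gamma>' has_vector_derivative \<gamma>'' t) (at t within I) \<and>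
        \<gamma>'' t = - christoffel A g c (chart_map c (\<gamma> t)) (\<gamma>' t) (\<gamma>' t))"

definition exp_geodesic ::
    "('m::topological_space, 'e::real_normed_vector) chart set \<Rightarrow> ('m, 'e) metric \<Rightarrow>
     'm \<Rightarrow> ('m, 'e) tvec \<Rightarrow> (real \<Rightarrow> 'm) \<Rightarrow> bool" where
  "exp_geodesic A g p v \<gamma> \<longleftrightarrow>
     geodesic_on A g {0..1} \<gamma> \<and> \<gamma> 0 = p \<and> velocity A {0..1} \<gamma> 0 = v"

definition exp_domain ::
    "('m::topological_space, 'e::real_normed_vector) chart set \<Rightarrow> ('m, 'e) metric \<Rightarrow>
     'm \<Rightarrow> ('m, 'e) tvec set" where
  "exp_domain A g p = {v \<in> tangent_space A p. \<exists>\<gamma>. exp_geodesic A g p v \<gamma>}"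

text \<open>The value is unspecified outside \<^const>\<open>exp_domain\<close>.\<close>
definition riem_exp ::
    "('m::topological_space, 'e::real_normed_vector) chart set \<Rightarrow> ('m, 'e) metric \<Rightarrow>
     'm \<Rightarrow> ('m, 'e) tvec \<Rightarrow> 'm" where
  "riem_exp A g p v = (THE q. \<exists>\<gamma>. exp_geodesic A g p v \<gamma> \<and> \<gamma> 1 = q)"

text \<open>
  \<open>U\<close> is an open neighborhood of \<open>0\<close> in the tangent space at \<open>p\<close> which the exponential map takes
  diffeomorphically onto an open neighborhood of \<open>p\<close>. Topology and smooth structure of the tangent
  space are those of the model space, transported by the coordinate map of any chart at \<open>p\<close>.
\<close>
definition exp_neighborhood ::
    "('m::topological_space, 'e::real_normed_vector) chart set \<Rightarrow> ('m, 'e) metric \<Rightarrow>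
     'm \<Rightarrow> ('m, 'e) tvec set \<Rightarrow> bool" where
  "exp_neighborhood A g p U \<longleftrightarrow>
     U \<subseteq> exp_domain A g p \<and> 0 \<in> U \<and>
     inj_on (riem_exp A g p) U \<and> open (riem_exp A g p ` U) \<and>
     (\<forall>c\<in>A. p \<in> chart_dom c \<longrightarrow>
        open ((\<lambda>v. coord v c) ` U) \<and>
        (\<forall>c'\<in>A.
           smooth_on ((\<lambda>v. coord v c) ` {v\<in>U. riem_exp A g p v \<in> chart_dom c'})
             (\<lambda>x. chart_map c' (riem_exp A g p (of_coord A c p x))) \<and>
           smooth_on (chart_map c' ` (chart_dom c' \<inter> riem_exp A g p ` U))
             (\<lambda>y. coord (inv_into U (riem_exp A g p) (chart_inv c' y)) c)))"


section \<open>Frechet subdifferentials and normal cones\<close>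

text \<open>
  The tangent space at \<open>p\<close> is a subspace rather than a type, and its norm depends on \<open>p\<close>. So here
  a normed space is a subspace \<open>V\<close> with a norm \<open>N\<close> on it, and functionals on it are made unique by
  being \<^const>\<open>undefined\<close> outside \<open>V\<close>.
\<close>

definition dual_space :: "'v::real_vector set \<Rightarrow> ('v \<Rightarrow> real) \<Rightarrow> ('v \<Rightarrow> real) set" where
  "dual_space V N =
     {\<xi> \<in> extensional V.
        (\<forall>u\<in>V. \<forall>v\<in>V. \<xi> (u + v) = \<xi> u + \<xi> v) \<and>
        (\<forall>r. \<forall>v\<in>V. \<xi> (r *\<^sub>R v) = r * \<xi> v) \<and>
        (\<exists>C. \<forall>v\<in>V. \<bar>\<xi> v\<bar> \<le> C * N v)}"

definition dual_norm :: "'v set \<Rightarrow> ('v \<Rightarrow> real) \<Rightarrow> ('v \<Rightarrow> real) \<Rightarrow> real" where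
  "dual_norm V N \<xi> = (SUP v\<in>{v\<in>V. N v \<le> 1}. \<bar>\<xi> v\<bar>)"

definition dual_unit_ball :: "'v::real_vector set \<Rightarrow> ('v \<Rightarrow> real) \<Rightarrow> ('v \<Rightarrow> real) set" where
  "dual_unit_ball V N = {\<xi> \<in> dual_space V N. dual_norm V N \<xi> \<le> 1}"

text \<open>The filter of \<open>u \<rightarrow> x\<close> with \<open>u \<in> B\<close> and \<open>u \<noteq> x\<close>.\<close>
definition norm_at_within :: "('v::real_vector \<Rightarrow> real) \<Rightarrow> 'v \<Rightarrow> 'v set \<Rightarrow> 'v filter" where
  "norm_at_within N x B = (INF \<epsilon>\<in>{0<..}. principal {u\<in>B. u \<noteq> x \<and> N (u - x) < \<epsilon>})"

definition frechet_subdifferential ::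
    "'v::real_vector set \<Rightarrow> ('v \<Rightarrow> real) \<Rightarrow> ('v \<Rightarrow> ereal) \<Rightarrow> 'v \<Rightarrow> ('v \<Rightarrow> real) set" where
  "frechet_subdifferential V N h x =
     {\<xi> \<in> dual_space V N.
        0 \<le> Liminf (norm_at_within N x V)
              (\<lambda>u. (h u - h x - ereal (\<xi> (u - x))) / ereal (N (u - x)))}"

definition frechet_normal_cone ::
    "'v::real_vector set \<Rightarrow> ('v \<Rightarrow> real) \<Rightarrow> 'v set \<Rightarrow> 'v \<Rightarrow> ('v \<Rightarrow> real) set" where
  "frechet_normal_cone V N B x =
     {\<xi> \<in> dual_space V N.
        Limsup (norm_at_within N x B) (\<lambda>u. ereal (\<xi> (u - x) / N (u - x))) \<le> 0}"

definition riem_subdifferential ::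
    "('m::topological_space, 'e::real_normed_vector) chart set \<Rightarrow> ('m, 'e) metric \<Rightarrow>
     ('m \<Rightarrow> ereal) \<Rightarrow> 'm \<Rightarrow> (('m, 'e) tvec \<Rightarrow> real) set" where
  "riem_subdifferential A g f p =
     frechet_subdifferential (tangent_space A p) (tangent_norm g p) (f \<circ> riem_exp A g p) 0"

text \<open>
  \<open>U\<close> is the neighborhood of \<open>0\<close> to which the exponential map at \<open>p\<close> is restricted in order to be
  inverted. For the subdifferential only the germ of the exponential map at \<open>0\<close> matters.
\<close>
definition riem_normal_cone ::
    "('m::topological_space, 'e::real_normed_vector) chart set \<Rightarrow> ('m, 'e) metric \<Rightarrow>
     ('m, 'e) tvec set \<Rightarrow> 'm set \<Rightarrow> 'm \<Rightarrow> (('m, 'e) tvec \<Rightarrow> real) set" where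
  "riem_normal_cone A g U \<Omega> p =
     frechet_normal_cone (tangent_space A p) (tangent_norm g p)
       (inv_into U (riem_exp A g p) ` (\<Omega> \<inter> riem_exp A g p ` U)) 0"

definition cotangent_unit_ball ::
    "('m, 'e::real_normed_vector) chart set \<Rightarrow> ('m, 'e) metric \<Rightarrow>
     'm \<Rightarrow> (('m, 'e) tvec \<Rightarrow> real) set" where
  "cotangent_unit_ball A g p = dual_unit_ball (tangent_space A p) (tangent_norm g p)"

end

theory Submission
  imports Defs
begin

text \<open>
  In the exponential chart at \<open>p\<close> the Riemannian distance and the norm of \<open>T\<^sub>p M\<close> agree to first
  order: \<open>d (exp u) (exp w) = \<parallel>u - w\<parallel> + o(\<parallel>u\<parallel> + \<parallel>w\<parallel>)\<close>. To see this, compare lengths in an arbitrary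
  chart at \<open>p\<close>, where the metric is continuous, and use that the exponential map has derivative the
  identity at \<open>0\<close>, as geodesics are unique. Granted this, a subgradient of the distance to \<open>\<Omega>\<close> is
  normal because the distance vanishes on \<open>\<Omega>\<close>, and has norm at most \<open>1\<close> because the distance is at
  most \<open>(1 + \<epsilon>) \<parallel>u\<parallel>\<close>. Conversely, let \<open>\<xi>\<close> be normal of norm at most \<open>1\<close>. An almost nearest point
  \<open>exp w\<close> of \<open>\<Omega>\<close> to \<open>exp u\<close> satisfies \<open>\<parallel>w\<parallel> \<le> 4 \<parallel>u\<parallel>\<close>, so that
  \<open>\<xi> u = \<xi> (u - w) + \<xi> w \<le> \<parallel>u - w\<parallel> + o(\<parallel>u\<parallel>)\<close>.
\<close>

section \<open>Derivatives of smooth maps\<close>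

text \<open>The model space may be infinite-dimensional, so balls need not be compact. Uniform
  bounds near a point are taken from the next higher derivative at that point, and completeness of
  the model space keeps a short curve inside a chart ball. Tangent spaces are subsets of a type on
  which the metric obeys no law elsewhere, so forms are pulled back to the model space before they
  are estimated. The Christoffel map and the exponential map are definite descriptions: a Riesz
  theorem for coercive forms gives the former a value, and uniqueness of geodesics the latter,
  through a local Lipschitz bound for the Christoffel map. Smoothness of the exponential map on
  \<open>U\<close> is part of \<open>exp_neighborhood\<close>; its derivative at \<open>0\<close> is
  therefore linear and can be computed along rays, where rescaled geodesics give the answer. The
  distance estimate has \<open>\<parallel>w\<parallel>\<close> in its error term; for small
  coefficients this term can be absorbed, and that yields
  \<open>\<parallel>w\<parallel> \<le> 4 \<parallel>u\<parallel>\<close>.\<close>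

definition higher_derivatives ::
    "'a::real_normed_vector set \<Rightarrow> ('a \<Rightarrow> 'b::real_normed_vector) \<Rightarrow> (nat \<Rightarrow> 'a \<Rightarrow> 'a list \<Rightarrow> 'b) \<Rightarrow> bool"
where
  "higher_derivatives S f D \<longleftrightarrow> open S \<and>
     (\<forall>x\<in>S. D 0 x [] = f x) \<and>
     (\<forall>k. \<forall>x\<in>S. bounded_multilinear k (D k x)) \<and>
     (\<forall>k. \<forall>x\<in>S. \<forall>\<epsilon>>0. \<exists>\<delta>>0. \<forall>y\<in>S. dist y x < \<delta> \<longrightarrow>
        (\<forall>vs. length vs = k \<longrightarrow>
           norm (D k y vs - D k x vs - D (Suc k) x ((y - x) # vs))
             \<le> \<epsilon> * norm (y - x) * prod_list (map norm vs)))"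

lemma higher_derivativesD:
  assumes "higher_derivatives S f D"
  shows "open S"
    and "x \<in> S \<Longrightarrow> D 0 x [] = f x"
    and "x \<in> S \<Longrightarrow> bounded_multilinear k (D k x)"
    and "x \<in> S \<Longrightarrow> \<epsilon> > 0 \<Longrightarrow> \<exists>\<delta>>0. \<forall>y\<in>S. dist y x < \<delta> \<longrightarrow>
        (\<forall>vs. length vs = k \<longrightarrow>
           norm (D k y vs - D k x vs - D (Suc k) x ((y - x) # vs))
             \<le> \<epsilon> * norm (y - x) * prod_list (map norm vs))"
  using assms unfolding higher_derivatives_def by simp_all

lemma smooth_on_iff_higher_derivatives: "smooth_on S f \<longleftrightarrow> (\<exists>D. higher_derivatives S f D)"
  unfolding smooth_on_def higher_derivatives_def by simp

lemma bounded_multilinear_slot: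
  assumes "bounded_multilinear (Suc k) m" "length vs = k"
  shows "bounded_linear (\<lambda>v. m (v # vs))"
proof -
  have len: "length (0 # vs) = Suc k" using assms by simp
  have "linear (\<lambda>v. m ((0 # vs)[0 := v]))"
    using assms(1) len unfolding bounded_multilinear_def by blast
  then have l: "linear (\<lambda>v. m (v # vs))" by simp
  obtain C where C: "\<And>ws. length ws = Suc k \<Longrightarrow> norm (m ws) \<le> C * prod_list (map norm ws)"
    using assms(1) unfolding bounded_multilinear_def by blast
  show ?thesis
  proof (rule bounded_linear_intro[where K="C * prod_list (map norm vs)"])
    fix x show "norm (m (x # vs)) \<le> norm x * (C * prod_list (map norm vs))"
      using C[of "x # vs"] assms(2) by (simp add: algebra_simps)
  qed (use linear_add[OF l] linear_scale[OF l] in auto)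
qed

text \<open>Freezing the argument list turns the operator-norm estimate of the tower into ordinary
  differentiability of a map between normed spaces, to which the mean value inequality
  applies.\<close>

lemma higher_derivatives_has_derivative:
  assumes D: "higher_derivatives S f D"
    and x: "x \<in> S" and len: "length vs = k"
  shows "((\<lambda>x. D k x vs) has_derivative (\<lambda>v. D (Suc k) x (v # vs))) (at x)"
proof -
  have "((\<lambda>x. D k x vs) has_derivative (\<lambda>v. D (Suc k) x (v # vs))) (at x within S)"
    unfolding has_derivative_within_alt
  proof (intro conjI allI impI)
    show "bounded_linear (\<lambda>v. D (Suc k) x (v # vs))"
      using bounded_multilinear_slot[OF higher_derivativesD(3)[OF D x] len] .
    fix e :: real assume e: "e > 0"
    \<comment> \<open>The \<open>+ 1\<close> keeps the divisor positive when an entry of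
      \<open>vs\<close> vanishes.\<close>
    define P where "P = prod_list (map norm vs) + 1"
    have pn: "prod_list (map norm vs) \<ge> 0" by (induction vs) auto
    then have P: "P > 0" unfolding P_def by simp
    obtain d where d: "d > 0" "\<And>y. y \<in> S \<Longrightarrow> dist y x < d \<Longrightarrow> 
       norm (D k y vs - D k x vs - D (Suc k) x ((y - x) # vs))
                \<le> e / P * norm (y - x) * prod_list (map norm vs)"
      using higher_derivativesD(4)[OF D x, of "e / P" k] e P len by auto
    show "\<exists>d>0. \<forall>y\<in>S. norm (y - x) < d \<longrightarrow>
          norm (D k y vs - D k x vs - D (Suc k) x ((y - x) # vs)) \<le> e * norm (y - x)"
    proof (intro exI conjI ballI impI)
      fix y assume y: "y \<in> S" "norm (y - x) < d"
      have "norm (D k y vs - D k x vs - D (Suc k) x ((y - x) # vs))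
         \<le> e / P * norm (y - x) * prod_list (map norm vs)"
        using d(2)[OF y(1)] y(2) by (simp add: dist_norm)
      also have "\<dots> \<le> e / P * norm (y - x) * P"
        using P e by (intro mult_left_mono) (auto simp: P_def)
      also have "\<dots> = e * norm (y - x)" using P by simp
      finally show "norm (D k y vs - D k x vs - D (Suc k) x ((y - x) # vs)) \<le> e * norm (y - x)" .
    qed (use d in auto)
  qed
  then show ?thesis using at_within_open[OF x higher_derivativesD(1)[OF D]] by simp
qed

lemma smooth_on_has_derivative:
  assumes "smooth_on S f" "x \<in> S"
  shows "(f has_derivative frechet_derivative f (at x)) (at x)"
proof -
  obtain D where D: "higher_derivatives S f D"
    using assms(1) unfolding smooth_on_iff_higher_derivatives by blast
  have "((\<lambda>x. D 0 x []) has_derivative (\<lambda>v. D (Suc 0) x (v # []))) (at x)"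
    by (rule higher_derivatives_has_derivative[OF D assms(2)]) simp
  then have "(f has_derivative (\<lambda>v. D (Suc 0) x (v # []))) (at x)"
    by (rule has_derivative_transform_within_open[OF _ higher_derivativesD(1)[OF D] assms(2)]) (use higher_derivativesD(2)[OF D] in simp)
  then show ?thesis
    using frechet_derivative_works differentiableI by blast
qed

text \<open>Without compact balls the bounds come from differentiability of \<open>D 2\<close> at
  the single point \<open>x0\<close>: it bounds \<open>D 2\<close> near \<open>x0\<close>, and the
  mean value inequality on the convex ball then makes \<open>D 1\<close> Lipschitz there.\<close>

lemma smooth_on_local_Lipschitz_derivative:
  assumes "smooth_on S f" "x0 \<in> S"
  obtains r C where "r > 0" "C > 0" "ball x0 r \<subseteq> S"
    "\<And>x v. x \<in> ball x0 r \<Longrightarrow> norm (frechet_derivative f (at x) v) \<le> C * norm v"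
    "\<And>x y v. x \<in> ball x0 r \<Longrightarrow> y \<in> ball x0 r \<Longrightarrow>
       norm (frechet_derivative f (at x) v - frechet_derivative f (at y) v)
         \<le> C * norm (x - y) * norm v"
proof -
  obtain D where D: "higher_derivatives S f D"
    using assms(1) unfolding smooth_on_iff_higher_derivatives by blast
  have f'_eq: "frechet_derivative f (at x) = (\<lambda>v. D 1 x [v])" if x: "x \<in> S" for x
  proof -
    have "((\<lambda>x. D 0 x []) has_derivative (\<lambda>v. D (Suc 0) x (v # []))) (at x)"
      by (rule higher_derivatives_has_derivative[OF D x]) simp
    then have "(f has_derivative (\<lambda>v. D (Suc 0) x (v # []))) (at x)"
      by (rule has_derivative_transform_within_open[OF _ higher_derivativesD(1)[OF D] x]) (use higher_derivativesD(2)[OF D] in simp)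
    then show ?thesis by (simp add: frechet_derivative_at[symmetric])
  qed
  obtain C2 where C2: "\<And>vs. length vs = 2 \<Longrightarrow> norm (D 2 x0 vs) \<le> C2 * prod_list (map norm vs)"
    using higher_derivativesD(3)[OF D assms(2), of 2] unfolding bounded_multilinear_def by blast
  obtain C3 where C3: "\<And>vs. length vs = 3 \<Longrightarrow> norm (D 3 x0 vs) \<le> C3 * prod_list (map norm vs)"
    using higher_derivativesD(3)[OF D assms(2), of 3] unfolding bounded_multilinear_def by blast
  obtain C1 where C1: "\<And>vs. length vs = 1 \<Longrightarrow> norm (D 1 x0 vs) \<le> C1 * prod_list (map norm vs)"
    using higher_derivativesD(3)[OF D assms(2), of 1] unfolding bounded_multilinear_def by blast
  obtain d where d: "d > 0" "\<And>y vs. y \<in> S \<Longrightarrow> dist y x0 < d \<Longrightarrow> length vs = 2 \<Longrightarrow>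
     norm (D 2 y vs - D 2 x0 vs - D (Suc 2) x0 ((y - x0) # vs)) \<le> 1 * norm (y - x0) * prod_list (map norm vs)"
    using higher_derivativesD(4)[OF D assms(2), of 1 2] by auto
  obtain r0 where r0: "r0 > 0" "ball x0 r0 \<subseteq> S" using higher_derivativesD(1)[OF D] assms(2) openE by blast
  define r where "r = min (min d r0) 1"
  have r: "r > 0" "r \<le> d" "r \<le> 1" "ball x0 r \<subseteq> S" 
    using d r0 unfolding r_def by auto
  \<comment> \<open>The summands bound \<open>D 2 x0\<close>, \<open>D 3 x0\<close> and the
    remainder of the expansion of \<open>D 2\<close>; the last two use
    \<open>norm (y - x0) \<le> 1\<close>.\<close>
  define B where "B = \<bar>C2\<bar> + \<bar>C3\<bar> + 1"
  have D2: "norm (D 2 y [u, v]) \<le> B * norm u * norm v" if y: "y \<in> ball x0 r" for y u v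
  proof -
    have yx: "norm (y - x0) < r" using y by (simp add: dist_norm norm_minus_commute)
    have "norm (D 2 y [u,v]) \<le> norm (D 2 y [u,v] - D 2 x0 [u,v] - D (Suc 2) x0 ((y - x0) # [u,v]))
       + norm (D 2 x0 [u,v]) + norm (D 3 x0 [y - x0, u, v])"
      using norm_triangle_ineq[of "D 2 y [u,v] - D 2 x0 [u,v] - D 3 x0 [y - x0,u,v]" "D 2 x0 [u,v] + D 3 x0 [y - x0, u, v]"]
        norm_triangle_ineq[of "D 2 x0 [u,v]" "D 3 x0 [y - x0, u, v]"] by (simp add: numeral_3_eq_3 numeral_2_eq_2)
    also have "norm (D 2 y [u,v] - D 2 x0 [u,v] - D (Suc 2) x0 ((y - x0) # [u,v])) \<le> 1 * norm (y - x0) * prod_list (map norm [u,v])"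
      using yx r y by (intro d(2)) (auto simp: dist_norm)
    also have "\<dots> \<le> 1 * (norm u * norm v)" using yx r by (simp add: mult_left_le_one_le)
    also have "norm (D 2 x0 [u,v]) \<le> \<bar>C2\<bar> * (norm u * norm v)"
      by (rule order_trans[OF C2]) (auto intro!: mult_right_mono)
    also have "norm (D 3 x0 [y - x0, u, v]) \<le> C3 * prod_list (map norm [y - x0, u, v])" by (rule C3) simp
    also have "\<dots> \<le> \<bar>C3\<bar> * (1 * (norm u * norm v))"
    proof -
      have "C3 * prod_list (map norm [y - x0, u, v]) = C3 * (norm (y - x0) * (norm u * norm v))" by simp
      also have "\<dots> \<le> \<bar>C3\<bar> * (norm (y - x0) * (norm u * norm v))" by (intro mult_right_mono) auto
      also have "\<dots> \<le> \<bar>C3\<bar> * (1 * (norm u * norm v))" using yx r by (intro mult_left_mono mult_right_mono) auto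
      finally show ?thesis .
    qed
    finally show ?thesis by (simp add: B_def algebra_simps)
  qed
  have Lip: "norm (D 1 x [v] - D 1 y [v]) \<le> B * norm v * norm (x - y)" if "x \<in> ball x0 r" "y \<in> ball x0 r" for x y v
  proof (rule differentiable_bound[where S="ball x0 r" and f="\<lambda>x. D 1 x [v]" and f'="\<lambda>x u. D 2 x [u, v]"])
    fix x assume x: "x \<in> ball x0 r"
    then have "x \<in> S" using r by auto
    then show "((\<lambda>x. D 1 x [v]) has_derivative (\<lambda>u. D 2 x [u, v])) (at x within ball x0 r)"
      using higher_derivatives_has_derivative[OF D, of x "[v]" 1] x r
      by (auto intro: has_derivative_at_withinI simp: numeral_2_eq_2)
    show "onorm (\<lambda>u. D 2 x [u, v]) \<le> B * norm v"
      by (rule onorm_bound) (use D2[OF x] in \<open>auto simp: B_def algebra_simps\<close>)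
  qed (use that in auto)
  have D1: "norm (D 1 x [v]) \<le> (\<bar>C1\<bar> + B) * norm v" if x: "x \<in> ball x0 r" for x v
  proof -
    have xx: "norm (x - x0) < r" using x by (simp add: dist_norm norm_minus_commute)
    have "norm (D 1 x [v]) \<le> norm (D 1 x [v] - D 1 x0 [v]) + norm (D 1 x0 [v])"
      using norm_triangle_ineq[of "D 1 x [v] - D 1 x0 [v]" "D 1 x0 [v]"] by simp
    also have "norm (D 1 x [v] - D 1 x0 [v]) \<le> B * norm v * norm (x - x0)" using Lip[OF x] r by simp
    also have "\<dots> \<le> B * norm v * 1" using xx r by (intro mult_left_mono) (auto simp: B_def)
    also have "norm (D 1 x0 [v]) \<le> \<bar>C1\<bar> * norm v"
      by (rule order_trans[OF C1]) (auto intro!: mult_right_mono)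
    finally show ?thesis by (simp add: algebra_simps)
  qed
  show ?thesis
  proof (rule that[of r "\<bar>C1\<bar> + B"])
    show "0 < \<bar>C1\<bar> + B" by (simp add: B_def)
    fix x y v assume x: "x \<in> ball x0 r"
    then show "norm (frechet_derivative f (at x) v) \<le> (\<bar>C1\<bar> + B) * norm v"
      using D1[OF x] f'_eq r by auto
    assume y: "y \<in> ball x0 r"
    have "norm (D 1 x [v] - D 1 y [v]) \<le> B * norm v * norm (x - y)" by (rule Lip[OF x y])
    also have "\<dots> \<le> (\<bar>C1\<bar> + B) * (norm v * norm (x - y))" 
      unfolding mult.assoc by (intro mult_right_mono) auto
    finally show "norm (frechet_derivative f (at x) v - frechet_derivative f (at y) v)
         \<le> (\<bar>C1\<bar> + B) * norm (x - y) * norm v"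
      using x y f'_eq r by (auto simp: algebra_simps subset_iff)
  qed (use r in auto)
qed

text \<open>Base point and vector vary together: the Lipschitz bound handles the change of the
  point, the operator bound that of the vector. This gives continuity of the velocity of a chart
  segment seen in a second chart.\<close>

lemma continuous_on_smooth_derivative:
  fixes a :: "'t::topological_space \<Rightarrow> 'a::real_normed_vector"
  assumes f: "smooth_on S f" and a: "continuous_on T a" and b: "continuous_on T b" and sub: "a ` T \<subseteq> S"
  shows "continuous_on T (\<lambda>t. frechet_derivative f (at (a t)) (b t))"
  unfolding continuous_on_def
proof
  fix t assume t: "t \<in> T"
  then have at_S: "a t \<in> S" using sub by auto
  show "((\<lambda>t. frechet_derivative f (at (a t)) (b t)) \<longlongrightarrow> frechet_derivative f (at (a t)) (b t)) (at t within T)"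
  proof (rule smooth_on_local_Lipschitz_derivative[OF f at_S])
    fix r C assume r: "r > 0" "C > 0" "ball (a t) r \<subseteq> S"
      "\<And>x v. x \<in> ball (a t) r \<Longrightarrow> norm (frechet_derivative f (at x) v) \<le> C * norm v"
      "\<And>x y v. x \<in> ball (a t) r \<Longrightarrow> y \<in> ball (a t) r \<Longrightarrow>
         norm (frechet_derivative f (at x) v - frechet_derivative f (at y) v)
           \<le> C * norm (x - y) * norm v"
    have at: "(a \<longlongrightarrow> a t) (at t within T)" and bt: "(b \<longlongrightarrow> b t) (at t within T)"
      using a b t by (auto simp: continuous_on_def)
    have ev: "eventually (\<lambda>s. a s \<in> ball (a t) r \<and> s \<in> T) (at t within T)"
      unfolding eventually_conj_iff
      using tendstoD[OF at r(1)] eventually_at_topological[of "\<lambda>s. s \<in> T" t T] by (auto simp: dist_commute)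
    show "((\<lambda>t. frechet_derivative f (at (a t)) (b t)) \<longlongrightarrow> frechet_derivative f (at (a t)) (b t)) (at t within T)"
    proof (rule LIM_zero_cancel, rule Lim_null_comparison)
      show "eventually (\<lambda>s. norm (frechet_derivative f (at (a s)) (b s) - frechet_derivative f (at (a t)) (b t))
         \<le> C * norm (a s - a t) * norm (b s) + C * norm (b s - b t)) (at t within T)"
        using ev
      proof eventually_elim
        case (elim s)
        let ?f = "\<lambda>x. frechet_derivative f (at x)"
        have lin: "linear (?f (a t))"
          using smooth_on_has_derivative[OF f at_S] has_derivative_linear by blast
        have "?f (a s) (b s) - ?f (a t) (b t) = (?f (a s) (b s) - ?f (a t) (b s)) + ?f (a t) (b s - b t)"
          using linear_diff[OF lin] by simp
        also have "norm \<dots> \<le> norm (?f (a s) (b s) - ?f (a t) (b s)) + norm (?f (a t) (b s - b t))"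
          by (rule norm_triangle_ineq)
        also have "\<dots> \<le> C * norm (a s - a t) * norm (b s) + C * norm (b s - b t)"
          using r elim by (intro add_mono r) auto
        finally show ?case .
      qed
      have "((\<lambda>s. C * norm (a s - a t) * norm (b s) + C * norm (b s - b t)) \<longlongrightarrow> C * norm (a t - a t) * norm (b t) + C * norm (b t - b t)) (at t within T)"
        by (intro tendsto_intros at bt)
      then show "((\<lambda>s. C * norm (a s - a t) * norm (b s) + C * norm (b s - b t)) \<longlongrightarrow> 0) (at t within T)" by simp
    qed
  qed
qed

section \<open>Coercive forms, tangent spaces and the metric in a chart\<close>

text \<open>The form is total on a type, whereas the metric obeys its laws on tangent spaces;
  instances are metrics pulled back to the model space. Definiteness enters separately, as
  coercivity.\<close>

locale psd_form =
  fixes B :: "'v::real_vector \<Rightarrow> 'v \<Rightarrow> real"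
  assumes add_left: "B (x + y) z = B x z + B y z"
    and scale_left: "B (r *\<^sub>R x) y = r * B x y"
    and sym: "B x y = B y x"
    and nonneg: "B x x \<ge> 0"
begin

lemma add_right: "B z (x + y) = B z x + B z y"
  using add_left sym by metis

lemma scale_right: "B x (r *\<^sub>R y) = r * B x y"
  using scale_left sym by metis

lemma Cauchy_Schwarz_square: "(B x y)\<^sup>2 \<le> B x x * B y y"
proof -
  have q: "0 \<le> B x x * t\<^sup>2 + 2 * B x y * t + B y y" for t
  proof -
    have "0 \<le> B (t *\<^sub>R x + y) (t *\<^sub>R x + y)" by (rule nonneg)
    also have "\<dots> = B x x * t\<^sup>2 + 2 * B x y * t + B y y"
      by (simp add: add_left add_right scale_left scale_right sym[of y x] power2_eq_square algebra_simps)
    finally show ?thesis .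
  qed
  show ?thesis
  proof (cases "B x x = 0")
    case True
    have "B x y = 0"
    proof (rule ccontr)
      assume "B x y \<noteq> 0"
      \<comment> \<open>When \<open>B x x = 0\<close> the expression is affine in \<open>t\<close>,
        and this \<open>t\<close> makes it equal to \<open>-1\<close>.\<close>
      then show False using q[of "- (B y y + 1) / (2 * B x y)"] True by simp
    qed
    then show ?thesis using True by simp
  next
    case False
    then have p: "B x x > 0" using nonneg[of x] by simp
    \<comment> \<open>The minimiser of the quadratic in \<open>t\<close>, with the denominator
      cleared.\<close>
    have "0 \<le> B x x * (B x x * (- B x y / B x x)\<^sup>2 + 2 * B x y * (- B x y / B x x) + B y y)"
      using q[of "- B x y / B x x"] p by simp
    also have "\<dots> = B x x * B y y - (B x y)\<^sup>2"
      using p by (simp add: field_simps power2_eq_square)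
    finally show ?thesis by simp
  qed
qed

lemma Cauchy_Schwarz: "\<bar>B x y\<bar> \<le> sqrt (B x x) * sqrt (B y y)"
  using real_sqrt_le_mono[OF Cauchy_Schwarz_square[of x y]] by (simp add: real_sqrt_mult)

lemma sqrt_triangle: "sqrt (B (x + y) (x + y)) \<le> sqrt (B x x) + sqrt (B y y)"
proof (rule real_le_lsqrt)
  have "B (x + y) (x + y) = B x x + 2 * B x y + B y y"
    by (simp add: add_left add_right sym[of y x])
  also have "\<dots> \<le> (sqrt (B x x) + sqrt (B y y))\<^sup>2"
    using Cauchy_Schwarz[of x y] nonneg by (simp add: power2_sum)
  finally show "B (x + y) (x + y) \<le> (sqrt (B x x) + sqrt (B y y))\<^sup>2" .
qed (simp add: nonneg)

lemma sqrt_scale: "sqrt (B (r *\<^sub>R x) (r *\<^sub>R x)) = \<bar>r\<bar> * sqrt (B x x)"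
  by (simp add: scale_left scale_right real_sqrt_mult flip: mult.assoc)

end

text \<open>The solution minimises \<open>u \<mapsto> B u u / 2 - l u\<close>; minimising sequences are Cauchy by the
  parallelogram law.\<close>

lemma Riesz_coercive:
  fixes B :: "'e::{real_inner, complete_space} \<Rightarrow>\<^sub>L 'e \<Rightarrow>\<^sub>L real" and l :: "'e \<Rightarrow>\<^sub>L real"
  assumes sym: "\<And>v w. B v w = B w v" and a: "a > 0" and co: "\<And>v. a * (norm v)\<^sup>2 \<le> B v v"
  shows "\<exists>!u. \<forall>z. B u z = l z"
proof -
  note lin = blinfun.add_left blinfun.add_right blinfun.diff_left blinfun.diff_right
    blinfun.scaleR_left blinfun.scaleR_right
  define J where "J u = B u u / 2 - l u" for u
  \<comment> \<open>Completing the square: the bound is the minimum of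
    \<open>a * s\<^sup>2 / 2 - norm l * s\<close>, attained at
    \<open>s = norm l / a\<close>.\<close>
  have lower: "J u \<ge> - (norm l)\<^sup>2 / (2 * a)" for u
  proof -
    have "l u \<le> norm l * norm u" using norm_blinfun[of l u] by simp
    then have "J u \<ge> a * (norm u)\<^sup>2 / 2 - norm l * norm u" using co[of u] by (simp add: J_def)
    moreover have "a * (norm u)\<^sup>2 / 2 - norm l * norm u + (norm l)\<^sup>2 / (2 * a)
        = (a * norm u - norm l)\<^sup>2 / (2 * a)"
      using a by (simp add: field_simps power2_eq_square)
    moreover have "(a * norm u - norm l)\<^sup>2 / (2 * a) \<ge> 0" using a by simp
    ultimately show ?thesis by simp
  qed
  define m where "m = (INF u. J u)"
  have bdd: "bdd_below (range J)" using lower by (intro bdd_belowI2) 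
  have mJ: "m \<le> J u" for u unfolding m_def by (rule cINF_lower[OF bdd]) simp
  have "\<exists>u. J u < m + 1 / real (Suc n)" for n
    using cINF_less_iff[OF _ bdd, of "m + 1 / real (Suc n)"] unfolding m_def by auto
  then obtain u where u: "\<And>n. J (u n) < m + 1 / real (Suc n)" by metis
  \<comment> \<open>Since \<open>J\<close> is at least \<open>m\<close> at the midpoint, two nearly
    minimal points are close to each other.\<close>
  have par: "a * (norm (v - w))\<^sup>2 / 4 \<le> J v + J w - 2 * m" for v w
  proof -
    have "J v + J w - 2 * J ((1/2) *\<^sub>R (v + w)) = B (v - w) (v - w) / 4"
      by (simp add: J_def lin sym[of w v] field_simps)
    then show ?thesis using co[of "v - w"] mJ[of "(1/2) *\<^sub>R (v + w)"] by simp
  qed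
  have "Cauchy u"
    unfolding Cauchy_altdef2
  proof (intro allI impI)
    fix e :: real assume e: "e > 0"
    obtain N where N: "1 / real (Suc N) < a * e\<^sup>2 / 8"
      using nat_approx_posE[of "a * e\<^sup>2 / 8"] a e by auto
    show "\<exists>N. \<forall>n\<ge>N. dist (u n) (u N) < e"
    proof (intro exI allI impI)
      fix n assume n: "n \<ge> N"
      have "1 / real (Suc n) \<le> 1 / real (Suc N)" using n by (simp add: field_simps)
      then have "a * (norm (u n - u N))\<^sup>2 / 4 < a * e\<^sup>2 / 4"
        using par[of "u n" "u N"] u[of n] u[of N] N by linarith
      then have "(norm (u n - u N))\<^sup>2 < e\<^sup>2" using a by simp
      then show "dist (u n) (u N) < e" using e power_less_imp_less_base[of _ 2 e] by (simp add: dist_norm)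
    qed
  qed
  then obtain v where v: "u \<longlonglongrightarrow> v" using Cauchy_convergent convergent_def by blast
  have "(\<lambda>n. J (u n)) \<longlonglongrightarrow> J v"
    unfolding J_def by (intro tendsto_intros v) auto
  moreover have "(\<lambda>n. m + 1 / real (Suc n)) \<longlonglongrightarrow> m + 0"
    by (intro tendsto_intros LIMSEQ_inverse_real_of_nat[unfolded inverse_eq_divide])
  ultimately have "J v \<le> m + 0" by (rule LIMSEQ_le) (use u less_imp_le in blast)
  then have min: "J v \<le> J w" for w using mJ[of w] by simp
  have "B v z = l z" for z
  proof (rule ccontr)
    assume ne: "B v z \<noteq> l z"
    define d where "d = B v z - l z"
    have d: "d \<noteq> 0" using ne by (simp add: d_def)
    \<comment> \<open>The \<open>+ 1\<close> makes \<open>b\<close> positive even for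
      \<open>z = 0\<close>. A step \<open>- d / b\<close> along \<open>z\<close> changes
      \<open>J\<close> by \<open>- d\<^sup>2 * (b + 1) / (2 * b\<^sup>2)\<close>, against
      minimality.\<close>
    define b where "b = B z z + 1"
    have b: "b > 0" using co[of z] a unfolding b_def
      by (smt (verit) mult_nonneg_nonneg zero_le_power2)
    have "J (v + t *\<^sub>R z) = J v + t * d + t\<^sup>2 * (b - 1) / 2" for t
      by (simp add: J_def lin sym[of z v] d_def b_def power2_eq_square field_simps)
    then have "J (v + (- d / b) *\<^sub>R z) = J v + (- d / b) * d + (- d / b)\<^sup>2 * (b - 1) / 2" .
    also have "\<dots> = J v - d\<^sup>2 * (b + 1) / (2 * b\<^sup>2)"
      using b by (simp add: field_simps power2_eq_square)
    also have "\<dots> < J v" using d b by simp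
    finally show False using min by (simp add: not_le[symmetric])
  qed
  then show ?thesis
  proof (intro ex1I[of _ v])
    fix w assume w: "\<forall>z. B w z = l z"
    then have "B (w - v) (w - v) = 0" using \<open>\<And>z. B v z = l z\<close> by (simp add: lin)
    then have "a * (norm (w - v))\<^sup>2 \<le> 0" using co[of "w - v"] by simp
    then show "w = v" using a by (simp add: mult_le_0_iff)
  qed auto
qed

section \<open>Changes of charts and coordinates of tangent vectors\<close>

definition transition_derivative ::
    "('m, 'e::real_normed_vector) chart \<Rightarrow> ('m, 'e) chart \<Rightarrow> 'm \<Rightarrow> 'e \<Rightarrow> 'e" where
  "transition_derivative c c' q = frechet_derivative (chart_map c' \<circ> chart_inv c) (at (chart_map c q))"

context hilbert_manifold
begin

lemma chart_inj: "c \<in> A \<Longrightarrow> inj_on (chart_map c) (chart_dom c)"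
  using chart_homeomorphism[of c] unfolding homeomorphism_def by (intro inj_on_inverseI[where g="chart_inv c"]) blast

lemma chart_inv_left: "c \<in> A \<Longrightarrow> q \<in> chart_dom c \<Longrightarrow> chart_inv c (chart_map c q) = q"
  unfolding chart_inv_def using chart_inj by (rule inv_into_f_f)

lemma chart_inv_right: "x \<in> chart_map c ` chart_dom c \<Longrightarrow> chart_map c (chart_inv c x) = x"
  unfolding chart_inv_def by (rule f_inv_into_f)

lemma chart_inv_dom: "x \<in> chart_map c ` chart_dom c \<Longrightarrow> chart_inv c x \<in> chart_dom c"
  unfolding chart_inv_def by (rule inv_into_into)

lemma chart_continuous: "c \<in> A \<Longrightarrow> continuous_on (chart_dom c) (chart_map c)"
  using chart_homeomorphism[of c] unfolding homeomorphism_def by blast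

lemma chart_inv_continuous: "c \<in> A \<Longrightarrow> continuous_on (chart_map c ` chart_dom c) (chart_inv c)"
  using chart_homeomorphism[of c] unfolding homeomorphism_def by blast

lemma open_chart_inv_image:
  assumes c: "c \<in> A" and X: "open X" "X \<subseteq> chart_map c ` chart_dom c"
  shows "open (chart_inv c ` X)"
proof -
  have "chart_inv c ` X = chart_dom c \<inter> chart_map c -` X"
  proof (intro set_eqI iffI)
    fix q assume "q \<in> chart_inv c ` X"
    then obtain x where x: "x \<in> X" "x \<in> chart_map c ` chart_dom c" "q = chart_inv c x" using X(2) by blast
    then show "q \<in> chart_dom c \<inter> chart_map c -` X"
      using chart_inv_dom[OF x(2)] chart_inv_right[OF x(2)] by simp
  next
    fix q assume "q \<in> chart_dom c \<inter> chart_map c -` X"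
    then show "q \<in> chart_inv c ` X" using chart_inv_left[OF c, of q] by (metis IntE imageI vimageE)
  qed
  then show ?thesis
    using continuous_open_preimage[OF chart_continuous[OF c] open_chart_dom[OF c] X(1)] by simp
qed

lemma open_chart_overlap: "c \<in> A \<Longrightarrow> c' \<in> A \<Longrightarrow> open (chart_map c ` (chart_dom c \<inter> chart_dom c'))"
  using smooth_transition[of c c'] unfolding smooth_on_def by blast

lemma transition_has_derivative:
  assumes "c \<in> A" "c' \<in> A" "q \<in> chart_dom c" "q \<in> chart_dom c'"
  shows "((chart_map c' \<circ> chart_inv c) has_derivative transition_derivative c c' q) (at (chart_map c q))"
  unfolding transition_derivative_def
  using smooth_on_has_derivative[OF smooth_transition[OF assms(1,2)]] assms by blast

lemma transition_derivative_linear: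
  assumes "c \<in> A" "c' \<in> A" "q \<in> chart_dom c" "q \<in> chart_dom c'"
  shows "bounded_linear (transition_derivative c c' q)"
  using transition_has_derivative[OF assms] has_derivative_bounded_linear by blast

text \<open>The cocycle identity; it makes the coordinates assembled by \<open>of_coord\<close>
  compatible, hence the result a tangent vector.\<close>

lemma transition_derivative_comp:
  assumes c: "c \<in> A" "c' \<in> A" "c'' \<in> A"
    and q: "q \<in> chart_dom c" "q \<in> chart_dom c'" "q \<in> chart_dom c''"
  shows "transition_derivative c' c'' q (transition_derivative c c' q v) = transition_derivative c c'' q v"
proof -
  have e: "(chart_map c' \<circ> chart_inv c) (chart_map c q) = chart_map c' q"
    using chart_inv_left c q by simp
  have "((chart_map c'' \<circ> chart_inv c') \<circ> (chart_map c' \<circ> chart_inv c) has_derivative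
      transition_derivative c' c'' q \<circ> transition_derivative c c' q) (at (chart_map c q))"
    by (rule diff_chain_at) (use transition_has_derivative c q e in auto)
  then have "((chart_map c'' \<circ> chart_inv c) has_derivative
      transition_derivative c' c'' q \<circ> transition_derivative c c' q) (at (chart_map c q))"
    by (rule has_derivative_transform_within_open[OF _ open_chart_overlap[OF c(1,2)]])
       (use q chart_inv_left[OF c(1)] chart_inv_left[OF c(2)] in auto)
  then have "transition_derivative c' c'' q \<circ> transition_derivative c c' q = transition_derivative c c'' q"
    by (rule has_derivative_unique) (use transition_has_derivative c q in auto)
  then show ?thesis by (metis comp_apply)
qed

lemma transition_derivative_self:
  assumes c: "c \<in> A" and q: "q \<in> chart_dom c"
  shows "transition_derivative c c q v = v"
proof -
  have "((\<lambda>x. x) has_derivative (\<lambda>v. v)) (at (chart_map c q))" by (rule has_derivative_ident)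
  then have "((chart_map c \<circ> chart_inv c) has_derivative (\<lambda>v. v)) (at (chart_map c q))"
    by (rule has_derivative_transform_within_open[OF _ open_chart_image[OF c]])
       (use q chart_inv_left[OF c] in auto)
  then have "(\<lambda>v. v) = transition_derivative c c q"
    by (rule has_derivative_unique) (use transition_has_derivative c q in auto)
  then show ?thesis by metis
qed

lemma coord_of_coord:
  "c' \<in> A \<Longrightarrow> q \<in> chart_dom c' \<Longrightarrow> coord (of_coord A c q v) c' = transition_derivative c c' q v"
  by (simp add: of_coord_def Tvec_inverse transition_derivative_def)

lemma coord_of_coord_outside:
  "\<not> (c' \<in> A \<and> q \<in> chart_dom c') \<Longrightarrow> coord (of_coord A c q v) c' = 0"
  unfolding of_coord_def by (simp add: Tvec_inverse) blast

lemma coord_of_coord_self: "c \<in> A \<Longrightarrow> q \<in> chart_dom c \<Longrightarrow> coord (of_coord A c q v) c = v"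
  by (simp add: coord_of_coord transition_derivative_self)

lemma of_coord_in_tangent_space:
  assumes "c \<in> A" "q \<in> chart_dom c" shows "of_coord A c q v \<in> tangent_space A q"
  unfolding tangent_space_def mem_Collect_eq
proof (intro conjI ballI allI impI)
  fix c' c'' assume "c' \<in> A" "c'' \<in> A" "q \<in> chart_dom c'" "q \<in> chart_dom c''"
  then show "coord (of_coord A c q v) c'' = frechet_derivative (chart_map c'' \<circ> chart_inv c')
       (at (chart_map c' q)) (coord (of_coord A c q v) c')"
    using transition_derivative_comp[OF assms(1) \<open>c' \<in> A\<close> \<open>c'' \<in> A\<close> assms(2)]
    by (simp add: coord_of_coord flip: transition_derivative_def)
qed (rule coord_of_coord_outside)

lemma tangent_space_coord:
  "v \<in> tangent_space A q \<Longrightarrow> c \<in> A \<Longrightarrow> c' \<in> A \<Longrightarrow> q \<in> chart_dom c \<Longrightarrow> q \<in> chart_dom c' \<Longrightarrow>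
     coord v c' = transition_derivative c c' q (coord v c)"
  unfolding tangent_space_def transition_derivative_def by blast

lemma of_coord_coord:
  assumes "v \<in> tangent_space A q" "c \<in> A" "q \<in> chart_dom c"
  shows "of_coord A c q (coord v c) = v"
proof -
  have "coord (of_coord A c q (coord v c)) c' = coord v c'" for c'
  proof (cases "c' \<in> A \<and> q \<in> chart_dom c'")
    case True
    then show ?thesis using coord_of_coord tangent_space_coord[OF assms(1,2) _ assms(3)] by simp
  next
    case False
    then have "coord v c' = 0" using assms(1) unfolding tangent_space_def by blast
    then show ?thesis using coord_of_coord_outside[OF False] by simp
  qed
  then show ?thesis by (metis coord_inject ext)
qed

lemma of_coord_add:
  assumes "c \<in> A" "q \<in> chart_dom c"
  shows "of_coord A c q (v + w) = of_coord A c q v + of_coord A c q w"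
proof -
  have "coord (of_coord A c q (v + w)) c' = coord (of_coord A c q v + of_coord A c q w) c'" for c'
  proof (cases "c' \<in> A \<and> q \<in> chart_dom c'")
    case True
    then have "linear (transition_derivative c c' q)"
      using transition_derivative_linear[OF assms(1) _ assms(2)] bounded_linear.linear by blast
    then show ?thesis using True by (simp add: coord_of_coord plus_tvec.rep_eq linear_add)
  qed (simp add: coord_of_coord_outside plus_tvec.rep_eq)
  then show ?thesis by (metis coord_inject ext)
qed

lemma of_coord_scaleR:
  assumes "c \<in> A" "q \<in> chart_dom c"
  shows "of_coord A c q (r *\<^sub>R v) = r *\<^sub>R of_coord A c q v"
proof -
  have "coord (of_coord A c q (r *\<^sub>R v)) c' = coord (r *\<^sub>R of_coord A c q v) c'" for c'
  proof (cases "c' \<in> A \<and> q \<in> chart_dom c'")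
    case True
    then have "linear (transition_derivative c c' q)"
      using transition_derivative_linear[OF assms(1) _ assms(2)] bounded_linear.linear by blast
    then show ?thesis using True by (simp add: coord_of_coord scaleR_tvec.rep_eq linear_scale)
  qed (simp add: coord_of_coord_outside scaleR_tvec.rep_eq)
  then show ?thesis by (metis coord_inject ext)
qed

lemma exists_chart: obtains c where "c \<in> A" "q \<in> chart_dom c"
  using charts_cover by blast

lemma tangent_space_eq_range:
  assumes "c \<in> A" "q \<in> chart_dom c"
  shows "tangent_space A q = range (of_coord A c q)"
proof (intro set_eqI iffI)
  fix v assume "v \<in> tangent_space A q"
  then show "v \<in> range (of_coord A c q)"
    by (intro range_eqI[of _ _ "coord v c"]) (rule of_coord_coord[OF _ assms, symmetric])
qed (use of_coord_in_tangent_space[OF assms] in auto)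

lemma subspace_tangent_space: "subspace (tangent_space A q)"
proof -
  obtain c where c: "c \<in> A" "q \<in> chart_dom c" by (rule exists_chart)
  have l: "linear (of_coord A c q)"
    by (rule linearI) (auto simp: of_coord_add[OF c] of_coord_scaleR[OF c])
  show ?thesis unfolding tangent_space_eq_range[OF c] using linear_subspace_image[OF l subspace_UNIV] .
qed

text \<open>Continuity of \<open>\<gamma>\<close> is a hypothesis of its own:
  \<open>chart_map c\<close> has arbitrary values outside its domain, so differentiability of
  \<open>chart_map c \<circ> \<gamma>\<close> does not say that \<open>\<gamma>\<close> stays in the
  chart near \<open>t\<close>.\<close>

lemma curve_change_chart:
  assumes c: "c \<in> A" "c' \<in> A" and \<gamma>: "\<gamma> t \<in> chart_dom c" "\<gamma> t \<in> chart_dom c'"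
    and t: "t \<in> I" and cont: "continuous (at t within I) \<gamma>"
    and d: "((chart_map c \<circ> \<gamma>) has_vector_derivative v) (at t within I)"
  shows "((chart_map c' \<circ> \<gamma>) has_vector_derivative transition_derivative c c' (\<gamma> t) v) (at t within I)"
proof -
  have lin: "linear (transition_derivative c c' (\<gamma> t))"
    using transition_derivative_linear c \<gamma> bounded_linear.linear by blast
  have d': "((chart_map c \<circ> \<gamma>) has_derivative (\<lambda>h. h *\<^sub>R v)) (at t within I)"
    using d by (simp add: has_vector_derivative_def)
  have tr: "((chart_map c' \<circ> chart_inv c) has_derivative transition_derivative c c' (\<gamma> t))
      (at ((chart_map c \<circ> \<gamma>) t) within (chart_map c \<circ> \<gamma>) ` I)"
    using transition_has_derivative[OF c \<gamma>] by (simp add: has_derivative_at_withinI)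
  have comp: "(((chart_map c' \<circ> chart_inv c) \<circ> (chart_map c \<circ> \<gamma>)) has_derivative
      transition_derivative c c' (\<gamma> t) \<circ> (\<lambda>h. h *\<^sub>R v)) (at t within I)"
    by (rule diff_chain_within[OF d' tr])
  have "eventually (\<lambda>s. \<gamma> s \<in> chart_dom c) (at t within I)"
    using cont \<gamma>(1) open_chart_dom[OF c(1)] unfolding continuous_within tendsto_def by blast
  then have ev: "eventually (\<lambda>s. ((chart_map c' \<circ> chart_inv c) \<circ> (chart_map c \<circ> \<gamma>)) s = (chart_map c' \<circ> \<gamma>) s)
      (at t within I)"
    by eventually_elim (simp add: chart_inv_left[OF c(1)])
  have "((chart_map c' \<circ> \<gamma>) has_derivative
      transition_derivative c c' (\<gamma> t) \<circ> (\<lambda>h. h *\<^sub>R v)) (at t within I)"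
    by (rule has_derivative_transform_eventually[OF comp ev])
       (use t \<gamma> chart_inv_left[OF c(1)] in auto)
  then show ?thesis
    by (simp add: has_vector_derivative_def o_def linear_scale[OF lin])
qed

end

section \<open>The metric read in a chart\<close>

context riemannian_manifold
begin

abbreviation metric_form :: "('m, 'e) chart \<Rightarrow> 'e \<Rightarrow> 'e \<Rightarrow> 'e \<Rightarrow> real" where
  "metric_form c x v w \<equiv> blinfun_apply (blinfun_apply (metric_in_chart A g c x) v) w"

lemma metric_pullback_form:
  assumes "c \<in> A" "q \<in> chart_dom c"
  shows "psd_form (\<lambda>v w. g q (of_coord A c q v) (of_coord A c q w))"
proof
  note T = of_coord_in_tangent_space[OF assms]
  show "g q (of_coord A c q x) (of_coord A c q x) \<ge> 0" for x
  proof (cases "of_coord A c q x = 0")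
    case True
    then show ?thesis using metric_scale[OF T[of x] T[of x], of 0] by simp
  qed (use metric_pos[OF T[of x]] in simp)
qed (use of_coord_in_tangent_space[OF assms] in
  \<open>auto simp: of_coord_add[OF assms] of_coord_scaleR[OF assms] metric_add metric_scale metric_sym\<close>)

text \<open>\<open>Blinfun\<close> has a known value on bounded linear maps only. Cauchy-Schwarz
  together with the upper half of the norm equivalence bounds the form in both arguments, which
  justifies both applications of it.\<close>

lemma metric_in_chart_apply:
  assumes c: "c \<in> A" and q: "q \<in> chart_dom c"
  shows "metric_form c (chart_map c q) v w = g q (of_coord A c q v) (of_coord A c q w)"
proof -
  let ?B = "\<lambda>v w. g q (of_coord A c q v) (of_coord A c q w)"
  interpret psd_form ?B by (rule metric_pullback_form[OF c q])
  obtain b where b: "b > 0" "\<forall>v\<in>tangent_space A q. tangent_norm g q v \<le> b * norm (coord v c)"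
    using norm_equivalent[OF c q] by blast
  have sq: "sqrt (?B v v) \<le> b * norm v" for v
    using b(2) of_coord_in_tangent_space[OF c q, of v] coord_of_coord_self[OF c q]
    unfolding tangent_norm_def by force
  have bd: "\<bar>?B v w\<bar> \<le> (b * norm v) * (b * norm w)" for v w
    using Cauchy_Schwarz[of v w] mult_mono[OF sq[of v] sq[of w]] nonneg[of w] b(1) by fastforce
  have bl: "bounded_linear (?B v)" for v
    by (rule bounded_linear_intro[where K="b * norm v * b"])
       (use bd[of v] in \<open>auto simp: add_right scale_right algebra_simps\<close>)
  have ap: "blinfun_apply (Blinfun (?B v)) w = ?B v w" for v w
    by (simp only: bounded_linear_Blinfun_apply[OF bl])
  have bl2: "bounded_linear (\<lambda>v. Blinfun (?B v))"
  proof (rule bounded_linear_intro[where K="b * b"])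
    show "norm (Blinfun (?B x)) \<le> norm x * (b * b)" for x
      by (rule norm_blinfun_bound) (use bd[of x] b in \<open>auto simp: bounded_linear_Blinfun_apply[OF bl] algebra_simps\<close>)
    show "Blinfun (?B (x + y)) = Blinfun (?B x) + Blinfun (?B y)" for x y
      by (rule blinfun_eqI) (unfold blinfun.add_left ap, rule add_left)
    show "Blinfun (?B (r *\<^sub>R x)) = r *\<^sub>R Blinfun (?B x)" for r x
      by (rule blinfun_eqI) (unfold blinfun.scaleR_left ap real_scaleR_def, rule scale_left)
  qed
  show ?thesis
    unfolding metric_in_chart_def chart_inv_left[OF c q]
    by (simp add: bounded_linear_Blinfun_apply[OF bl2] bounded_linear_Blinfun_apply[OF bl])
qed

lemma metric_form_psd:
  assumes "c \<in> A" "x \<in> chart_map c ` chart_dom c"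
  shows "psd_form (metric_form c x)"
  using assms metric_pullback_form[OF assms(1)] by (auto simp: metric_in_chart_apply)

lemma tangent_norm_eq:
  assumes "c \<in> A" "q \<in> chart_dom c" "v \<in> tangent_space A q"
  shows "tangent_norm g q v = sqrt (metric_form c (chart_map c q) (coord v c) (coord v c))"
  using assms by (simp add: metric_in_chart_apply of_coord_coord tangent_norm_def)

text \<open>The lower half of the norm equivalence, squared. The constant belongs to one point;
  continuity of the metric makes it locally uniform in
  \<open>metric_local_Lipschitz\<close>.\<close>

lemma metric_form_coercive:
  assumes c: "c \<in> A" and x: "x \<in> chart_map c ` chart_dom c"
  obtains a where "a > 0" "\<And>v. a * (norm v)\<^sup>2 \<le> metric_form c x v v"
proof -
  obtain q where q: "q \<in> chart_dom c" "x = chart_map c q" using x by auto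
  interpret psd_form "metric_form c x" by (rule metric_form_psd[OF c x])
  obtain a where a: "a > 0" "\<forall>v\<in>tangent_space A q. a * norm (coord v c) \<le> tangent_norm g q v"
    using norm_equivalent[OF c q(1)] by blast
  have "a\<^sup>2 * (norm v)\<^sup>2 \<le> metric_form c x v v" for v
  proof -
    have "a * norm v \<le> sqrt (metric_form c x v v)"
      using a(2) of_coord_in_tangent_space[OF c q(1), of v] coord_of_coord_self[OF c q(1)]
        tangent_norm_eq[OF c q(1)] q(2) by force
    then have "(a * norm v)\<^sup>2 \<le> (sqrt (metric_form c x v v))\<^sup>2"
      using a(1) by (intro power_mono) auto
    then show ?thesis by (simp add: nonneg power_mult_distrib)
  qed
  then show ?thesis using that[of "a\<^sup>2"] a(1) by simp
qed

end

section \<open>Christoffel symbols\<close>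

lemma norm_blinfun2: "\<bar>blinfun_apply (blinfun_apply T v) w\<bar> \<le> norm T * norm v * norm w"
  for T :: "'a::real_normed_vector \<Rightarrow>\<^sub>L 'b::real_normed_vector \<Rightarrow>\<^sub>L real"
proof -
  have "norm (blinfun_apply (blinfun_apply T v) w) \<le> norm (blinfun_apply T v) * norm w"
    by (rule norm_blinfun)
  also have "\<dots> \<le> norm T * norm v * norm w" by (intro mult_right_mono norm_blinfun) auto
  finally show ?thesis by simp
qed

text \<open>Let \<open>M\<close> be the maximum of \<open>m\<close> over an interval of length
  \<open>h\<close>. The mean value inequality, from equal initial data, gives
  \<open>M \<le> M * (h * (1 + L))\<close>, and \<open>h * (1 + L) \<le> 1/2\<close> forces
  \<open>M = 0\<close>. The Lipschitz estimate is stated along the two solutions, which lets the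
  caller confine them to a ball where it holds.\<close>

lemma second_order_ODE_local_uniqueness:
  fixes x y :: "real \<Rightarrow> 'a::real_normed_vector"
  assumes sb: "s < b" and L: "L > 0"
    and x: "\<And>t. t \<in> {s..b} \<Longrightarrow> (x has_vector_derivative x' t) (at t within {s..b})"
    and x': "\<And>t. t \<in> {s..b} \<Longrightarrow> (x' has_vector_derivative x'' t) (at t within {s..b})"
    and y: "\<And>t. t \<in> {s..b} \<Longrightarrow> (y has_vector_derivative y' t) (at t within {s..b})"
    and y': "\<And>t. t \<in> {s..b} \<Longrightarrow> (y' has_vector_derivative y'' t) (at t within {s..b})"
    and lip: "\<And>t. t \<in> {s..b} \<Longrightarrow> norm (x'' t - y'' t) \<le> L * (norm (x t - y t) + norm (x' t - y' t))"
    and init: "x s = y s" "x' s = y' s"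
  shows "\<exists>b'. s < b' \<and> b' \<le> b \<and> (\<forall>t\<in>{s..b'}. x t = y t)"
proof -
  define h where "h = min (b - s) (1 / (2 * (1 + L)))"
  have h: "h > 0" "h \<le> b - s" "h * (1 + L) \<le> 1/2"
    using sb L by (auto simp: h_def min_def field_simps)
  define I where "I = {s..s + h}"
  have sub: "I \<subseteq> {s..b}" and sI: "s \<in> I" using h by (auto simp: I_def)
  define m where "m t = norm (x t - y t) + norm (x' t - y' t)" for t
  have cont: "continuous_on I m"
  proof -
    have "continuous_on I x" "continuous_on I x'" "continuous_on I y" "continuous_on I y'"
      using x x' y y' sub
      by (meson continuous_on_subset continuous_on_vector_derivative)+
    then show ?thesis unfolding m_def by (intro continuous_intros)
  qed
  obtain t0 where t0: "t0 \<in> I" "\<And>t. t \<in> I \<Longrightarrow> m t \<le> m t0"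
    using continuous_attains_sup[OF _ _ cont] sI unfolding I_def by (metis compact_Icc empty_iff)
  define M where "M = m t0"
  have M0: "M \<ge> 0" by (simp add: M_def m_def)
  have mean: "norm (f t) \<le> K * h"
    if f: "\<And>t. t \<in> I \<Longrightarrow> (f has_vector_derivative f' t) (at t within I)" and K: "\<And>t. t \<in> I \<Longrightarrow> norm (f' t) \<le> K"
      and f0: "f s = 0" and t: "t \<in> I" for f f' :: "real \<Rightarrow> 'a" and K t
  proof -
    have K0: "K \<ge> 0" using K[OF sI] norm_ge_zero order_trans by blast
    have "norm (f t - f s) \<le> K * norm (t - s)"
    proof (rule differentiable_bound[where S=I and f'="\<lambda>t h. h *\<^sub>R f' t"])
      show "(f has_derivative (\<lambda>h. h *\<^sub>R f' u)) (at u within I)" if "u \<in> I" for u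
        using f[OF that] by (simp add: has_vector_derivative_def)
      show "onorm (\<lambda>h. h *\<^sub>R f' u) \<le> K" if "u \<in> I" for u
      proof (rule onorm_bound[OF K0])
        show "norm (h *\<^sub>R f' u) \<le> K * norm h" for h
          using mult_right_mono[OF K[OF that] abs_ge_zero[of h]] by (simp add: mult.commute)
      qed
    qed (use t sI in \<open>auto simp: I_def\<close>)
    also have "\<dots> \<le> K * h" using t K0 by (intro mult_left_mono) (auto simp: I_def)
    finally show ?thesis using f0 by simp
  qed
  have dx: "((\<lambda>t. x t - y t) has_vector_derivative (x' t - y' t)) (at t within I)" if "t \<in> I" for t
  proof -
    have "t \<in> {s..b}" using that sub by blast
    then show ?thesis
      using has_vector_derivative_within_subset[OF has_vector_derivative_diff[OF x y] sub] by blast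
  qed
  have dx': "((\<lambda>t. x' t - y' t) has_vector_derivative (x'' t - y'' t)) (at t within I)" if "t \<in> I" for t
  proof -
    have "t \<in> {s..b}" using that sub by blast
    then show ?thesis
      using has_vector_derivative_within_subset[OF has_vector_derivative_diff[OF x' y'] sub] by blast
  qed
  have b1: "norm (x t0 - y t0) \<le> M * h"
  proof (rule mean[OF dx _ _ t0(1)])
    fix t assume "t \<in> I"
    then have "m t \<le> M" using t0(2) by (simp add: M_def)
    then show "norm (x' t - y' t) \<le> M" unfolding m_def using norm_ge_zero[of "x t - y t"] by linarith
  qed (use init in auto)
  have b2: "norm (x' t0 - y' t0) \<le> (L * M) * h"
  proof (rule mean[OF dx' _ _ t0(1)])
    fix t assume t: "t \<in> I"
    then have "L * m t \<le> L * M" using t0(2) L by (simp add: M_def)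
    moreover have "t \<in> {s..b}" using t sub by blast
    ultimately show "norm (x'' t - y'' t) \<le> L * M" using lip[of t] unfolding m_def by linarith
  qed (use init in auto)
  have "M \<le> M * (h * (1 + L))" using b1 b2 unfolding M_def m_def by (simp add: algebra_simps)
  also have "\<dots> \<le> M * (1/2)" using h(3) M0 by (rule mult_left_mono)
  finally have "M = 0" using M0 by simp
  have "x t = y t" if "t \<in> I" for t
  proof -
    have "m t \<le> 0" using t0(2)[OF that] \<open>M = 0\<close> by (simp add: M_def)
    then have "norm (x t - y t) \<le> 0"
      unfolding m_def using norm_ge_zero[of "x' t - y' t"] by linarith
    then show ?thesis by simp
  qed
  then show ?thesis using h by (intro exI[of _ "s + h"]) (auto simp: I_def)
qed

context riemannian_manifold
begin

abbreviation metric_deriv :: "('m, 'e) chart \<Rightarrow> 'e \<Rightarrow> 'e \<Rightarrow> 'e \<Rightarrow>\<^sub>L 'e \<Rightarrow>\<^sub>L real" where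
  "metric_deriv c x \<equiv> frechet_derivative (metric_in_chart A g c) (at x)"

lemma metric_deriv_bounded_linear:
  assumes "c \<in> A" "x \<in> chart_map c ` chart_dom c"
  shows "bounded_linear (metric_deriv c x)"
  using smooth_on_has_derivative[OF metric_smooth[OF assms(1)] assms(2)] has_derivative_bounded_linear
  by blast

lemma metric_form_cancel:
  assumes "c \<in> A" "x \<in> chart_map c ` chart_dom c" "\<And>z. metric_form c x u z = metric_form c x w z"
  shows "u = w"
proof (rule metric_form_coercive[OF assms(1,2)])
  fix a assume a: "a > 0" "\<And>v. a * (norm v)\<^sup>2 \<le> metric_form c x v v"
  have "metric_form c x (u - w) (u - w) = 0"
    using assms(3) by (simp add: blinfun.diff_left blinfun.diff_right)
  then have "a * (norm (u - w))\<^sup>2 \<le> 0" using a(2)[of "u - w"] by simp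
  then show ?thesis using a(1) by (simp add: mult_le_0_iff)
qed

text \<open>Turns the definite description into a usable equation: the Riesz theorem represents the
  right-hand side, a bounded functional of \<open>z\<close>, by a unique vector.\<close>

lemma christoffel_Koszul:
  assumes c: "c \<in> A" and x: "x \<in> chart_map c ` chart_dom c"
  shows "2 * metric_form c x (christoffel A g c x v w) z =
    metric_deriv c x v w z + metric_deriv c x w v z - metric_deriv c x z v w"
proof (rule metric_form_coercive[OF c x])
  fix a assume a: "a > 0" "\<And>v. a * (norm v)\<^sup>2 \<le> metric_form c x v v"
  interpret psd_form "metric_form c x" by (rule metric_form_psd[OF c x])
  let ?R = "\<lambda>z. metric_deriv c x v w z + metric_deriv c x w v z - metric_deriv c x z v w"
  \<comment> \<open>In this term \<open>z\<close> is the direction of differentiation, so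
    boundedness comes from that of the derivative of the metric.\<close>
  have bl: "bounded_linear (\<lambda>z. metric_deriv c x z v w)"
    by (intro bounded_linear_compose[OF blinfun.bounded_linear_left]
        metric_deriv_bounded_linear[OF c x])
  have "bounded_linear (\<lambda>z. ?R z / 2)"
    using bounded_linear_sub[OF bounded_linear_add[OF blinfun.bounded_linear_right blinfun.bounded_linear_right] bl]
    by (intro bounded_linear_compose[OF bounded_linear_divide]) 
  then have l: "blinfun_apply (Blinfun (\<lambda>z. ?R z / 2)) = (\<lambda>z. ?R z / 2)"
    by (rule bounded_linear_Blinfun_apply)
  have "\<exists>!u. \<forall>z. metric_form c x u z = Blinfun (\<lambda>z. ?R z / 2) z"
    by (rule Riesz_coercive[OF sym a])
  then have "\<exists>!u. \<forall>z. 2 * metric_form c x u z = ?R z"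
    unfolding l by (simp add: field_simps)
  from theI'[OF this] show ?thesis
    unfolding christoffel_def Let_def by blast
qed

text \<open>Every term on the right of the Koszul formula is quadratic in the repeated argument.
  This homogeneity is what lets geodesics be run at a slower speed.\<close>

lemma christoffel_scale:
  assumes c: "c \<in> A" and x: "x \<in> chart_map c ` chart_dom c"
  shows "christoffel A g c x (r *\<^sub>R v) (r *\<^sub>R v) = r\<^sup>2 *\<^sub>R christoffel A g c x v v"
proof (rule metric_form_cancel[OF c x])
  fix z
  have l: "linear (metric_deriv c x)"
    using metric_deriv_bounded_linear[OF c x] bounded_linear.linear by blast
  have "2 * metric_form c x (christoffel A g c x (r *\<^sub>R v) (r *\<^sub>R v)) z
      = r\<^sup>2 * (2 * metric_form c x (christoffel A g c x v v) z)"
    unfolding christoffel_Koszul[OF c x]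
    by (simp add: linear_scale[OF l] blinfun.scaleR_left blinfun.scaleR_right power2_eq_square algebra_simps)
  then show "metric_form c x (christoffel A g c x (r *\<^sub>R v) (r *\<^sub>R v)) z
      = metric_form c x (r\<^sup>2 *\<^sub>R christoffel A g c x v v) z"
    by (simp add: blinfun.scaleR_left blinfun.scaleR_right)
qed

text \<open>Collects on a single ball the uniform constants from which the Lipschitz bound for the
  Christoffel map and the comparison of norms at nearby points are derived.\<close>

lemma metric_local_Lipschitz:
  assumes c: "c \<in> A" and x0: "x0 \<in> chart_map c ` chart_dom c"
  obtains r C a where "r > 0" "C > 0" "a > 0" "ball x0 r \<subseteq> chart_map c ` chart_dom c"
    "\<And>x v. x \<in> ball x0 r \<Longrightarrow> norm (metric_deriv c x v) \<le> C * norm v"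
    "\<And>x y v. x \<in> ball x0 r \<Longrightarrow> y \<in> ball x0 r \<Longrightarrow>
       norm (metric_deriv c x v - metric_deriv c y v) \<le> C * norm (x - y) * norm v"
    "\<And>x y. x \<in> ball x0 r \<Longrightarrow> y \<in> ball x0 r \<Longrightarrow>
       norm (metric_in_chart A g c x - metric_in_chart A g c y) \<le> C * norm (x - y)"
    "\<And>x v. x \<in> ball x0 r \<Longrightarrow> a * (norm v)\<^sup>2 \<le> metric_form c x v v"
proof (rule metric_form_coercive[OF c x0], rule smooth_on_local_Lipschitz_derivative[OF metric_smooth[OF c] x0])
  fix a assume a: "a > 0" "\<And>v. a * (norm v)\<^sup>2 \<le> metric_form c x0 v v"
  fix r C assume r: "r > 0" "C > 0" "ball x0 r \<subseteq> chart_map c ` chart_dom c"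
    and D: "\<And>x v. x \<in> ball x0 r \<Longrightarrow> norm (metric_deriv c x v) \<le> C * norm v"
    and L: "\<And>x y v. x \<in> ball x0 r \<Longrightarrow> y \<in> ball x0 r \<Longrightarrow>
       norm (metric_deriv c x v - metric_deriv c y v) \<le> C * norm (x - y) * norm v"
  have G: "norm (metric_in_chart A g c x - metric_in_chart A g c y) \<le> C * norm (x - y)"
    if "x \<in> ball x0 r" "y \<in> ball x0 r" for x y
  proof (rule differentiable_bound[where S="ball x0 r" and f'="metric_deriv c"])
    fix x assume x: "x \<in> ball x0 r"
    then have "x \<in> chart_map c ` chart_dom c" using r(3) by blast
    then show "(metric_in_chart A g c has_derivative metric_deriv c x) (at x within ball x0 r)"
      using smooth_on_has_derivative[OF metric_smooth[OF c]] has_derivative_at_withinI by blast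
    show "onorm (metric_deriv c x) \<le> C"
      by (rule onorm_bound) (use D[OF x] r(2) in auto)
  qed (use that in auto)
  \<comment> \<open>Within distance \<open>a / (2 * C)\<close> of \<open>x0\<close> the form changes
    by at most \<open>a / 2\<close> times the squared norm, so half of the coercivity
    survives.\<close>
  define r' where "r' = min r (a / (2 * C))"
  have r': "r' > 0" "r' \<le> r" "C * r' \<le> a / 2"
    using r a(1) by (auto simp: r'_def min_def field_simps)
  have sub: "ball x0 r' \<subseteq> ball x0 r" using r' by auto
  have co: "(a / 2) * (norm v)\<^sup>2 \<le> metric_form c x v v" if x: "x \<in> ball x0 r'" for x v
  proof -
    have "metric_form c x0 v v - metric_form c x v v = (metric_in_chart A g c x0 - metric_in_chart A g c x) v v"
      by (simp add: blinfun.diff_left)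
    also have "\<dots> \<le> norm (metric_in_chart A g c x0 - metric_in_chart A g c x) * norm v * norm v"
      using norm_blinfun2 abs_le_D1 by blast
    also have "\<dots> \<le> (a / 2) * norm v * norm v"
    proof (intro mult_right_mono)
      have "norm (metric_in_chart A g c x0 - metric_in_chart A g c x) \<le> C * norm (x0 - x)"
        using G[of x0 x] x r' by auto
      also have "\<dots> \<le> C * r'" using x r by (intro mult_left_mono) (auto simp: dist_norm)
      finally show "norm (metric_in_chart A g c x0 - metric_in_chart A g c x) \<le> a / 2" using r'(3) by simp
    qed auto
    finally show ?thesis using a(2)[of v] by (simp add: power2_eq_square)
  qed
  show thesis
    by (rule that[of r' C "a / 2"]) (use r r' a sub co D L G in \<open>auto simp: subset_iff\<close>)
qed

text \<open>The Christoffel vectors are known through the Koszul formula only, so their difference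
  \<open>z\<close> is tested against itself: coercivity bounds \<open>a * (norm z)\<^sup>2\<close>
  by differences of Koszul terms, each carrying a factor \<open>norm z\<close> that cancels. The
  velocity bound \<open>M\<close> is there because the map is quadratic in the velocity.\<close>

lemma christoffel_local_Lipschitz:
  assumes c: "c \<in> A" and x0: "x0 \<in> chart_map c ` chart_dom c" and M: "M \<ge> 0"
  shows "\<exists>r>0. \<exists>L>0. \<forall>x\<in>ball x0 r. \<forall>y\<in>ball x0 r. \<forall>v w. norm v \<le> M \<longrightarrow> norm w \<le> M \<longrightarrow>
     norm (christoffel A g c x v v - christoffel A g c y w w) \<le> L * (norm (x - y) + norm (v - w))"
proof (rule metric_local_Lipschitz[OF c x0])
  fix r C a assume r: "r > 0" and C: "C > 0" and a: "a > 0"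
    and sub: "ball x0 r \<subseteq> chart_map c ` chart_dom c"
    and D: "\<And>x v. x \<in> ball x0 r \<Longrightarrow> norm (metric_deriv c x v) \<le> C * norm v"
    and DL: "\<And>x y v. x \<in> ball x0 r \<Longrightarrow> y \<in> ball x0 r \<Longrightarrow>
       norm (metric_deriv c x v - metric_deriv c y v) \<le> C * norm (x - y) * norm v"
    and GL: "\<And>x y. x \<in> ball x0 r \<Longrightarrow> y \<in> ball x0 r \<Longrightarrow>
       norm (metric_in_chart A g c x - metric_in_chart A g c y) \<le> C * norm (x - y)"
    and co: "\<And>x v. x \<in> ball x0 r \<Longrightarrow> a * (norm v)\<^sup>2 \<le> metric_form c x v v"
  let ?\<Gamma> = "christoffel A g c"
  have D3: "\<bar>metric_deriv c x u v w\<bar> \<le> C * norm u * norm v * norm w" if "x \<in> ball x0 r" for x u v w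
  proof -
    have "\<bar>metric_deriv c x u v w\<bar> \<le> norm (metric_deriv c x u) * norm v * norm w" by (rule norm_blinfun2)
    also have "\<dots> \<le> C * norm u * norm v * norm w" by (intro mult_right_mono D that) auto
    finally show ?thesis .
  qed
  \<comment> \<open>A priori bound for a Christoffel vector, from the Koszul formula tested with
    that vector itself.\<close>
  define K where "K = 3 * C * M\<^sup>2 / (2 * a)"
  have K: "K \<ge> 0" using C a by (simp add: K_def)
  have \<Gamma>K: "norm (?\<Gamma> y w w) \<le> K" if y: "y \<in> ball x0 r" and w: "norm w \<le> M" for y w
  proof -
    let ?u = "?\<Gamma> y w w"
    have yi: "y \<in> chart_map c ` chart_dom c" using y sub by blast
    have wM: "norm w * norm w \<le> M * M" using w M by (intro mult_mono) auto
    have t1: "metric_deriv c y w w ?u \<le> C * norm w * norm w * norm ?u"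
      using D3[OF y, of w w ?u] by simp
    have t2: "- metric_deriv c y ?u w w \<le> C * norm ?u * norm w * norm w"
      using D3[OF y, of ?u w w] by simp
    have "2 * (a * (norm ?u)\<^sup>2) \<le> 2 * metric_form c y ?u ?u" using co[OF y, of ?u] by simp
    also have "\<dots> = 2 * metric_deriv c y w w ?u - metric_deriv c y ?u w w"
      by (subst christoffel_Koszul[OF c yi]) simp
    also have "\<dots> \<le> 3 * C * norm ?u * (norm w * norm w)"
      using t1 t2 by (simp add: algebra_simps)
    also have "\<dots> \<le> 3 * C * norm ?u * (M * M)"
      using wM C by (intro mult_left_mono) auto
    finally have *: "norm ?u * (2 * a * norm ?u) \<le> norm ?u * (3 * C * M\<^sup>2)"
      by (simp add: power2_eq_square algebra_simps)
    show ?thesis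
    proof (cases "?u = 0")
      case False
      then have "2 * a * norm ?u \<le> 3 * C * M\<^sup>2" using * by (simp add: mult_le_cancel_left)
      then show ?thesis using a by (simp add: K_def pos_le_divide_eq algebra_simps)
    qed (use K in simp)
  qed
  \<comment> \<open>The coefficients count the estimates below: \<open>e1\<close> twice and
    \<open>e2\<close> once, \<open>f1\<close> and \<open>f2\<close> twice and \<open>f3\<close> and
    \<open>f4\<close> once, \<open>g\<close> twice. The division by \<open>2 * a\<close> comes from
    coercivity, and the \<open>+ 1\<close> makes \<open>L\<close> positive.\<close>
  define L where "L = (3 * C * M\<^sup>2 + 6 * C * M + 2 * C * K) / (2 * a) + 1"
  have L: "L > 0" using C a K M unfolding L_def by (intro add_nonneg_pos divide_nonneg_pos add_nonneg_nonneg mult_nonneg_nonneg) auto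
  have "norm (?\<Gamma> x v v - ?\<Gamma> y w w) \<le> L * (norm (x - y) + norm (v - w))"
    if x: "x \<in> ball x0 r" and y: "y \<in> ball x0 r" and v: "norm v \<le> M" and w: "norm w \<le> M" for x y v w
  proof -
    have xi: "x \<in> chart_map c ` chart_dom c" and yi: "y \<in> chart_map c ` chart_dom c" using x y sub by auto
    have lin: "linear (metric_deriv c y)"
      using metric_deriv_bounded_linear[OF c yi] bounded_linear.linear by blast
    note bl = blinfun.diff_left blinfun.diff_right
    let ?u = "?\<Gamma> x v v" and ?u' = "?\<Gamma> y w w"
    define z where "z = ?u - ?u'"
    define X where "X = norm (x - y)"
    define W where "W = norm (v - w)"
    have X: "X \<ge> 0" and W: "W \<ge> 0" by (auto simp: X_def W_def)
    have P: "C * X * norm e1 * norm e2 * norm e3 \<le> C * X * (M * M) * norm z"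
      if "norm e1 * norm e2 * norm e3 \<le> M * M * norm z" for e1 e2 e3 :: 'e
      using mult_left_mono[OF that, of "C * X"] C X by (simp add: algebra_simps)
    have n1: "norm v * norm v * norm z \<le> M * M * norm z" "norm z * norm v * norm v \<le> M * M * norm z"
    proof -
      have "norm v * norm v \<le> M * M" using v M by (intro mult_mono) auto
      then have "(norm v * norm v) * norm z \<le> (M * M) * norm z" by (intro mult_right_mono) auto
      then show "norm v * norm v * norm z \<le> M * M * norm z" "norm z * norm v * norm v \<le> M * M * norm z"
        by (simp_all add: algebra_simps)
    qed
    have Q: "C * (W * k * norm z) \<le> C * (W * M * norm z)" if "k \<le> M" for k
      using that C W by (intro mult_left_mono mult_right_mono) auto
    have e1: "(metric_deriv c x v - metric_deriv c y v) v z \<le> C * X * (M * M) * norm z"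
    proof -
      have "(metric_deriv c x v - metric_deriv c y v) v z \<le> norm (metric_deriv c x v - metric_deriv c y v) * norm v * norm z"
        using norm_blinfun2 abs_le_D1 by blast
      also have "\<dots> \<le> (C * X * norm v) * norm v * norm z"
        using DL[OF x y] unfolding X_def by (intro mult_right_mono) auto
      also have "\<dots> \<le> C * X * (M * M) * norm z" using P n1 by blast
      finally show ?thesis .
    qed
    have e2: "- (metric_deriv c x z - metric_deriv c y z) v v \<le> C * X * (M * M) * norm z"
    proof -
      have "- (metric_deriv c x z - metric_deriv c y z) v v \<le> norm (metric_deriv c x z - metric_deriv c y z) * norm v * norm v"
        using norm_blinfun2[of "metric_deriv c x z - metric_deriv c y z" v v] by (simp add: blinfun.minus_left)
      also have "\<dots> \<le> (C * X * norm z) * norm v * norm v"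
        using DL[OF x y] unfolding X_def by (intro mult_right_mono) auto
      also have "\<dots> \<le> C * X * (M * M) * norm z" using P n1 by blast
      finally show ?thesis .
    qed
    have f1: "metric_deriv c y (v - w) v z \<le> C * (W * M * norm z)"
      using D3[OF y, of "v - w" v z] Q[OF v] unfolding W_def by (simp add: algebra_simps)
    have f2: "metric_deriv c y w (v - w) z \<le> C * (W * M * norm z)"
      using D3[OF y, of w "v - w" z] Q[OF w] unfolding W_def by (simp add: algebra_simps)
    have f3: "- metric_deriv c y z (v - w) v \<le> C * (W * M * norm z)"
      using D3[OF y, of z "v - w" v] Q[OF v] unfolding W_def by (simp add: algebra_simps)
    have f4: "- metric_deriv c y z w (v - w) \<le> C * (W * M * norm z)"
      using D3[OF y, of z w "v - w"] Q[OF w] unfolding W_def by (simp add: algebra_simps)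
    have g: "(metric_in_chart A g c y - metric_in_chart A g c x) ?u' z \<le> C * X * K * norm z"
    proof -
      have "(metric_in_chart A g c y - metric_in_chart A g c x) ?u' z
          \<le> norm (metric_in_chart A g c y - metric_in_chart A g c x) * norm ?u' * norm z"
        using norm_blinfun2 abs_le_D1 by blast
      also have "\<dots> \<le> (C * X) * K * norm z"
        using GL[OF y x] \<Gamma>K[OF y w] C X K unfolding X_def
        by (intro mult_mono) (auto simp: norm_minus_commute)
      finally show ?thesis .
    qed
    have "2 * (a * (norm z)\<^sup>2) \<le> 2 * metric_form c x z z" using co[OF x, of z] by simp
    \<comment> \<open>The second vector satisfies the Koszul formula at \<open>y\<close>, so the
      metric at \<open>x\<close> is exchanged for the one at \<open>y\<close>; the last term is the
      cost.\<close>
    also have "\<dots> = 2 * metric_form c x ?u z - 2 * metric_form c y ?u' z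
       + 2 * (metric_in_chart A g c y - metric_in_chart A g c x) ?u' z"
      by (simp add: z_def bl)
    also have "2 * metric_form c x ?u z - 2 * metric_form c y ?u' z
      = 2 * ((metric_deriv c x v - metric_deriv c y v) v z + metric_deriv c y (v - w) v z + metric_deriv c y w (v - w) z)
       + (- (metric_deriv c x z - metric_deriv c y z) v v - metric_deriv c y z (v - w) v - metric_deriv c y z w (v - w))"
      unfolding christoffel_Koszul[OF c xi] christoffel_Koszul[OF c yi]
      by (simp add: linear_diff[OF lin] bl blinfun.minus_left)
    also have "\<dots> + 2 * (metric_in_chart A g c y - metric_in_chart A g c x) ?u' z
      \<le> norm z * (3 * (C * X * (M * M)) + 6 * (C * W * M) + 2 * (C * X * K))"
      using e1 e2 f1 f2 f3 f4 g by (simp add: algebra_simps)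
    also have "\<dots> \<le> norm z * ((3 * C * M\<^sup>2 + 6 * C * M + 2 * C * K) * (X + W))"
    proof (intro mult_left_mono)
      have "0 \<le> 3 * C * (M * M) * W + 6 * C * M * X + 2 * C * K * W"
        using C M K X W by (intro add_nonneg_nonneg mult_nonneg_nonneg) auto
      then show "3 * (C * X * (M * M)) + 6 * (C * W * M) + 2 * (C * X * K) \<le> (3 * C * M\<^sup>2 + 6 * C * M + 2 * C * K) * (X + W)"
        by (simp add: algebra_simps power2_eq_square)
    qed auto
    finally have *: "norm z * (2 * a * norm z) \<le> norm z * ((3 * C * M\<^sup>2 + 6 * C * M + 2 * C * K) * (X + W))"
      by (simp add: power2_eq_square algebra_simps)
    have "norm z \<le> L * (X + W)"
    proof (cases "z = 0")
      case True
      then show ?thesis using L X W by simp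
    next
      case False
      then have "2 * a * norm z \<le> (3 * C * M\<^sup>2 + 6 * C * M + 2 * C * K) * (X + W)"
        using * by (simp add: mult_le_cancel_left)
      also have "\<dots> = 2 * a * ((L - 1) * (X + W))" using a by (simp add: L_def)
      finally have "norm z \<le> (L - 1) * (X + W)" using a by simp
      then show ?thesis using X W by (simp add: algebra_simps)
    qed
    then show ?thesis unfolding z_def X_def W_def .
  qed
  then show ?thesis using r L by blast
qed

end

section \<open>Uniqueness of geodesics and the exponential map\<close>

lemma vector_derivative_unit_interval:
  assumes "(f has_vector_derivative v) (at t within {0..1})" "t \<in> {0..1::real}"
  shows "vector_derivative f (at t within {0..1}) = v"
  using vector_derivative_within_cbox[of 0 1 t f v] assms by simp

context riemannian_manifold
begin

text \<open>Near \<open>s\<close> both chart images stay in a ball with bounded velocities, where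
  the geodesic equation is Lipschitz. Equality of velocities is assumed for whatever derivatives
  exist, since its reason differs at the initial time and at a later one.\<close>

lemma geodesic_on_local_coincidence:
  assumes \<gamma>: "geodesic_on A g {0..1} \<gamma>" and \<eta>: "geodesic_on A g {0..1} \<eta>"
    and s: "0 \<le> s" "s < 1" and eq: "\<gamma> s = \<eta> s"
    and c: "c \<in> A" "\<gamma> s \<in> chart_dom c"
    and vel: "\<And>v w. ((chart_map c \<circ> \<gamma>) has_vector_derivative v) (at s within {0..1}) \<Longrightarrow>
        ((chart_map c \<circ> \<eta>) has_vector_derivative w) (at s within {0..1}) \<Longrightarrow> v = w"
  shows "\<exists>b>s. b \<le> 1 \<and> (\<forall>t\<in>{s..b}. \<gamma> t = \<eta> t)"
proof -
  let ?I = "{0..1} :: real set"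
  have sI: "s \<in> ?I" using s by simp
  obtain x' x'' where "\<forall>t\<in>?I. \<gamma> t \<in> chart_dom c \<longrightarrow>
        ((chart_map c \<circ> \<gamma>) has_vector_derivative x' t) (at t within ?I) \<and>
        (x' has_vector_derivative x'' t) (at t within ?I) \<and>
        x'' t = - christoffel A g c (chart_map c (\<gamma> t)) (x' t) (x' t)"
    using \<gamma> c(1) unfolding geodesic_on_def by blast
  then have x1: "\<And>t. t \<in> ?I \<Longrightarrow> \<gamma> t \<in> chart_dom c \<Longrightarrow> ((chart_map c \<circ> \<gamma>) has_vector_derivative x' t) (at t within ?I)"
    and x2: "\<And>t. t \<in> ?I \<Longrightarrow> \<gamma> t \<in> chart_dom c \<Longrightarrow> (x' has_vector_derivative x'' t) (at t within ?I)"
    and x3: "\<And>t. t \<in> ?I \<Longrightarrow> \<gamma> t \<in> chart_dom c \<Longrightarrow> x'' t = - christoffel A g c (chart_map c (\<gamma> t)) (x' t) (x' t)"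
    by auto
  obtain y' y'' where "\<forall>t\<in>?I. \<eta> t \<in> chart_dom c \<longrightarrow>
        ((chart_map c \<circ> \<eta>) has_vector_derivative y' t) (at t within ?I) \<and>
        (y' has_vector_derivative y'' t) (at t within ?I) \<and>
        y'' t = - christoffel A g c (chart_map c (\<eta> t)) (y' t) (y' t)"
    using \<eta> c(1) unfolding geodesic_on_def by blast
  then have y1: "\<And>t. t \<in> ?I \<Longrightarrow> \<eta> t \<in> chart_dom c \<Longrightarrow> ((chart_map c \<circ> \<eta>) has_vector_derivative y' t) (at t within ?I)"
    and y2: "\<And>t. t \<in> ?I \<Longrightarrow> \<eta> t \<in> chart_dom c \<Longrightarrow> (y' has_vector_derivative y'' t) (at t within ?I)"
    and y3: "\<And>t. t \<in> ?I \<Longrightarrow> \<eta> t \<in> chart_dom c \<Longrightarrow> y'' t = - christoffel A g c (chart_map c (\<eta> t)) (y' t) (y' t)"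
    by auto
  have cs: "\<eta> s \<in> chart_dom c" using c(2) eq by simp
  have v: "x' s = y' s" by (rule vel[OF x1[OF sI c(2)] y1[OF sI cs]])
  \<comment> \<open>The margin of \<open>1\<close> over the common velocity at \<open>s\<close> lets
    both velocities stay below \<open>M\<close> for a while, by continuity.\<close>
  define M where "M = norm (x' s) + 1"
  define x0 where "x0 = chart_map c (\<gamma> s)"
  have x0: "x0 \<in> chart_map c ` chart_dom c" using c(2) by (simp add: x0_def)
  have "M \<ge> 0" by (simp add: M_def)
  obtain r L where r: "r > 0" and L: "L > 0" and lip: "\<forall>x\<in>ball x0 r. \<forall>y\<in>ball x0 r. \<forall>v w. norm v \<le> M \<longrightarrow> norm w \<le> M \<longrightarrow>
     norm (christoffel A g c x v v - christoffel A g c y w w) \<le> L * (norm (x - y) + norm (v - w))"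
    using christoffel_local_Lipschitz[OF c(1) x0 \<open>M \<ge> 0\<close>] by blast
  have near: "eventually (\<lambda>t. \<zeta> t \<in> chart_dom c \<and> chart_map c (\<zeta> t) \<in> ball x0 r \<and> norm (z' t) \<le> M) (at s within ?I)"
    if \<zeta>: "geodesic_on A g ?I \<zeta>" "\<zeta> s = \<gamma> s" "z' s = x' s"
      and d1: "((chart_map c \<circ> \<zeta>) has_vector_derivative z1) (at s within ?I)"
      and d2: "(z' has_vector_derivative z2) (at s within ?I)" for \<zeta> z' z1 z2
  proof -
    have "(\<zeta> \<longlongrightarrow> \<zeta> s) (at s within ?I)"
      using \<zeta>(1) sI unfolding geodesic_on_def continuous_on_def by blast
    then have e1: "eventually (\<lambda>t. \<zeta> t \<in> chart_dom c) (at s within ?I)"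
      using open_chart_dom[OF c(1)] c(2) \<zeta>(2) by (auto dest: topological_tendstoD)
    have "((chart_map c \<circ> \<zeta>) \<longlongrightarrow> (chart_map c \<circ> \<zeta>) s) (at s within ?I)"
      using has_vector_derivative_continuous[OF d1] by (simp add: continuous_within)
    from tendstoD[OF this r]
    have "eventually (\<lambda>t. dist ((chart_map c \<circ> \<zeta>) t) x0 < r) (at s within ?I)"
      using \<zeta>(2) by (simp add: x0_def)
    then have e2: "eventually (\<lambda>t. chart_map c (\<zeta> t) \<in> ball x0 r) (at s within ?I)"
      by (simp add: dist_commute)
    have "((\<lambda>t. norm (z' t)) \<longlongrightarrow> norm (z' s)) (at s within ?I)"
      using has_vector_derivative_continuous[OF d2] by (intro tendsto_norm) (simp add: continuous_within)
    then have "eventually (\<lambda>t. norm (z' t) < M) (at s within ?I)"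
      by (rule order_tendstoD) (simp add: \<zeta>(3) M_def)
    then show ?thesis using e1 e2 by eventually_elim auto
  qed
  have "eventually (\<lambda>t. (\<gamma> t \<in> chart_dom c \<and> chart_map c (\<gamma> t) \<in> ball x0 r \<and> norm (x' t) \<le> M) \<and>
      (\<eta> t \<in> chart_dom c \<and> chart_map c (\<eta> t) \<in> ball x0 r \<and> norm (y' t) \<le> M)) (at s within ?I)"
    using near[OF \<gamma> refl refl x1[OF sI c(2)] x2[OF sI c(2)]]
      near[OF \<eta> eq[symmetric] v[symmetric] y1[OF sI cs] y2[OF sI cs]]
    by (rule eventually_conj)
  then obtain d where d: "d > 0" "\<And>t. t \<in> ?I \<Longrightarrow> t \<noteq> s \<Longrightarrow> dist t s < d \<Longrightarrow>
      (\<gamma> t \<in> chart_dom c \<and> chart_map c (\<gamma> t) \<in> ball x0 r \<and> norm (x' t) \<le> M) \<and>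
      (\<eta> t \<in> chart_dom c \<and> chart_map c (\<eta> t) \<in> ball x0 r \<and> norm (y' t) \<le> M)"
    unfolding eventually_at by blast
  define b where "b = min 1 (s + d / 2)"
  have b: "s < b" "b \<le> 1" using d(1) s by (auto simp: b_def)
  have sub: "{s..b} \<subseteq> ?I" using s b by auto
  have good: "(\<gamma> t \<in> chart_dom c \<and> chart_map c (\<gamma> t) \<in> ball x0 r \<and> norm (x' t) \<le> M) \<and>
      (\<eta> t \<in> chart_dom c \<and> chart_map c (\<eta> t) \<in> ball x0 r \<and> norm (y' t) \<le> M)" if t: "t \<in> {s..b}" for t
  proof (cases "t = s")
    case True
    then show ?thesis using c(2) eq v r by (simp add: x0_def M_def)
  next
    case False
    have "dist t s < d" using t d(1) by (auto simp: b_def dist_real_def)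
    then show ?thesis using d(2)[of t] False t sub by blast
  qed
  have "\<exists>b'. s < b' \<and> b' \<le> b \<and> (\<forall>t\<in>{s..b'}. (chart_map c \<circ> \<gamma>) t = (chart_map c \<circ> \<eta>) t)"
  proof (rule second_order_ODE_local_uniqueness[OF b(1) L, where x'=x' and y'=y' and x''=x'' and y''=y''])
    fix t assume t: "t \<in> {s..b}"
    then have tI: "t \<in> ?I" using sub by blast
    note g = good[OF t]
    have gt: "\<gamma> t \<in> chart_dom c" "\<eta> t \<in> chart_dom c" using g by auto
    show "((chart_map c \<circ> \<gamma>) has_vector_derivative x' t) (at t within {s..b})"
      by (rule has_vector_derivative_within_subset[OF x1[OF tI gt(1)] sub])
    show "(x' has_vector_derivative x'' t) (at t within {s..b})"
      by (rule has_vector_derivative_within_subset[OF x2[OF tI gt(1)] sub])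
    show "((chart_map c \<circ> \<eta>) has_vector_derivative y' t) (at t within {s..b})"
      by (rule has_vector_derivative_within_subset[OF y1[OF tI gt(2)] sub])
    show "(y' has_vector_derivative y'' t) (at t within {s..b})"
      by (rule has_vector_derivative_within_subset[OF y2[OF tI gt(2)] sub])
    have "norm (christoffel A g c (chart_map c (\<gamma> t)) (x' t) (x' t) - christoffel A g c (chart_map c (\<eta> t)) (y' t) (y' t))
       \<le> L * (norm (chart_map c (\<gamma> t) - chart_map c (\<eta> t)) + norm (x' t - y' t))"
      using lip g by blast
    then show "norm (x'' t - y'' t) \<le> L * (norm ((chart_map c \<circ> \<gamma>) t - (chart_map c \<circ> \<eta>) t) + norm (x' t - y' t))"
      unfolding x3[OF tI gt(1)] y3[OF tI gt(2)] by (simp add: norm_minus_commute)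
  qed (use eq v in auto)
  then obtain b' where b': "s < b'" "b' \<le> b" "\<And>t. t \<in> {s..b'} \<Longrightarrow> chart_map c (\<gamma> t) = chart_map c (\<eta> t)"
    by auto
  have "\<gamma> t = \<eta> t" if t: "t \<in> {s..b'}" for t
  proof -
    have "t \<in> {s..b}" using t b' by auto
    then have "\<gamma> t \<in> chart_dom c" "\<eta> t \<in> chart_dom c" using good by auto
    then show ?thesis using b'(3)[OF t] chart_inj[OF c(1)] by (simp add: inj_onD)
  qed
  then show ?thesis using b' b by (intro exI[of _ b']) auto
qed

text \<open>At the supremum \<open>s\<close> of the times up to which the curves agree, positions
  coincide by continuity in a Hausdorff space; velocities coincide by hypothesis if
  \<open>s = 0\<close> and as derivatives from the left otherwise. Local coincidence then pushes
  past \<open>s\<close> unless \<open>s = 1\<close>.\<close>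

lemma geodesic_on_unique:
  assumes \<gamma>: "geodesic_on A g {0..1} \<gamma>" and \<eta>: "geodesic_on A g {0..1} \<eta>"
    and start: "\<gamma> 0 = \<eta> 0" and vel: "velocity A {0..1} \<gamma> 0 = velocity A {0..1} \<eta> 0"
    and t: "t \<in> {0..1}"
  shows "\<gamma> t = \<eta> t"
proof -
  define S where "S = {t \<in> {0..1}. \<forall>s\<in>{0..t}. \<gamma> s = \<eta> s}"
  have 0: "0 \<in> S" using start by (simp add: S_def)
  have bdd: "bdd_above S" by (rule bdd_aboveI[of _ 1]) (auto simp: S_def)
  define s where "s = Sup S"
  have s: "0 \<le> s" "s \<le> 1"
  proof -
    show "0 \<le> s" using cSup_upper[OF 0 bdd] by (simp add: s_def)
    have "S \<noteq> {}" using 0 by blast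
    then show "s \<le> 1" unfolding s_def by (rule cSup_least) (simp add: S_def)
  qed
  have before: "\<gamma> u = \<eta> u" if u: "0 \<le> u" "u < s" for u
  proof -
    obtain v where "v \<in> S" "u < v"
      using less_cSupE[of u S] 0 u(2) unfolding s_def by auto
    then show ?thesis using u by (simp add: S_def)
  qed
  have at_s: "\<gamma> s = \<eta> s"
  proof (cases "s = 0")
    case False
    have "continuous_on {0..1} \<gamma>" "continuous_on {0..1} \<eta>" using \<gamma> \<eta> by (simp_all add: geodesic_on_def)
    then have "continuous_on {0..s} \<gamma>" "continuous_on {0..s} \<eta>"
      using s(2) by (simp_all add: continuous_on_subset)
    then have "(\<gamma> \<longlongrightarrow> \<gamma> s) (at s within {0..s})" "(\<eta> \<longlongrightarrow> \<eta> s) (at s within {0..s})"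
      using s(1) by (simp_all add: continuous_on_def)
    moreover have "eventually (\<lambda>u. \<gamma> u = \<eta> u) (at s within {0..s})"
      unfolding eventually_at using before by (intro exI[of _ 1]) auto
    ultimately have "(\<eta> \<longlongrightarrow> \<gamma> s) (at s within {0..s})" using tendsto_cong[of \<gamma> \<eta>] by simp
    moreover have "at s within {0..s} \<noteq> bot"
      using False s by (simp add: at_within_Icc_at_left trivial_limit_at_left_real)
    ultimately show ?thesis using \<open>(\<eta> \<longlongrightarrow> \<eta> s) (at s within {0..s})\<close> by (intro tendsto_unique)
  qed (use start in simp)
  have upto: "\<gamma> u = \<eta> u" if "u \<in> {0..s}" for u
    using before[of u] at_s that by (cases "u = s") auto
  have "s = 1"
  proof (rule ccontr)
    assume "s \<noteq> 1"
    then have s1: "s < 1" using s by simp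
    obtain c where c: "c \<in> A" "\<gamma> s \<in> chart_dom c" by (rule exists_chart)
    have "\<exists>b>s. b \<le> 1 \<and> (\<forall>t\<in>{s..b}. \<gamma> t = \<eta> t)"
    proof (rule geodesic_on_local_coincidence[OF \<gamma> \<eta> s(1) s1 at_s c])
      fix v w assume v: "((chart_map c \<circ> \<gamma>) has_vector_derivative v) (at s within {0..1})"
        and w: "((chart_map c \<circ> \<eta>) has_vector_derivative w) (at s within {0..1})"
      show "v = w"
      proof (cases "s = 0")
        case True
        have "coord (velocity A {0..1} \<gamma> 0) c = v"
          using v c True by (simp add: velocity_def Tvec_inverse vector_derivative_unit_interval)
        moreover have "coord (velocity A {0..1} \<eta> 0) c = w"
          using w c True start by (simp add: velocity_def Tvec_inverse vector_derivative_unit_interval)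
        ultimately show ?thesis using vel by simp
      next
        case False
        \<comment> \<open>For \<open>s > 0\<close> both derivatives are restricted to
          \<open>{0..s}\<close>, where the curves are the same and the derivative at the end point
          is unique.\<close>
        have sub: "{0..s} \<subseteq> {0..1}" using s by simp
        have "((chart_map c \<circ> \<eta>) has_vector_derivative v) (at s within {0..s})"
          using has_vector_derivative_within_subset[OF v sub]
          by (rule has_vector_derivative_transform_within[where d=1]) (use s upto in auto)
        moreover have "at s within {0..s} \<noteq> bot"
          using False s by (simp add: at_within_Icc_at_left trivial_limit_at_left_real)
        ultimately show ?thesis
          using vector_derivative_unique_within has_vector_derivative_within_subset[OF w sub] by blast
      qed
    qed
    then obtain b where b: "s < b" "b \<le> 1" "\<And>t. t \<in> {s..b} \<Longrightarrow> \<gamma> t = \<eta> t" by blast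
    have "\<gamma> u = \<eta> u" if "u \<in> {0..b}" for u
      using upto[of u] b(3)[of u] that by (cases "u \<le> s") auto
    then have "b \<in> S" using b s by (auto simp: S_def)
    then have "b \<le> s" unfolding s_def using bdd by (rule cSup_upper)
    then show False using b by simp
  qed
  then show ?thesis using upto t by simp
qed

text \<open>Uniqueness of geodesics gives the definite description in \<open>riem_exp\<close> its
  value, which any geodesic with the right initial data computes.\<close>

lemma riem_exp_eq:
  assumes "exp_geodesic A g p v \<gamma>"
  shows "riem_exp A g p v = \<gamma> 1"
  unfolding riem_exp_def
proof (rule the_equality)
  show "\<exists>\<gamma>'. exp_geodesic A g p v \<gamma>' \<and> \<gamma>' 1 = \<gamma> 1" using assms by blast
  fix q assume "\<exists>\<gamma>'. exp_geodesic A g p v \<gamma>' \<and> \<gamma>' 1 = q"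
  then obtain \<gamma>' where \<gamma>': "exp_geodesic A g p v \<gamma>'" "\<gamma>' 1 = q" by blast
  have "\<gamma>' 1 = \<gamma> 1"
    by (rule geodesic_on_unique) (use assms \<gamma>' in \<open>simp_all add: exp_geodesic_def\<close>)
  then show "q = \<gamma> 1" using \<gamma>' by simp
qed

text \<open>Slowing down by \<open>s\<close> multiplies the acceleration by
  \<open>s\<^sup>2\<close>, and the Christoffel term scales alike. The restriction to
  \<open>s \<le> 1\<close> keeps \<open>s * t\<close> inside the interval on which
  \<open>\<gamma>\<close> is a geodesic; \<open>s = 0\<close> gives the constant curve.\<close>

lemma exp_geodesic_rescale:
  assumes \<gamma>: "exp_geodesic A g p v \<gamma>" and s: "s \<in> {0..1}"
  shows "exp_geodesic A g p (s *\<^sub>R v) (\<lambda>t. \<gamma> (s * t))"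
proof -
  let ?I = "{0..1} :: real set"
  let ?\<eta> = "\<lambda>t. \<gamma> (s * t)"
  have geo: "geodesic_on A g ?I \<gamma>" and p: "\<gamma> 0 = p" and v: "velocity A ?I \<gamma> 0 = v"
    using \<gamma> by (auto simp: exp_geodesic_def)
  have img: "(\<lambda>t. s * t) ` ?I \<subseteq> ?I" using s by (auto simp: mult_le_one)
  have sd: "((\<lambda>t. s * t) has_vector_derivative s) (at t within ?I)" for t
    by (auto intro!: derivative_eq_intros simp: has_real_derivative_iff_has_vector_derivative[symmetric])
  have chain: "((\<lambda>t. f (s * t)) has_vector_derivative s *\<^sub>R f') (at t within ?I)"
    if "(f has_vector_derivative f') (at (s * t) within ?I)" for f :: "real \<Rightarrow> 'e" and f' t
    using vector_diff_chain_within[OF sd has_vector_derivative_within_subset[OF that img]]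
    by (simp add: o_def)
  have "\<exists>y' y''. \<forall>t\<in>?I. ?\<eta> t \<in> chart_dom c \<longrightarrow>
        ((chart_map c \<circ> ?\<eta>) has_vector_derivative y' t) (at t within ?I) \<and>
        (y' has_vector_derivative y'' t) (at t within ?I) \<and>
        y'' t = - christoffel A g c (chart_map c (?\<eta> t)) (y' t) (y' t)" if c: "c \<in> A" for c
  proof -
    obtain x' x'' where x: "\<forall>t\<in>?I. \<gamma> t \<in> chart_dom c \<longrightarrow>
        ((chart_map c \<circ> \<gamma>) has_vector_derivative x' t) (at t within ?I) \<and>
        (x' has_vector_derivative x'' t) (at t within ?I) \<and>
        x'' t = - christoffel A g c (chart_map c (\<gamma> t)) (x' t) (x' t)"
      using geo c unfolding geodesic_on_def by blast
    show ?thesis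
    proof (rule exI[of _ "\<lambda>t. s *\<^sub>R x' (s * t)"], rule exI[of _ "\<lambda>t. s\<^sup>2 *\<^sub>R x'' (s * t)"], intro ballI impI)
      fix t assume t: "t \<in> ?I" and d: "?\<eta> t \<in> chart_dom c"
      have st: "s * t \<in> ?I" using t img by blast
      have d1: "((chart_map c \<circ> \<gamma>) has_vector_derivative x' (s * t)) (at (s * t) within ?I)"
        and d2: "(x' has_vector_derivative x'' (s * t)) (at (s * t) within ?I)"
        and d3: "x'' (s * t) = - christoffel A g c (chart_map c (\<gamma> (s * t))) (x' (s * t)) (x' (s * t))"
        using x st d by auto
      have "((\<lambda>t. (chart_map c \<circ> \<gamma>) (s * t)) has_vector_derivative s *\<^sub>R x' (s * t)) (at t within ?I)"
        by (rule chain[OF d1])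
      moreover have "((\<lambda>t. s *\<^sub>R x' (s * t)) has_vector_derivative s *\<^sub>R (s *\<^sub>R x'' (s * t))) (at t within ?I)"
        using bounded_linear.has_vector_derivative[OF bounded_linear_scaleR_right chain[OF d2]] .
      moreover have "s\<^sup>2 *\<^sub>R x'' (s * t) = - christoffel A g c (chart_map c (?\<eta> t)) (s *\<^sub>R x' (s * t)) (s *\<^sub>R x' (s * t))"
        using d3 d c by (simp add: christoffel_scale)
      ultimately show "((chart_map c \<circ> ?\<eta>) has_vector_derivative s *\<^sub>R x' (s * t)) (at t within ?I) \<and>
        ((\<lambda>t. s *\<^sub>R x' (s * t)) has_vector_derivative s\<^sup>2 *\<^sub>R x'' (s * t)) (at t within ?I) \<and>
        s\<^sup>2 *\<^sub>R x'' (s * t) = - christoffel A g c (chart_map c (?\<eta> t)) (s *\<^sub>R x' (s * t)) (s *\<^sub>R x' (s * t))"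
        by (simp add: o_def power2_eq_square)
    qed
  qed
  moreover have "continuous_on ?I ?\<eta>"
  proof -
    have "continuous_on ?I \<gamma>" using geo by (simp add: geodesic_on_def)
    then show ?thesis
      by (rule continuous_on_compose2) (use img in \<open>auto intro!: continuous_intros\<close>)
  qed
  ultimately have "geodesic_on A g ?I ?\<eta>" unfolding geodesic_on_def by blast
  moreover have "velocity A ?I ?\<eta> 0 = s *\<^sub>R v"
  proof -
    have "coord (velocity A ?I ?\<eta> 0) c = coord (s *\<^sub>R v) c" for c
    proof (cases "c \<in> A \<and> p \<in> chart_dom c")
      case True
      then obtain x' where d: "((chart_map c \<circ> \<gamma>) has_vector_derivative x') (at 0 within ?I)"
        using geo p unfolding geodesic_on_def by (metis atLeastAtMost_iff order_refl zero_le_one)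
      have "((\<lambda>t. (chart_map c \<circ> \<gamma>) (s * t)) has_vector_derivative s *\<^sub>R x') (at 0 within ?I)"
        by (rule chain[where f="chart_map c \<circ> \<gamma>"]) (use d in simp)
      then have "coord (velocity A ?I ?\<eta> 0) c = s *\<^sub>R x'"
        using True p by (simp add: velocity_def Tvec_inverse o_def vector_derivative_unit_interval)
      moreover have "coord v c = x'"
        using True p d v[symmetric] by (simp add: velocity_def Tvec_inverse vector_derivative_unit_interval)
      ultimately show ?thesis by (simp add: scaleR_tvec.rep_eq)
    next
      case False
      then show ?thesis using p v[symmetric] by (auto simp: velocity_def Tvec_inverse scaleR_tvec.rep_eq)
    qed
    then show ?thesis by (metis coord_inject ext)
  qed
  ultimately show ?thesis using p by (simp add: exp_geodesic_def)
qed

lemma riem_exp_ray: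
  assumes "exp_geodesic A g p v \<gamma>" "s \<in> {0..1}"
  shows "riem_exp A g p (s *\<^sub>R v) = \<gamma> s"
  using riem_exp_eq[OF exp_geodesic_rescale[OF assms]] by simp

lemma riem_exp_zero:
  assumes "v \<in> exp_domain A g p"
  shows "riem_exp A g p 0 = p"
proof -
  obtain \<gamma> where \<gamma>: "exp_geodesic A g p v \<gamma>" using assms by (auto simp: exp_domain_def)
  then show ?thesis using riem_exp_ray[OF \<gamma>, of 0] by (simp add: exp_geodesic_def)
qed

text \<open>Along a ray the exponential map traces the geodesic itself, so its derivative is the
  initial velocity. The derivative is one-sided because geodesics are given for nonnegative
  time.\<close>

lemma riem_exp_ray_has_vector_derivative:
  assumes v: "v \<in> exp_domain A g p" and c: "c \<in> A" "p \<in> chart_dom c"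
  shows "((\<lambda>s. chart_map c (riem_exp A g p (s *\<^sub>R v))) has_vector_derivative coord v c) (at 0 within {0..1})"
proof -
  obtain \<gamma> where \<gamma>: "exp_geodesic A g p v \<gamma>" using v by (auto simp: exp_domain_def)
  then have geo: "geodesic_on A g {0..1} \<gamma>" and p: "\<gamma> 0 = p" and vel: "velocity A {0..1} \<gamma> 0 = v"
    by (auto simp: exp_geodesic_def)
  obtain x' where d: "((chart_map c \<circ> \<gamma>) has_vector_derivative x') (at 0 within {0..1})"
    using geo p c unfolding geodesic_on_def by (metis atLeastAtMost_iff order_refl zero_le_one)
  have "coord v c = x'"
    using c p d vel[symmetric] by (simp add: velocity_def Tvec_inverse vector_derivative_unit_interval)
  moreover have "((\<lambda>s. chart_map c (riem_exp A g p (s *\<^sub>R v))) has_vector_derivative x') (at 0 within {0..1})"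
    by (rule has_vector_derivative_transform[OF _ _ d]) (simp_all add: riem_exp_ray[OF \<gamma>])
  ultimately show ?thesis by simp
qed

end

section \<open>Lengths of curves\<close>

context riemannian_manifold
begin

abbreviation speed :: "(real \<Rightarrow> 'm) \<Rightarrow> real \<Rightarrow> real" where
  "speed \<gamma> t \<equiv> tangent_norm g (\<gamma> t) (velocity A {0..1} \<gamma> t)"

text \<open>\<open>velocity\<close> differentiates in every chart separately. Differentiability in
  one chart makes these coordinates compatible, so that the velocity is tangent and its norm can be
  computed in that chart.\<close>

lemma velocity_eq_of_coord:
  assumes c: "c \<in> A" "\<gamma> t \<in> chart_dom c" and t: "t \<in> {0..1}"
    and cont: "continuous (at t within {0..1}) \<gamma>"
    and d: "((chart_map c \<circ> \<gamma>) has_vector_derivative v) (at t within {0..1})"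
  shows "velocity A {0..1} \<gamma> t = of_coord A c (\<gamma> t) v"
proof -
  have "coord (velocity A {0..1} \<gamma> t) c' = coord (of_coord A c (\<gamma> t) v) c'" for c'
  proof (cases "c' \<in> A \<and> \<gamma> t \<in> chart_dom c'")
    case True
    then have "((chart_map c' \<circ> \<gamma>) has_vector_derivative transition_derivative c c' (\<gamma> t) v) (at t within {0..1})"
      using curve_change_chart[OF c(1) _ c(2) _ t cont d] by blast
    then have "coord (velocity A {0..1} \<gamma> t) c' = transition_derivative c c' (\<gamma> t) v"
      using True t by (simp add: velocity_def Tvec_inverse vector_derivative_unit_interval)
    then show ?thesis using True by (simp add: coord_of_coord)
  next
    case False
    have "coord (velocity A {0..1} \<gamma> t) c' = 0"
      unfolding velocity_def using False by (simp add: Tvec_inverse) blast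
    then show ?thesis using coord_of_coord_outside[OF False] by simp
  qed
  then show ?thesis by (metis coord_inject ext)
qed

lemma speed_eq:
  assumes c: "c \<in> A" "\<gamma> t \<in> chart_dom c" and t: "t \<in> {0..1}"
    and cont: "continuous (at t within {0..1}) \<gamma>"
    and d: "((chart_map c \<circ> \<gamma>) has_vector_derivative v) (at t within {0..1})"
  shows "speed \<gamma> t = sqrt (metric_form c (chart_map c (\<gamma> t)) v v)"
  unfolding velocity_eq_of_coord[OF assms]
  by (simp add: tangent_norm_eq[OF c of_coord_in_tangent_space[OF c]] coord_of_coord_self[OF c])

lemma metric_in_chart_continuous:
  "c \<in> A \<Longrightarrow> continuous_on (chart_map c ` chart_dom c) (metric_in_chart A g c)"
  by (rule has_derivative_continuous_on)
     (rule has_derivative_at_withinI[OF smooth_on_has_derivative[OF metric_smooth]])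

text \<open>\<open>speed\<close> uses derivatives within \<open>{0..1}\<close>, the
  \<open>C1_curve_on\<close> condition those within \<open>{a..b}\<close>. They agree in the
  interior, where the speed equals a continuous function on \<open>{a..b}\<close>; the end points
  are a null set.\<close>

lemma speed_integrable_on_piece:
  assumes cont: "continuous_on {0..1} \<gamma>" and ab: "0 \<le> a" "a \<le> b" "b \<le> 1"
    and C1: "a < b \<Longrightarrow> C1_curve_on A a b \<gamma>" and c: "c \<in> A" "\<And>t. t \<in> {a..b} \<Longrightarrow> \<gamma> t \<in> chart_dom c"
  shows "speed \<gamma> integrable_on {a..b}"
proof (cases "a = b")
  case False
  then have "a < b" using ab by simp
  have dom: "{t \<in> {a..b}. \<gamma> t \<in> chart_dom c} = {a..b}" using c(2) by auto
  obtain \<gamma>' where \<gamma>': "continuous_on {a..b} \<gamma>'"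
    "\<And>t. t \<in> {a..b} \<Longrightarrow> ((chart_map c \<circ> \<gamma>) has_vector_derivative \<gamma>' t) (at t within {a..b})"
    using C1[OF \<open>a < b\<close>] c unfolding C1_curve_on_def by (metis dom)
  have sub: "{a..b} \<subseteq> {0..1}" using ab by auto
  have cab: "continuous_on {a..b} \<gamma>" by (rule continuous_on_subset[OF cont sub])
  have x: "continuous_on {a..b} (\<lambda>t. chart_map c (\<gamma> t))"
    by (rule continuous_on_compose2[OF chart_continuous[OF c(1)] cab]) (use c(2) in blast)
  have G: "continuous_on {a..b} (\<lambda>t. metric_in_chart A g c (chart_map c (\<gamma> t)))"
    by (rule continuous_on_compose2[OF metric_in_chart_continuous[OF c(1)] x]) (use c(2) in blast)
  have "continuous_on {a..b} (\<lambda>t. sqrt (metric_form c (chart_map c (\<gamma> t)) (\<gamma>' t) (\<gamma>' t)))"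
    by (intro continuous_on_real_sqrt blinfun.continuous_on G \<gamma>'(1))
  then have i: "(\<lambda>t. sqrt (metric_form c (chart_map c (\<gamma> t)) (\<gamma>' t) (\<gamma>' t))) integrable_on {a..b}"
    by (rule integrable_continuous_interval)
  show ?thesis
  proof (rule integrable_spike_finite[OF _ _ i])
    show "finite {a, b}" by simp
    fix t assume t: "t \<in> {a..b} - {a, b}"
    then have ti: "t \<in> {a<..<b}" by auto
    have "((chart_map c \<circ> \<gamma>) has_vector_derivative \<gamma>' t) (at t within {a<..<b})"
      by (rule has_vector_derivative_within_subset[OF \<gamma>'(2)]) (use t in auto)
    then have "((chart_map c \<circ> \<gamma>) has_vector_derivative \<gamma>' t) (at t)"
      using at_within_open[OF ti open_greaterThanLessThan] by simp
    then have d: "((chart_map c \<circ> \<gamma>) has_vector_derivative \<gamma>' t) (at t within {0..1})"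
      by (rule has_vector_derivative_at_within)
    have t01: "t \<in> {0..1}" using t sub by blast
    then have "continuous (at t within {0..1}) \<gamma>" using cont by (simp add: continuous_on_eq_continuous_within)
    then show "speed \<gamma> t = sqrt (metric_form c (chart_map c (\<gamma> t)) (\<gamma>' t) (\<gamma>' t))"
      using t c by (intro speed_eq t01 d) auto
  qed
qed (use integrable_on_refl[of "speed \<gamma>" a] in simp)

text \<open>Integrability is local. A small interval around \<open>t\<close> lies in one chart and
  contains no break point except possibly \<open>t\<close>, so it is cut at \<open>t\<close> into
  two pieces that are \<open>C1\<close> up to their ends.\<close>

lemma speed_integrable:
  assumes "piecewise_C1_curve A \<gamma>"
  shows "speed \<gamma> integrable_on {0..1}"
proof -
  have cont: "continuous_on {0..1} \<gamma>" using assms by (simp add: piecewise_C1_curve_def)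
  obtain S where S: "finite S" "\<And>a b. 0 \<le> a \<Longrightarrow> a < b \<Longrightarrow> b \<le> 1 \<Longrightarrow> {a<..<b} \<inter> S = {} \<Longrightarrow> C1_curve_on A a b \<gamma>"
    using assms unfolding piecewise_C1_curve_def by blast
  have "\<exists>d>0. \<forall>u v. t \<in> cbox u v \<and> cbox u v \<subseteq> ball t d \<and> cbox u v \<subseteq> cbox 0 1 \<longrightarrow> speed \<gamma> integrable_on cbox u v"
    if t: "t \<in> cbox 0 1" for t
  proof -
    have t': "t \<in> {0..1}" using t by simp
    obtain c where c: "c \<in> A" "\<gamma> t \<in> chart_dom c" by (rule exists_chart)
    obtain e where e: "e > 0" "\<And>s. s \<in> S \<Longrightarrow> s \<noteq> t \<Longrightarrow> e \<le> dist t s"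
      using finite_set_avoid[OF S(1), of t] by auto
    have "(\<gamma> \<longlongrightarrow> \<gamma> t) (at t within {0..1})" using cont t' by (simp add: continuous_on_def)
    then have "eventually (\<lambda>s. \<gamma> s \<in> chart_dom c) (at t within {0..1})"
      using open_chart_dom[OF c(1)] c(2) by (rule topological_tendstoD)
    then obtain d where d: "d > 0" "\<And>s. s \<in> {0..1} \<Longrightarrow> s \<noteq> t \<Longrightarrow> dist s t < d \<Longrightarrow> \<gamma> s \<in> chart_dom c"
      unfolding eventually_at by blast
    have "speed \<gamma> integrable_on {u..v}"
      if uv: "t \<in> {u..v}" "{u..v} \<subseteq> ball t (min d e)" "{u..v} \<subseteq> {0..1}" for u v
    proof -
      have dom: "\<gamma> s \<in> chart_dom c" if "s \<in> {u..v}" for s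
      proof (cases "s = t")
        case False
        have "s \<in> ball t (min d e)" using that uv(2) by blast
        then show ?thesis using d(2)[of s] False that uv(3) by (auto simp: dist_commute)
      qed (use c in simp)
      have nS: "s \<notin> S" if "s \<in> {u..v}" "s \<noteq> t" for s
      proof
        assume "s \<in> S"
        then have "e \<le> dist t s" using e(2) that(2) by blast
        moreover have "s \<in> ball t (min d e)" using that uv(2) by blast
        ultimately show False by simp
      qed
      have u: "u \<le> t" "t \<le> v" "0 \<le> u" "v \<le> 1" using uv by auto
      have "speed \<gamma> integrable_on {u..t}"
      proof (rule speed_integrable_on_piece[OF cont _ _ _ _ c(1)])
        show "C1_curve_on A u t \<gamma>" if "u < t"
          using nS u that by (intro S(2)) fastforce+
        show "\<gamma> s \<in> chart_dom c" if "s \<in> {u..t}" for s using that u by (intro dom) auto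
      qed (use u in auto)
      moreover have "speed \<gamma> integrable_on {t..v}"
      proof (rule speed_integrable_on_piece[OF cont _ _ _ _ c(1)])
        show "C1_curve_on A t v \<gamma>" if "t < v"
          using nS u that by (intro S(2)) fastforce+
        show "\<gamma> s \<in> chart_dom c" if "s \<in> {t..v}" for s using that u by (intro dom) auto
      qed (use u in auto)
      ultimately show ?thesis using Henstock_Kurzweil_Integration.integrable_combine[OF u(1,2)] by blast
    qed
    then show ?thesis using d(1) e(1) by (intro exI[of _ "min d e"]) auto
  qed
  then have "speed \<gamma> integrable_on cbox 0 1" by (intro integrable_on_little_subintervals) blast
  then show ?thesis by simp
qed

lemma piecewise_C1_curveE:
  assumes "piecewise_C1_curve A \<gamma>"
  obtains S where "finite S" "continuous_on {0..1} \<gamma>"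
    "\<And>t c. t \<in> {0<..<1} - S \<Longrightarrow> c \<in> A \<Longrightarrow> \<gamma> t \<in> chart_dom c \<Longrightarrow>
       \<exists>v. ((chart_map c \<circ> \<gamma>) has_vector_derivative v) (at t)"
proof -
  have cont: "continuous_on {0..1} \<gamma>" using assms by (simp add: piecewise_C1_curve_def)
  obtain S where S: "finite S" "\<And>a b. 0 \<le> a \<Longrightarrow> a < b \<Longrightarrow> b \<le> 1 \<Longrightarrow> {a<..<b} \<inter> S = {} \<Longrightarrow> C1_curve_on A a b \<gamma>"
    using assms unfolding piecewise_C1_curve_def by blast
  have "\<exists>v. ((chart_map c \<circ> \<gamma>) has_vector_derivative v) (at t)"
    if t: "t \<in> {0<..<1} - S" and c: "c \<in> A" "\<gamma> t \<in> chart_dom c" for t c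
  proof -
    obtain e where e: "e > 0" "\<And>s. s \<in> S \<Longrightarrow> s \<noteq> t \<Longrightarrow> e \<le> dist t s"
      using finite_set_avoid[OF S(1), of t] by auto
    define a where "a = max 0 (t - e)"
    define b where "b = min 1 (t + e)"
    have ab: "0 \<le> a" "a < b" "b \<le> 1" "t \<in> {a<..<b}" using t e(1) by (auto simp: a_def b_def)
    have "s \<notin> S" if "s \<in> {a<..<b}" for s
    proof
      assume s: "s \<in> S"
      then have "e \<le> dist t s" using e(2) t by blast
      then show False using that by (auto simp: a_def b_def dist_real_def)
    qed
    then have "{a<..<b} \<inter> S = {}" by blast
    then have "C1_curve_on A a b \<gamma>" by (rule S(2)[OF ab(1-3)])
    moreover have tab: "t \<in> {a..b}" using ab by auto
    ultimately obtain v where "((chart_map c \<circ> \<gamma>) has_vector_derivative v) (at t within {a..b})"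
      using c unfolding C1_curve_on_def by blast
    then have "((chart_map c \<circ> \<gamma>) has_vector_derivative v) (at t within {a<..<b})"
      by (rule has_vector_derivative_within_subset) auto
    then show ?thesis using at_within_open[OF ab(4) open_greaterThanLessThan] by auto
  qed
  then show ?thesis by (rule that[OF S(1) cont])
qed

text \<open>The chart displacement is paired with itself in the metric at \<open>x0\<close>, which reduces the
  fundamental theorem of calculus to a real-valued function.\<close>

lemma chart_displacement_le_length:
  assumes \<gamma>: "piecewise_C1_curve A \<gamma>"
  obtains h where "h integrable_on {0..1}" "\<And>t. h t \<ge> 0" "integral {0..1} h = curve_length A g \<gamma>"
    "\<And>c x0 r \<kappa> s t. c \<in> A \<Longrightarrow> x0 \<in> chart_map c ` chart_dom c \<Longrightarrow> \<kappa> > 0 \<Longrightarrow>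
      (\<And>x v. x \<in> ball x0 r \<Longrightarrow> sqrt (metric_form c x0 v v) \<le> \<kappa> * sqrt (metric_form c x v v)) \<Longrightarrow>
      0 \<le> s \<Longrightarrow> s \<le> t \<Longrightarrow> t \<le> 1 \<Longrightarrow>
      (\<And>u. u \<in> {s..t} \<Longrightarrow> \<gamma> u \<in> chart_dom c \<and> chart_map c (\<gamma> u) \<in> ball x0 r) \<Longrightarrow>
      sqrt (metric_form c x0 (chart_map c (\<gamma> t) - chart_map c (\<gamma> s)) (chart_map c (\<gamma> t) - chart_map c (\<gamma> s)))
        \<le> \<kappa> * integral {s..t} h"
proof (rule piecewise_C1_curveE[OF \<gamma>])
  fix S assume S: "finite S" and cont: "continuous_on {0..1} \<gamma>"
    and diff: "\<And>t c. t \<in> {0<..<1} - S \<Longrightarrow> c \<in> A \<Longrightarrow> \<gamma> t \<in> chart_dom c \<Longrightarrow>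
       \<exists>v. ((chart_map c \<circ> \<gamma>) has_vector_derivative v) (at t)"
  \<comment> \<open>\<open>h\<close> is the speed with the break points and end points reset to
    \<open>0\<close>. There the velocity may fail to exist and the speed may be an arbitrary value,
    possibly negative; \<open>h\<close> is nonnegative everywhere and has the same integral.\<close>
  define h where "h t = (if t \<in> {0<..<1} - S then speed \<gamma> t else 0)" for t
  have h_eq: "h t = sqrt (metric_form c (chart_map c (\<gamma> t)) v v)"
    if t: "t \<in> {0<..<1} - S" and c: "c \<in> A" "\<gamma> t \<in> chart_dom c" 
      and d: "((chart_map c \<circ> \<gamma>) has_vector_derivative v) (at t)" for t c v
  proof -
    have t01: "t \<in> {0..1}" using t by auto
    then have "continuous (at t within {0..1}) \<gamma>" using cont by (simp add: continuous_on_eq_continuous_within)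
    then have "speed \<gamma> t = sqrt (metric_form c (chart_map c (\<gamma> t)) v v)"
      by (rule speed_eq[OF c t01 _ has_vector_derivative_at_within[OF d]])
    then show ?thesis using t by (simp add: h_def)
  qed
  have h0: "h t \<ge> 0" for t
  proof (cases "t \<in> {0<..<1} - S")
    case True
    obtain c where c: "c \<in> A" "\<gamma> t \<in> chart_dom c" by (rule exists_chart)
    obtain v where v: "((chart_map c \<circ> \<gamma>) has_vector_derivative v) (at t)" using diff[OF True c] by blast
    interpret psd_form "metric_form c (chart_map c (\<gamma> t))" by (rule metric_form_psd) (use c in auto)
    show ?thesis unfolding h_eq[OF True c v] using nonneg by simp
  next
    case False
    then have "h t = 0" by (simp only: h_def if_False)
    then show ?thesis by simp
  qed
  have fin: "finite (S \<union> {0, 1})" using S by simp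
  have spike: "h t = speed \<gamma> t" if "t \<in> {0..1} - (S \<union> {0, 1})" for t using that by (auto simp: h_def)
  have int: "h integrable_on {0..1}"
    by (rule integrable_spike_finite[OF fin spike speed_integrable[OF \<gamma>]])
  have len: "integral {0..1} h = curve_length A g \<gamma>"
    unfolding curve_length_def by (rule integral_spike[OF negligible_finite[OF fin]]) (use spike in simp)
  show ?thesis
  proof (rule that[OF int h0 len])
    fix c x0 r \<kappa> s t
    assume c: "c \<in> A" and x0: "x0 \<in> chart_map c ` chart_dom c" and \<kappa>: "(\<kappa>::real) > 0"
      and comp: "\<And>x v. x \<in> ball x0 r \<Longrightarrow> sqrt (metric_form c x0 v v) \<le> \<kappa> * sqrt (metric_form c x v v)"
      and st: "0 \<le> s" "s \<le> t" "t \<le> 1"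
      and inb: "\<And>u. u \<in> {s..t} \<Longrightarrow> \<gamma> u \<in> chart_dom c \<and> chart_map c (\<gamma> u) \<in> ball x0 r"
    interpret psd_form "metric_form c x0" by (rule metric_form_psd[OF c x0])
    define z where "z = chart_map c (\<gamma> t) - chart_map c (\<gamma> s)"
    define nz where "nz = sqrt (metric_form c x0 z z)"
    define f where "f u = metric_form c x0 z (chart_map c (\<gamma> u))" for u
    have sub: "{s..t} \<subseteq> {0..1}" using st by auto
    have hst: "h integrable_on {s..t}" by (rule integrable_on_subinterval[OF int sub])
    have "\<exists>w. ((chart_map c \<circ> \<gamma>) has_vector_derivative w) (at u)" if u: "u \<in> {s<..<t} - S" for u
      using u st inb[of u] by (intro diff c) auto
    then obtain x' where x': "\<And>u. u \<in> {s<..<t} - S \<Longrightarrow> ((chart_map c \<circ> \<gamma>) has_vector_derivative x' u) (at u)"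
      by metis
    define f' where "f' u = (if u \<in> {s<..<t} - S then metric_form c x0 z (x' u) else 0)" for u
    have cg: "continuous_on {s..t} (\<lambda>u. chart_map c (\<gamma> u))"
      by (rule continuous_on_compose2[OF chart_continuous[OF c] continuous_on_subset[OF cont sub]])
         (use inb in blast)
    have "(f' has_integral f t - f s) {s..t}"
    proof (rule fundamental_theorem_of_calculus_interior_strong[OF S st(2)])
      show "continuous_on {s..t} f"
        unfolding f_def by (intro continuous_intros cg)
      fix u assume u: "u \<in> {s<..<t} - S"
      show "(f has_vector_derivative f' u) (at u)"
        using bounded_linear.has_vector_derivative[OF blinfun.bounded_linear_right x'[OF u], of "metric_in_chart A g c x0 z"] u
        by (simp add: f_def[abs_def] f'_def)
    qed
    moreover have "f t - f s = nz\<^sup>2"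
    proof -
      have "f t - f s = metric_form c x0 z (chart_map c (\<gamma> t) - chart_map c (\<gamma> s))"
        by (simp add: f_def blinfun.diff_right)
      also have "\<dots> = metric_form c x0 z z" by (simp add: z_def)
      also have "\<dots> = nz\<^sup>2" using nonneg[of z] by (simp add: nz_def)
      finally show ?thesis .
    qed
    ultimately have FTC: "(f' has_integral nz\<^sup>2) {s..t}" by simp
    have bound: "f' u \<le> nz * \<kappa> * h u" if "u \<in> {s..t}" for u
    proof (cases "u \<in> {s<..<t} - S")
      case True
      have ub: "\<gamma> u \<in> chart_dom c" "chart_map c (\<gamma> u) \<in> ball x0 r" using inb[OF that] by auto
      have u01: "u \<in> {0<..<1} - S" using True st by auto
      have "f' u \<le> nz * sqrt (metric_form c x0 (x' u) (x' u))"
        using Cauchy_Schwarz[of z "x' u"] True by (simp add: f'_def nz_def)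
      also have "\<dots> \<le> nz * (\<kappa> * sqrt (metric_form c (chart_map c (\<gamma> u)) (x' u) (x' u)))"
        using comp[OF ub(2)] nonneg by (intro mult_left_mono) (auto simp: nz_def)
      also have "\<dots> = nz * \<kappa> * h u" unfolding h_eq[OF u01 c ub(1) x'[OF True]] by simp
      finally show ?thesis .
    next
      case False
      then have "f' u = 0" by (simp only: f'_def if_False)
      then show ?thesis using h0[of u] \<kappa> nonneg by (simp add: nz_def)
    qed
    \<comment> \<open>Cauchy-Schwarz has left a factor \<open>nz\<close> on the right; cancelling it
      gives the bound on the displacement.\<close>
    have "nz\<^sup>2 \<le> integral {s..t} (\<lambda>u. nz * \<kappa> * h u)"
      by (rule has_integral_le[OF FTC integrable_integral bound]) (use integrable_on_mult_right[OF hst] in auto)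
    then have *: "nz * nz \<le> nz * (\<kappa> * integral {s..t} h)" by (simp add: power2_eq_square mult.assoc)
    have "nz \<le> \<kappa> * integral {s..t} h"
    proof (cases "nz = 0")
      case True
      then show ?thesis using \<kappa> integral_nonneg[OF hst h0] by simp
    next
      case False
      then have "nz > 0" using nonneg by (simp add: nz_def less_le)
      then show ?thesis using * by simp
    qed
    then show "sqrt (metric_form c x0 (chart_map c (\<gamma> t) - chart_map c (\<gamma> s)) (chart_map c (\<gamma> t) - chart_map c (\<gamma> s)))
        \<le> \<kappa> * integral {s..t} h" unfolding nz_def z_def .
  qed
qed

end

section \<open>Distances in a chart\<close>

context riemannian_manifold
begin

text \<open>Coercivity makes an additive estimate multiplicative: if the forms at two points differ
  by at most \<open>a * \<theta> * (norm v)\<^sup>2\<close>, then one is at most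
  \<open>1 + \<theta> = \<kappa>\<^sup>2\<close> times the other.\<close>

lemma metric_comparison:
  assumes c: "c \<in> A" and x0: "x0 \<in> chart_map c ` chart_dom c" and \<kappa>: "\<kappa> > 1"
  shows "\<exists>r>0. ball x0 r \<subseteq> chart_map c ` chart_dom c \<and>
    (\<forall>x\<in>ball x0 r. \<forall>v. sqrt (metric_form c x0 v v) \<le> \<kappa> * sqrt (metric_form c x v v) \<and>
       sqrt (metric_form c x v v) \<le> \<kappa> * sqrt (metric_form c x0 v v))"
proof (rule metric_local_Lipschitz[OF c x0])
  fix r C a assume r: "r > 0" and C: "C > 0" and a: "a > 0"
    and sub: "ball x0 r \<subseteq> chart_map c ` chart_dom c"
    and GL: "\<And>x y. x \<in> ball x0 r \<Longrightarrow> y \<in> ball x0 r \<Longrightarrow>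
       norm (metric_in_chart A g c x - metric_in_chart A g c y) \<le> C * norm (x - y)"
    and co: "\<And>x v. x \<in> ball x0 r \<Longrightarrow> a * (norm v)\<^sup>2 \<le> metric_form c x v v"
  define \<theta> where "\<theta> = \<kappa>\<^sup>2 - 1"
  have \<theta>: "\<theta> > 0" using \<kappa> by (simp add: \<theta>_def)
  define r' where "r' = min r (a * \<theta> / C)"
  have r': "r' > 0" "r' \<le> r" "C * r' \<le> a * \<theta>"
    using r a \<theta> C by (auto simp: r'_def min_def field_simps)
  have close: "metric_form c x v v \<le> \<kappa>\<^sup>2 * metric_form c y v v"
    if x: "x \<in> ball x0 r" and y: "y \<in> ball x0 r" and d: "norm (x - y) < r'" for x y v
  proof -
    have "metric_form c x v v - metric_form c y v v = (metric_in_chart A g c x - metric_in_chart A g c y) v v"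
      by (simp add: blinfun.diff_left)
    also have "\<dots> \<le> norm (metric_in_chart A g c x - metric_in_chart A g c y) * norm v * norm v"
      using norm_blinfun2 abs_le_D1 by blast
    also have "\<dots> \<le> (a * \<theta>) * norm v * norm v"
    proof (intro mult_right_mono)
      have "norm (metric_in_chart A g c x - metric_in_chart A g c y) \<le> C * norm (x - y)" by (rule GL[OF x y])
      also have "\<dots> \<le> C * r'" using d C by (intro mult_left_mono) auto
      finally show "norm (metric_in_chart A g c x - metric_in_chart A g c y) \<le> a * \<theta>" using r'(3) by simp
    qed auto
    also have "\<dots> = \<theta> * (a * (norm v)\<^sup>2)" by (simp add: power2_eq_square)
    also have "\<dots> \<le> \<theta> * metric_form c y v v" using co[OF y] \<theta> by (intro mult_left_mono) auto
    finally show ?thesis by (simp add: \<theta>_def algebra_simps)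
  qed
  have sq: "sqrt (metric_form c x v v) \<le> \<kappa> * sqrt (metric_form c y v v)"
    if "x \<in> ball x0 r" and "y \<in> ball x0 r" and "norm (x - y) < r'" for x y v
    using real_sqrt_le_mono[OF close[OF that, of v]] \<kappa> by (simp add: real_sqrt_mult)
  have x0r: "x0 \<in> ball x0 r" using r by simp
  show ?thesis
  proof (intro exI[of _ r'] conjI ballI allI)
    fix x v assume "x \<in> ball x0 r'"
    then have x: "x \<in> ball x0 r" "norm (x - x0) < r'" "norm (x0 - x) < r'"
      using r' by (auto simp: dist_norm norm_minus_commute)
    show "sqrt (metric_form c x0 v v) \<le> \<kappa> * sqrt (metric_form c x v v)" by (rule sq[OF x0r x(1,3)])
    show "sqrt (metric_form c x v v) \<le> \<kappa> * sqrt (metric_form c x0 v v)" by (rule sq[OF x(1) x0r x(2)])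
  qed (use r' sub in auto)
qed

text \<open>A short curve cannot leave the chart ball: up to the first exit time its chart image is Cauchy
  with a limit inside the ball, and limits in the manifold are unique.\<close>

lemma short_curve_stays_in_chart:
  assumes c: "c \<in> A" and x0: "x0 \<in> chart_map c ` chart_dom c"
    and r: "r > 0" "ball x0 r \<subseteq> chart_map c ` chart_dom c" and \<kappa>: "\<kappa> > 0"
    and comp: "\<And>x v. x \<in> ball x0 r \<Longrightarrow> sqrt (metric_form c x0 v v) \<le> \<kappa> * sqrt (metric_form c x v v)"
    and \<alpha>: "\<alpha> > 0" "\<And>v. \<alpha> * norm v \<le> sqrt (metric_form c x0 v v)"
    and x: "x \<in> ball x0 (r / 2)"
    and \<gamma>: "piecewise_C1_curve A \<gamma>" "\<gamma> 0 = chart_inv c x"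
    and len: "\<kappa> * curve_length A g \<gamma> \<le> \<alpha> * (r / 4)"
  shows "\<gamma> 1 \<in> chart_dom c \<and>
    sqrt (metric_form c x0 (chart_map c (\<gamma> 1) - x) (chart_map c (\<gamma> 1) - x)) \<le> \<kappa> * curve_length A g \<gamma>"
proof (rule chart_displacement_le_length[OF \<gamma>(1)])
  fix h assume h: "h integrable_on {0..1}" "\<And>t. h t \<ge> 0" "integral {0..1} h = curve_length A g \<gamma>"
    and disp': "\<And>c x0 r \<kappa> s t. c \<in> A \<Longrightarrow> x0 \<in> chart_map c ` chart_dom c \<Longrightarrow> \<kappa> > 0 \<Longrightarrow>
      (\<And>x v. x \<in> ball x0 r \<Longrightarrow> sqrt (metric_form c x0 v v) \<le> \<kappa> * sqrt (metric_form c x v v)) \<Longrightarrow>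
      0 \<le> s \<Longrightarrow> s \<le> t \<Longrightarrow> t \<le> 1 \<Longrightarrow>
      (\<And>u. u \<in> {s..t} \<Longrightarrow> \<gamma> u \<in> chart_dom c \<and> chart_map c (\<gamma> u) \<in> ball x0 r) \<Longrightarrow>
      sqrt (metric_form c x0 (chart_map c (\<gamma> t) - chart_map c (\<gamma> s)) (chart_map c (\<gamma> t) - chart_map c (\<gamma> s)))
        \<le> \<kappa> * integral {s..t} h"
  define W where "W = chart_inv c ` ball x0 r"
  have W_iff: "q \<in> W \<longleftrightarrow> q \<in> chart_dom c \<and> chart_map c q \<in> ball x0 r" for q
  proof
    assume "q \<in> W"
    then obtain y where y: "y \<in> ball x0 r" "q = chart_inv c y" by (auto simp: W_def)
    then have yi: "y \<in> chart_map c ` chart_dom c" using r by blast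
    then show "q \<in> chart_dom c \<and> chart_map c q \<in> ball x0 r"
      using y chart_inv_dom[OF yi] chart_inv_right[OF yi] by simp
  next
    assume "q \<in> chart_dom c \<and> chart_map c q \<in> ball x0 r"
    then show "q \<in> W" unfolding W_def using chart_inv_left[OF c, of q] by (intro image_eqI[of _ _ "chart_map c q"]) auto
  qed
  have openW: "open W" unfolding W_def by (rule open_chart_inv_image[OF c open_ball r(2)])
  have cont: "continuous_on {0..1} \<gamma>" using \<gamma>(1) by (simp add: piecewise_C1_curve_def)
  let ?x = "\<lambda>t. chart_map c (\<gamma> t)"
  have xr: "x \<in> ball x0 r" using x r by auto
  have xi: "x \<in> chart_map c ` chart_dom c" using xr r(2) by blast
  have x_start: "?x 0 = x" using \<gamma>(2) chart_inv_right[OF xi] by simp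
  have start: "\<gamma> 0 \<in> W" unfolding \<gamma>(2) W_def using xr by blast
  have disp: "sqrt (metric_form c x0 (?x t - ?x s) (?x t - ?x s)) \<le> \<kappa> * integral {s..t} h"
    if "0 \<le> s" "s \<le> t" "t \<le> 1" "\<And>u. u \<in> {s..t} \<Longrightarrow> \<gamma> u \<in> W" for s t
    by (rule disp'[OF c x0 \<kappa> comp that(1-3)]) (use that(4) W_iff in auto)
  define I where "I t = integral {0..t} h" for t
  have I: "integral {s..t} h = I t - I s" if "0 \<le> s" "s \<le> t" "t \<le> 1" for s t
  proof -
    have "h integrable_on {0..t}" using that by (intro integrable_on_subinterval[OF h(1)]) auto
    then show ?thesis using Henstock_Kurzweil_Integration.integral_combine[OF that(1,2)] by (simp add: I_def algebra_simps)
  qed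
  have I_le: "I t \<le> curve_length A g \<gamma>" if "0 \<le> t" "t \<le> 1" for t
  proof -
    have "h integrable_on {t..1}" using that by (intro integrable_on_subinterval[OF h(1)]) auto
    then have "integral {t..1} h \<ge> 0" using h(2) by (rule integral_nonneg)
    then show ?thesis using I[of t 1] that h(3) by (simp add: I_def)
  qed
  have inside: "\<gamma> t \<in> W" if t: "t \<in> {0..1}" for t
  proof (rule ccontr)
    assume "\<gamma> t \<notin> W"
    \<comment> \<open>Closed because \<open>W\<close> is open, so its infimum \<open>\<tau>\<close>,
      the first exit time, is attained.\<close>
    define T where "T = {t \<in> {0..1}. \<gamma> t \<notin> W}"
    have tT: "t \<in> T" using t \<open>\<gamma> t \<notin> W\<close> by (simp add: T_def)
    have "T = {0..1} \<inter> \<gamma> -` (- W)" by (auto simp: T_def)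
    then have "closed T" using continuous_closed_preimage[OF cont] openW by (simp add: closed_Compl)
    have bdd: "bdd_below T" by (rule bdd_belowI[of _ 0]) (simp add: T_def)
    define \<tau> where "\<tau> = Inf T"
    have "\<tau> \<in> T" unfolding \<tau>_def using tT bdd \<open>closed T\<close> by (intro closed_contains_Inf) auto
    then have \<tau>: "0 \<le> \<tau>" "\<tau> \<le> 1" "\<gamma> \<tau> \<notin> W" by (auto simp: T_def)
    have before: "\<gamma> u \<in> W" if "0 \<le> u" "u < \<tau>" for u
    proof (rule ccontr)
      assume "\<gamma> u \<notin> W"
      then have "u \<in> T" using that \<tau> by (simp add: T_def)
      then have "\<tau> \<le> u" unfolding \<tau>_def using bdd by (intro cInf_lower)
      then show False using that by simp
    qed
    have "\<tau> \<noteq> 0" using start \<tau> by metis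
    then have \<tau>0: "\<tau> > 0" using \<tau> by simp
    define s where "s n = \<tau> - \<tau> / real (Suc n)" for n
    have s: "0 \<le> s n" "s n < \<tau>" for n
      using \<tau>0 by (auto simp: s_def field_simps)
    have s01: "s n \<in> {0..1}" for n using s[of n] \<tau>(2) by simp
    have s_lim: "s \<longlonglongrightarrow> \<tau>"
    proof -
      have "(\<lambda>n. \<tau> - \<tau> * inverse (real (Suc n))) \<longlonglongrightarrow> \<tau> - \<tau> * 0"
        by (intro tendsto_intros LIMSEQ_inverse_real_of_nat)
      then show ?thesis by (simp add: s_def[abs_def] divide_inverse)
    qed
    \<comment> \<open>Before \<open>\<tau>\<close> the chart displacement is controlled by the
      increment of the continuous function \<open>I\<close>. So the chart points along
      \<open>s n\<close> inherit the Cauchy property of \<open>I (s n)\<close> and converge in the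
      complete model space.\<close>
    have step: "\<alpha> * norm (?x (s n) - ?x (s m)) \<le> \<kappa> * \<bar>I (s n) - I (s m)\<bar>" for n m
    proof -
      have *: "\<alpha> * norm (?x b - ?x a) \<le> \<kappa> * \<bar>I b - I a\<bar>" if "0 \<le> a" "a \<le> b" "b < \<tau>" for a b
      proof -
        have "\<alpha> * norm (?x b - ?x a) \<le> sqrt (metric_form c x0 (?x b - ?x a) (?x b - ?x a))" by (rule \<alpha>(2))
        also have "\<dots> \<le> \<kappa> * integral {a..b} h"
          using that \<tau> before by (intro disp) auto
        also have "\<dots> = \<kappa> * (I b - I a)" using I[of a b] that \<tau> by simp
        also have "\<dots> \<le> \<kappa> * \<bar>I b - I a\<bar>" using \<kappa> by (intro mult_left_mono) auto
        finally show ?thesis .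
      qed
      show ?thesis
      proof (cases "s m \<le> s n")
        case True
        then show ?thesis using * s by blast
      next
        case False
        then have "\<alpha> * norm (?x (s m) - ?x (s n)) \<le> \<kappa> * \<bar>I (s m) - I (s n)\<bar>" using * s by auto
        then show ?thesis by (simp add: norm_minus_commute abs_minus_commute)
      qed
    qed
    have "continuous_on {0..1} I" unfolding I_def[abs_def] by (rule indefinite_integral_continuous_1[OF h(1)])
    then have "(\<lambda>n. I (s n)) \<longlonglongrightarrow> I \<tau>"
      by (rule continuous_on_tendsto_compose[OF _ s_lim]) (use s01 \<tau> in \<open>auto intro!: always_eventually\<close>)
    then have "Cauchy (\<lambda>n. I (s n))" by (rule LIMSEQ_imp_Cauchy)
    then have "Cauchy (\<lambda>n. ?x (s n))"
      unfolding Cauchy_def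
    proof (intro allI impI)
      fix e :: real assume C: "\<forall>e>0. \<exists>M. \<forall>m\<ge>M. \<forall>n\<ge>M. dist (I (s m)) (I (s n)) < e" and e: "e > 0"
      have "\<alpha> * e / \<kappa> > 0" using \<alpha> \<kappa> e by simp
      then obtain M where M: "\<forall>m\<ge>M. \<forall>n\<ge>M. dist (I (s m)) (I (s n)) < \<alpha> * e / \<kappa>" using C by blast
      have "dist (?x (s m)) (?x (s n)) < e" if "m \<ge> M" "n \<ge> M" for m n
      proof -
        have "\<bar>I (s m) - I (s n)\<bar> < \<alpha> * e / \<kappa>" using M that by (simp add: dist_real_def)
        then have "\<kappa> * \<bar>I (s m) - I (s n)\<bar> < \<alpha> * e" using \<kappa> by (simp add: pos_less_divide_eq mult.commute)
        then have "\<alpha> * norm (?x (s m) - ?x (s n)) < \<alpha> * e" using step[of m n] by simp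
        then show ?thesis using \<alpha> by (simp add: dist_norm)
      qed
      then show "\<exists>M. \<forall>m\<ge>M. \<forall>n\<ge>M. dist (?x (s m)) (?x (s n)) < e" by blast
    qed
    then obtain y where y: "(\<lambda>n. ?x (s n)) \<longlonglongrightarrow> y" using Cauchy_convergent convergent_def by blast
    \<comment> \<open>The length budget allows a displacement of \<open>r / 4\<close> from
      \<open>x\<close>, which lies within \<open>r / 2\<close> of \<open>x0\<close>; so the limit
      \<open>y\<close> is still strictly inside the ball.\<close>
    have near: "norm (?x (s n) - x) \<le> r / 4" for n
    proof -
      have s1: "s n \<le> 1" using s(2)[of n] \<tau>(2) by linarith
      have "\<alpha> * norm (?x (s n) - ?x 0) \<le> sqrt (metric_form c x0 (?x (s n) - ?x 0) (?x (s n) - ?x 0))" by (rule \<alpha>(2))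
      also have "\<dots> \<le> \<kappa> * integral {0..s n} h"
        using s[of n] s1 by (intro disp) (auto intro!: before)
      also have "\<dots> \<le> \<kappa> * curve_length A g \<gamma>"
        using I_le[OF s(1) s1] \<kappa> by (simp add: I_def)
      also have "\<dots> \<le> \<alpha> * (r / 4)" by (rule len)
      finally show ?thesis using \<alpha>(1) x_start by simp
    qed
    have "norm (y - x) \<le> r / 4"
      by (rule Lim_bounded[of "\<lambda>n. norm (?x (s n) - x)" _ 0]) (use near in \<open>auto intro!: tendsto_intros y\<close>)
    moreover have "dist x0 x < r / 2" using x by simp
    ultimately have yr: "y \<in> ball x0 r"
      using dist_triangle[of x0 y x] r(1) by (simp add: dist_norm norm_minus_commute)
    then have yi: "y \<in> chart_map c ` chart_dom c" using r by blast
    have "(\<lambda>n. chart_inv c (?x (s n))) \<longlonglongrightarrow> chart_inv c y"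
      by (rule continuous_on_tendsto_compose[OF chart_inv_continuous[OF c] y yi])
         (use before s W_iff in \<open>auto intro!: always_eventually\<close>)
    moreover have "chart_inv c (?x (s n)) = \<gamma> (s n)" for n
      using before[OF s] W_iff chart_inv_left[OF c] by blast
    ultimately have "(\<lambda>n. \<gamma> (s n)) \<longlonglongrightarrow> chart_inv c y" by simp
    moreover have "(\<lambda>n. \<gamma> (s n)) \<longlonglongrightarrow> \<gamma> \<tau>"
      by (rule continuous_on_tendsto_compose[OF cont s_lim]) (use s01 \<tau> in \<open>auto intro!: always_eventually\<close>)
    \<comment> \<open>The same sequence converges to the exit point and to a point of
      \<open>W\<close>; the Hausdorff property identifies them.\<close>
    ultimately have "\<gamma> \<tau> = chart_inv c y" using LIMSEQ_unique by blast
    then have "\<gamma> \<tau> \<in> W" using yr by (simp add: W_def)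
    then show False using \<tau> by blast
  qed
  have "sqrt (metric_form c x0 (?x 1 - ?x 0) (?x 1 - ?x 0)) \<le> \<kappa> * integral {0..1} h"
    by (rule disp) (use inside in auto)
  then show ?thesis using h(3) x_start inside[of 1] W_iff by simp
qed

text \<open>The competitor for upper bounds on the distance. Its velocity in \<open>c\<close> is the
  constant \<open>y - x\<close>; in any other chart it is the derivative of the transition map
  applied to this vector, which is continuous along the curve.\<close>

lemma chart_segment:
  assumes c: "c \<in> A" and B: "convex B" "B \<subseteq> chart_map c ` chart_dom c" and x: "x \<in> B" and y: "y \<in> B"
  defines "\<gamma> \<equiv> \<lambda>t. chart_inv c (x + t *\<^sub>R (y - x))"
  shows "piecewise_C1_curve A \<gamma>"
    and "\<And>t. t \<in> {0..1} \<Longrightarrow> x + t *\<^sub>R (y - x) \<in> B"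
    and "\<And>t. t \<in> {0..1} \<Longrightarrow> speed \<gamma> t = sqrt (metric_form c (x + t *\<^sub>R (y - x)) (y - x) (y - x))"
proof -
  let ?l = "\<lambda>t. x + t *\<^sub>R (y - x)"
  show inB: "?l t \<in> B" if "t \<in> {0..1}" for t
    using convexD_alt[OF B(1) x y, of t] that by (simp add: algebra_simps)
  then have im: "?l t \<in> chart_map c ` chart_dom c" if "t \<in> {0..1}" for t using B(2) that by blast
  have dom: "\<gamma> t \<in> chart_dom c" "chart_map c (\<gamma> t) = ?l t" if "t \<in> {0..1}" for t
    unfolding \<gamma>_def using chart_inv_dom[OF im[OF that]] chart_inv_right[OF im[OF that]] by auto
  have cont: "continuous_on {0..1} \<gamma>"
    unfolding \<gamma>_def by (rule continuous_on_compose2[OF chart_inv_continuous[OF c]])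
      (use im in \<open>auto intro!: continuous_intros\<close>)
  have d: "((chart_map c \<circ> \<gamma>) has_vector_derivative (y - x)) (at t within {0..1})" if t: "t \<in> {0..1}" for t
  proof (rule has_vector_derivative_transform[OF t])
    show "(?l has_vector_derivative (y - x)) (at t within {0..1})"
      by (auto intro!: derivative_eq_intros)
  qed (simp add: dom)
  have cw: "continuous (at t within {0..1}) \<gamma>" if "t \<in> {0..1}" for t
    using cont that by (simp add: continuous_on_eq_continuous_within)
  show "speed \<gamma> t = sqrt (metric_form c (?l t) (y - x) (y - x))" if "t \<in> {0..1}" for t
    using speed_eq[OF c dom(1)[OF that] that cw[OF that] d[OF that]] dom(2)[OF that] by simp
  have "C1_curve_on A a b \<gamma>" if ab: "0 \<le> a" "b \<le> 1" for a b
    unfolding C1_curve_on_def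
  proof (intro conjI ballI)
    have sub: "{a..b} \<subseteq> {0..1}" using ab by auto
    show "continuous_on {a..b} \<gamma>" by (rule continuous_on_subset[OF cont sub])
    fix c' assume c': "c' \<in> A"
    let ?T = "{t \<in> {a..b}. \<gamma> t \<in> chart_dom c'}"
    let ?g = "\<lambda>t. frechet_derivative (chart_map c' \<circ> chart_inv c) (at (?l t)) (y - x)"
    have "continuous_on ?T ?g"
    proof (rule continuous_on_smooth_derivative[OF smooth_transition[OF c c']])
      show "?l ` ?T \<subseteq> chart_map c ` (chart_dom c \<inter> chart_dom c')"
      proof
        fix z assume "z \<in> ?l ` ?T"
        then obtain t where t: "t \<in> {a..b}" "\<gamma> t \<in> chart_dom c'" "z = ?l t" by blast
        then have "t \<in> {0..1}" using sub by blast
        then show "z \<in> chart_map c ` (chart_dom c \<inter> chart_dom c')"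
          using dom[of t] t by (intro image_eqI[of _ _ "\<gamma> t"]) auto
      qed
    qed (auto intro!: continuous_intros)
    moreover have "((chart_map c' \<circ> \<gamma>) has_vector_derivative ?g t) (at t within {a..b})"
      if t: "t \<in> {a..b}" "\<gamma> t \<in> chart_dom c'" for t
    proof -
      have t01: "t \<in> {0..1}" using t sub by blast
      have "((chart_map c' \<circ> \<gamma>) has_vector_derivative transition_derivative c c' (\<gamma> t) (y - x)) (at t within {0..1})"
        by (rule curve_change_chart[OF c c' dom(1)[OF t01] t(2) t01 cw[OF t01] d[OF t01]])
      then show ?thesis
        unfolding transition_derivative_def dom(2)[OF t01]
        by (rule has_vector_derivative_within_subset[OF _ sub])
    qed
    ultimately show "\<exists>\<gamma>'. continuous_on ?T \<gamma>' \<and>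
        (\<forall>t\<in>{a..b}. \<gamma> t \<in> chart_dom c' \<longrightarrow> ((chart_map c' \<circ> \<gamma>) has_vector_derivative \<gamma>' t) (at t within {a..b}))"
      by (intro exI[of _ ?g]) blast
  qed
  then show "piecewise_C1_curve A \<gamma>"
    unfolding piecewise_C1_curve_def using cont by (intro conjI exI[of _ "{}"]) auto
qed

text \<open>Convexity keeps the segment in \<open>B\<close>, where \<open>K\<close> bounds the norm
  of its velocity \<open>y - x\<close> at every point; integrate over the unit interval.\<close>

lemma riem_dist_chart_upper:
  assumes c: "c \<in> A" and B: "convex B" "B \<subseteq> chart_map c ` chart_dom c" and x: "x \<in> B" and y: "y \<in> B"
    and comp: "\<And>z. z \<in> B \<Longrightarrow> sqrt (metric_form c z (y - x) (y - x)) \<le> K"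
  shows "riem_dist A g (chart_inv c x) (chart_inv c y) \<le> ereal K"
proof -
  define \<gamma> where "\<gamma> = (\<lambda>t. chart_inv c (x + t *\<^sub>R (y - x)))"
  note seg = chart_segment[OF c B x y, folded \<gamma>_def]
  have "curve_length A g \<gamma> \<le> integral {0..1} (\<lambda>t::real. K)"
    unfolding curve_length_def
  proof (rule integral_le[OF speed_integrable[OF seg(1)]])
    show "speed \<gamma> t \<le> K" if "t \<in> {0..1}" for t
      using comp[OF seg(2)[OF that]] seg(3)[OF that] by (simp add: \<gamma>_def)
  qed auto
  then have "curve_length A g \<gamma> \<le> K" by simp
  moreover have "riem_dist A g (chart_inv c x) (chart_inv c y) \<le> ereal (curve_length A g \<gamma>)"
    unfolding riem_dist_def using seg(1) by (intro INF_lower) (simp add: \<gamma>_def)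
  ultimately show ?thesis by (meson ereal_less_eq(3) order_trans)
qed

text \<open>The strict bound \<open>\<rho>\<close> replaces the distance because the infimum need
  not be attained: it yields one curve shorter than \<open>\<rho>\<close>. That \<open>q\<close>
  lies in the chart at all is part of the conclusion, since the curve cannot leave the ball.\<close>

lemma riem_dist_chart_lower:
  assumes c: "c \<in> A" and x0: "x0 \<in> chart_map c ` chart_dom c"
    and r: "r > 0" "ball x0 r \<subseteq> chart_map c ` chart_dom c" and \<kappa>: "\<kappa> > 0"
    and comp: "\<And>x v. x \<in> ball x0 r \<Longrightarrow> sqrt (metric_form c x0 v v) \<le> \<kappa> * sqrt (metric_form c x v v)"
    and \<alpha>: "\<alpha> > 0" "\<And>v. \<alpha> * norm v \<le> sqrt (metric_form c x0 v v)"
    and x: "x \<in> ball x0 (r / 2)"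
    and \<rho>: "riem_dist A g (chart_inv c x) q < ereal \<rho>" "\<kappa> * \<rho> \<le> \<alpha> * (r / 4)"
  shows "q \<in> chart_dom c \<and> sqrt (metric_form c x0 (chart_map c q - x) (chart_map c q - x)) \<le> \<kappa> * \<rho>"
proof -
  obtain \<gamma> where \<gamma>: "piecewise_C1_curve A \<gamma>" "\<gamma> 0 = chart_inv c x" "\<gamma> 1 = q" "curve_length A g \<gamma> < \<rho>"
    using \<rho>(1) unfolding riem_dist_def by (auto simp: INF_less_iff)
  have l: "\<kappa> * curve_length A g \<gamma> \<le> \<kappa> * \<rho>" using \<gamma>(4) \<kappa> by simp
  have "\<gamma> 1 \<in> chart_dom c \<and>
    sqrt (metric_form c x0 (chart_map c (\<gamma> 1) - x) (chart_map c (\<gamma> 1) - x)) \<le> \<kappa> * curve_length A g \<gamma>"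
    by (rule short_curve_stays_in_chart[OF c x0 r \<kappa> comp \<alpha> x \<gamma>(1,2)]) (use l \<rho>(2) in auto)
  then show ?thesis using \<gamma>(3) l by auto
qed

end

section \<open>Subdifferential of a distance function in a normed space\<close>

lemma eventually_norm_at_within:
  "eventually P (norm_at_within N x B) \<longleftrightarrow> (\<exists>\<epsilon>>0. \<forall>u\<in>B. u \<noteq> x \<longrightarrow> N (u - x) < \<epsilon> \<longrightarrow> P u)"
  unfolding norm_at_within_def
proof (subst eventually_INF_base)
  fix a b :: real assume "a \<in> {0<..}" "b \<in> {0<..}"
  then show "\<exists>e\<in>{0<..}. principal {u \<in> B. u \<noteq> x \<and> N (u - x) < e}
     \<le> inf (principal {u \<in> B. u \<noteq> x \<and> N (u - x) < a}) (principal {u \<in> B. u \<noteq> x \<and> N (u - x) < b})"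
    by (intro bexI[of _ "min a b"]) auto
qed (auto simp: eventually_principal)

text \<open>Separates the variational argument from the geometry; the instance is a tangent space
  with the norm of the metric.\<close>

locale norm_on =
  fixes V :: "'v::real_vector set" and N :: "'v \<Rightarrow> real"
  assumes subspace: "subspace V"
    and norm_nonneg: "v \<in> V \<Longrightarrow> 0 \<le> N v"
    and norm_eq_zero: "v \<in> V \<Longrightarrow> N v = 0 \<Longrightarrow> v = 0"
    and norm_scale: "v \<in> V \<Longrightarrow> N (r *\<^sub>R v) = \<bar>r\<bar> * N v"
    and norm_triangle: "v \<in> V \<Longrightarrow> w \<in> V \<Longrightarrow> N (v + w) \<le> N v + N w"
begin

lemma norm_zero: "N 0 = 0"
  using norm_scale[OF subspace_0[OF subspace], of 0] by simp

lemma norm_pos: "v \<in> V \<Longrightarrow> v \<noteq> 0 \<Longrightarrow> 0 < N v"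
  using norm_nonneg norm_eq_zero by fastforce

lemma norm_minus: "v \<in> V \<Longrightarrow> N (- v) = N v"
  using norm_scale[of v "-1"] by simp

lemma dual_space_scale: "\<xi> \<in> dual_space V N \<Longrightarrow> v \<in> V \<Longrightarrow> \<xi> (r *\<^sub>R v) = r * \<xi> v"
  by (simp add: dual_space_def)

lemma dual_space_zero: "\<xi> \<in> dual_space V N \<Longrightarrow> \<xi> 0 = 0"
  using dual_space_scale[OF _ subspace_0[OF subspace], of \<xi> 0] by simp

lemma dual_space_diff:
  assumes "\<xi> \<in> dual_space V N" "v \<in> V" "w \<in> V" shows "\<xi> (v - w) = \<xi> v - \<xi> w"
proof -
  have "\<forall>u\<in>V. \<forall>v\<in>V. \<xi> (u + v) = \<xi> u + \<xi> v" using assms(1) by (simp add: dual_space_def)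
  then have "\<xi> ((v - w) + w) = \<xi> (v - w) + \<xi> w"
    using assms(3) subspace_diff[OF subspace assms(2,3)] by blast
  then show ?thesis by simp
qed

text \<open>The absolute value is recovered by applying the one-sided inequality to
  \<open>- v\<close>. Boundedness of the functional makes the supremum meaningful.\<close>

lemma dual_norm_le_1_iff:
  assumes \<xi>: "\<xi> \<in> dual_space V N"
  shows "dual_norm V N \<xi> \<le> 1 \<longleftrightarrow> (\<forall>v\<in>V. \<xi> v \<le> N v)"
proof
  have "\<exists>C. \<forall>v\<in>V. \<bar>\<xi> v\<bar> \<le> C * N v" using \<xi> by (simp add: dual_space_def)
  then obtain C where C: "\<And>v. v \<in> V \<Longrightarrow> \<bar>\<xi> v\<bar> \<le> C * N v" by blast
  have bdd: "bdd_above ((\<lambda>v. \<bar>\<xi> v\<bar>) ` {v \<in> V. N v \<le> 1})"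
  proof (rule bdd_aboveI2)
    fix v assume "v \<in> {v \<in> V. N v \<le> 1}"
    then have v: "v \<in> V" "N v \<le> 1" by auto
    have "C * N v \<le> \<bar>C\<bar> * 1" by (rule mult_mono) (use v norm_nonneg in auto)
    then show "\<bar>\<xi> v\<bar> \<le> \<bar>C\<bar>" using C[OF v(1)] by simp
  qed
  assume d: "dual_norm V N \<xi> \<le> 1"
  show "\<forall>v\<in>V. \<xi> v \<le> N v"
  proof
    fix v assume v: "v \<in> V"
    show "\<xi> v \<le> N v"
    proof (cases "v = 0")
      case True
      then show ?thesis using dual_space_zero[OF \<xi>] norm_zero by simp
    next
      case False
      then have p: "0 < N v" using norm_pos v by blast
      let ?w = "(1 / N v) *\<^sub>R v"
      have w: "?w \<in> V" using v subspace_scale[OF subspace] by blast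
      have "N ?w \<le> 1" using norm_scale[OF v] p by simp
      then have "\<bar>\<xi> ?w\<bar> \<le> dual_norm V N \<xi>"
        unfolding dual_norm_def using w by (intro cSUP_upper bdd) auto
      then have "\<xi> ?w \<le> 1" using d by linarith
      then have "1 / N v * \<xi> v \<le> 1" unfolding dual_space_scale[OF \<xi> v] .
      then show ?thesis using p by simp
    qed
  qed
next
  assume le: "\<forall>v\<in>V. \<xi> v \<le> N v"
  show "dual_norm V N \<xi> \<le> 1"
    unfolding dual_norm_def
  proof (rule cSUP_least)
    show "{v \<in> V. N v \<le> 1} \<noteq> {}" using subspace_0[OF subspace] norm_zero by (auto intro!: exI[of _ 0])
    fix v assume v: "v \<in> {v \<in> V. N v \<le> 1}"
    then have "- v \<in> V" using subspace_neg[OF subspace] by blast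
    then have "\<xi> (- v) \<le> N v" using le norm_minus v by force
    moreover have "\<xi> (- v) = - \<xi> v" using dual_space_scale[OF \<xi>, of v "-1"] v by simp
    ultimately show "\<bar>\<xi> v\<bar> \<le> 1" using le v by force
  qed
qed

text \<open>Clears the quotient by the positive norm, so that later estimates avoid extended real
  arithmetic. Infinite values of \<open>F u\<close> cause no harm: \<open>\<infinity>\<close>
  satisfies both inequalities and \<open>-\<infinity>\<close> neither.\<close>

lemma frechet_subdifferential_at_zero_iff:
  assumes F0: "F 0 = 0"
  shows "\<xi> \<in> frechet_subdifferential V N F 0 \<longleftrightarrow> \<xi> \<in> dual_space V N \<and>
     (\<forall>\<epsilon>>0. \<exists>\<delta>>0. \<forall>u\<in>V. u \<noteq> 0 \<longrightarrow> N u < \<delta> \<longrightarrow> ereal (\<xi> u - \<epsilon> * N u) \<le> F u)"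
proof -
  let ?q = "\<lambda>u. (F u - F 0 - ereal (\<xi> (u - 0))) / ereal (N (u - 0))"
  have le: "ereal (\<xi> u - \<epsilon> * N u) \<le> F u" if "ereal (- \<epsilon>) < ?q u" "u \<in> V" "u \<noteq> 0" for u \<epsilon>
  proof (cases "F u")
    case (real r)
    then have "- \<epsilon> < (r - \<xi> u) / N u" using that F0 norm_pos[of u] by simp
    then show ?thesis using real norm_pos[OF that(2,3)] by (simp add: pos_less_divide_eq)
  qed (use that F0 norm_pos[of u] in auto)
  have ge: "ereal (- \<epsilon>) \<le> ?q u" if "ereal (\<xi> u - \<epsilon> * N u) \<le> F u" "u \<in> V" "u \<noteq> 0" for u \<epsilon>
  proof (cases "F u")
    case (real r)
    then have "- \<epsilon> \<le> (r - \<xi> u) / N u" using that norm_pos[OF that(2,3)] by (simp add: pos_le_divide_eq)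
    then show ?thesis using real F0 norm_pos[OF that(2,3)] by simp
  qed (use that F0 norm_pos[of u] in auto)
  have "0 \<le> Liminf (norm_at_within N 0 V) ?q \<longleftrightarrow>
     (\<forall>\<epsilon>>0. \<exists>\<delta>>0. \<forall>u\<in>V. u \<noteq> 0 \<longrightarrow> N u < \<delta> \<longrightarrow> ereal (\<xi> u - \<epsilon> * N u) \<le> F u)" (is "?L \<longleftrightarrow> ?R")
  proof
    assume L: ?L
    show ?R
    proof (intro allI impI)
      fix \<epsilon> :: real assume "\<epsilon> > 0"
      then have "ereal (- \<epsilon>) < 0" by simp
      then have "eventually (\<lambda>u. ereal (- \<epsilon>) < ?q u) (norm_at_within N 0 V)"
        using L unfolding le_Liminf_iff by blast
      then obtain \<delta> where "\<delta> > 0" "\<And>u. u \<in> V \<Longrightarrow> u \<noteq> 0 \<Longrightarrow> N (u - 0) < \<delta> \<Longrightarrow> ereal (- \<epsilon>) < ?q u"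
        unfolding eventually_norm_at_within by blast
      then show "\<exists>\<delta>>0. \<forall>u\<in>V. u \<noteq> 0 \<longrightarrow> N u < \<delta> \<longrightarrow> ereal (\<xi> u - \<epsilon> * N u) \<le> F u"
        using le by (metis diff_zero)
    qed
  next
    assume R: ?R
    show ?L unfolding le_Liminf_iff
    proof (intro allI impI)
      fix y :: ereal assume "y < 0"
      then obtain z where z: "y < ereal z" "ereal z < 0" using ereal_dense2 by blast
      then have "- z > 0" by simp
      then obtain \<delta> where d: "\<delta> > 0"
        "\<And>u. u \<in> V \<Longrightarrow> u \<noteq> 0 \<Longrightarrow> N u < \<delta> \<Longrightarrow> ereal (\<xi> u - (- z) * N u) \<le> F u" using R by blast
      show "eventually (\<lambda>u. y < ?q u) (norm_at_within N 0 V)"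
        unfolding eventually_norm_at_within
      proof (intro exI[of _ \<delta>] conjI ballI impI d(1))
        fix u assume u: "u \<in> V" "u \<noteq> 0" "N (u - 0) < \<delta>"
        then have "ereal (- (- z)) \<le> ?q u" by (intro ge d(2)) auto
        then show "y < ?q u" using z(1) by simp
      qed
    qed
  qed
  then show ?thesis unfolding frechet_subdifferential_def by blast
qed

lemma frechet_normal_cone_at_zero_iff:
  assumes B: "B \<subseteq> V"
  shows "\<xi> \<in> frechet_normal_cone V N B 0 \<longleftrightarrow> \<xi> \<in> dual_space V N \<and>
     (\<forall>\<epsilon>>0. \<exists>\<delta>>0. \<forall>u\<in>B. N u < \<delta> \<longrightarrow> \<xi> u \<le> \<epsilon> * N u)"
proof -
  let ?q = "\<lambda>u. ereal (\<xi> (u - 0) / N (u - 0))"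
  have "Limsup (norm_at_within N 0 B) ?q \<le> 0 \<longleftrightarrow>
     (\<forall>\<epsilon>>0. \<exists>\<delta>>0. \<forall>u\<in>B. N u < \<delta> \<longrightarrow> \<xi> u \<le> \<epsilon> * N u)" (is "?L \<longleftrightarrow> ?R")
    if \<xi>: "\<xi> \<in> dual_space V N"
  proof
    assume L: ?L
    show ?R
    proof (intro allI impI)
      fix \<epsilon> :: real assume "\<epsilon> > 0"
      then have "0 < ereal \<epsilon>" by simp
      then have "eventually (\<lambda>u. ?q u < ereal \<epsilon>) (norm_at_within N 0 B)"
        using L unfolding Limsup_le_iff by blast
      then obtain \<delta> where d: "\<delta> > 0" "\<And>u. u \<in> B \<Longrightarrow> u \<noteq> 0 \<Longrightarrow> N (u - 0) < \<delta> \<Longrightarrow> ?q u < ereal \<epsilon>"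
        unfolding eventually_norm_at_within by blast
      show "\<exists>\<delta>>0. \<forall>u\<in>B. N u < \<delta> \<longrightarrow> \<xi> u \<le> \<epsilon> * N u"
      proof (intro exI[of _ \<delta>] conjI ballI impI d(1))
        fix u assume u: "u \<in> B" "N u < \<delta>"
        show "\<xi> u \<le> \<epsilon> * N u"
        proof (cases "u = 0")
          case True
          then show ?thesis using dual_space_zero[OF \<xi>] norm_zero by simp
        next
          case False
          then have "\<xi> u / N u < \<epsilon>" using d(2)[of u] u by simp
          moreover have "0 < N u" using norm_pos False u B by blast
          ultimately show ?thesis by (simp add: pos_divide_less_eq)
        qed
      qed
    qed
  next
    assume R: ?R
    show ?L unfolding Limsup_le_iff
    proof (intro allI impI)
      fix y :: ereal assume "0 < y"
      then obtain z where z: "0 < ereal z" "ereal z < y" using ereal_dense2 by blast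
      then obtain \<delta> where d: "\<delta> > 0" "\<And>u. u \<in> B \<Longrightarrow> N u < \<delta> \<Longrightarrow> \<xi> u \<le> z * N u" using R by auto
      show "eventually (\<lambda>u. ?q u < y) (norm_at_within N 0 B)"
        unfolding eventually_norm_at_within
      proof (intro exI[of _ \<delta>] conjI ballI impI d(1))
        fix u assume u: "u \<in> B" "u \<noteq> 0" "N (u - 0) < \<delta>"
        then have "\<xi> u / N u \<le> z" using d(2)[of u] norm_pos[of u] B by (auto simp: pos_divide_le_eq)
        then have "?q u \<le> ereal z" by simp
        then show "?q u < y" using z(2) by (rule le_less_trans)
      qed
    qed
  qed
  then show ?thesis unfolding frechet_normal_cone_def by blast
qed

text \<open>The theorem with the geometry condensed into two first-order estimates; \<open>E\<close>
  plays the exponential map and \<open>d\<close> the distance. In \<open>lower\<close> a point close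
  to \<open>E u\<close> is found inside the image of \<open>U\<close> as part of the estimate, so
  points of \<open>\<Omega>\<close> outside that neighborhood cannot interfere. Its error term
  contains the norm of the unknown \<open>w\<close>.\<close>

theorem frechet_subdifferential_distance:
  fixes E :: "'v \<Rightarrow> 'm" and d :: "'m \<Rightarrow> 'm \<Rightarrow> ereal"
  assumes U: "U \<subseteq> V" "inj_on E U"
    and upper: "\<And>\<epsilon>. \<epsilon> > 0 \<Longrightarrow> \<exists>\<delta>>0. \<forall>u\<in>V. \<forall>w\<in>V. N u < \<delta> \<longrightarrow> N w < \<delta> \<longrightarrow>
        d (E u) (E w) \<le> ereal (N (u - w) + \<epsilon> * (N u + N w))"
    and lower: "\<And>\<epsilon>. \<epsilon> > 0 \<Longrightarrow> \<exists>\<delta>>0. \<forall>u\<in>V. \<forall>q r. N u < \<delta> \<longrightarrow> r < \<delta> \<longrightarrow> d (E u) q < ereal r \<longrightarrow>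
        (\<exists>w\<in>U. E w = q \<and> N (u - w) \<le> (1 + \<epsilon>) * r + \<epsilon> * (N u + N w))"
    and near: "\<And>\<delta>. \<delta> > 0 \<Longrightarrow> \<exists>w\<in>U. N w < \<delta> \<and> E w \<in> \<Omega>"
  shows "frechet_subdifferential V N (\<lambda>u. INF q\<in>\<Omega>. d (E u) q) 0 =
         frechet_normal_cone V N (inv_into U E ` (\<Omega> \<inter> E ` U)) 0 \<inter> dual_unit_ball V N"
proof -
  define F where "F u = (INF q\<in>\<Omega>. d (E u) q)" for u
  have zero: "0 \<in> V" using subspace_0[OF subspace] .
  have preimage: "inv_into U E ` (\<Omega> \<inter> E ` U) = {w \<in> U. E w \<in> \<Omega>}"
    using U(2) by (force simp: image_iff)
  have F_le: "F u \<le> d (E u) q" if "q \<in> \<Omega>" for u q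
    unfolding F_def using that by (rule INF_lower)
  have F_bound: "\<exists>\<delta>>0. \<forall>u\<in>V. N u < \<delta> \<longrightarrow> F u \<le> ereal ((1 + \<epsilon>) * N u)" if e: "\<epsilon> > 0" for \<epsilon>
  proof -
    obtain \<delta> where \<delta>: "\<delta> > 0" "\<And>u w. u \<in> V \<Longrightarrow> w \<in> V \<Longrightarrow> N u < \<delta> \<Longrightarrow> N w < \<delta> \<Longrightarrow>
        d (E u) (E w) \<le> ereal (N (u - w) + \<epsilon> * (N u + N w))"
      using upper[OF e] by blast
    have "F u \<le> ereal ((1 + \<epsilon>) * N u)" if u: "u \<in> V" "N u < \<delta>" for u
    proof (rule ereal_le_epsilon2)
      fix e' :: real assume e': "e' > 0"
      \<comment> \<open>Chosen so that a point of \<open>\<Omega>\<close> at \<open>w\<close> with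
        \<open>N w < \<eta>\<close> costs at most \<open>e'\<close> in
        \<open>(1 + \<epsilon>) * (N u + N w)\<close>.\<close>
      define \<eta> where "\<eta> = min \<delta> (e' / (1 + \<epsilon>))"
      have "\<eta> > 0" using e' \<delta>(1) e by (simp add: \<eta>_def)
      then obtain w where w: "w \<in> U" "N w < \<eta>" "E w \<in> \<Omega>" using near by blast
      have wV: "w \<in> V" using w U by blast
      have "N (u - w) \<le> N u + N w"
        using norm_triangle[OF u(1) subspace_neg[OF subspace wV]] norm_minus[OF wV] by simp
      moreover have "(1 + \<epsilon>) * N w \<le> e'"
        using w(2) e by (auto simp: \<eta>_def pos_less_divide_eq mult.commute)
      ultimately have *: "N (u - w) + \<epsilon> * (N u + N w) \<le> (1 + \<epsilon>) * N u + e'" by (simp add: algebra_simps)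
      have "F u \<le> d (E u) (E w)" by (rule F_le[OF w(3)])
      also have "\<dots> \<le> ereal (N (u - w) + \<epsilon> * (N u + N w))"
        using \<delta>(2)[OF u(1) wV u(2)] w(2) by (simp add: \<eta>_def)
      also have "\<dots> \<le> ereal ((1 + \<epsilon>) * N u + e')" using * by simp
      finally show "F u \<le> ereal ((1 + \<epsilon>) * N u) + ereal e'" by simp
    qed
    then show ?thesis using \<delta>(1) by blast
  qed
  have F0: "F 0 = 0"
  proof (rule antisym)
    show "F 0 \<le> 0" using F_bound[of 1] zero norm_zero by (metis mult_zero_right zero_ereal_def zero_less_one)
    show "0 \<le> F 0" unfolding F_def
    proof (rule INF_greatest, rule ccontr)
      fix q assume "q \<in> \<Omega>" and neg: "\<not> 0 \<le> d (E 0) q"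
      obtain \<delta> where \<delta>: "\<delta> > 0" "\<And>u q r. u \<in> V \<Longrightarrow> N u < \<delta> \<Longrightarrow> r < \<delta> \<Longrightarrow> d (E u) q < ereal r \<Longrightarrow>
        (\<exists>w\<in>U. E w = q \<and> N (u - w) \<le> (1 + 1/2) * r + 1/2 * (N u + N w))"
        using lower[of "1/2"] by auto
      \<comment> \<open>A negative radius is admissible in \<open>lower\<close>; it would give
        \<open>w\<close> with \<open>N w \<le> 3/2 * r + 1/2 * N w\<close>, impossible for
        \<open>r < 0\<close>.\<close>
      obtain r where r: "d (E 0) q < ereal r" "ereal r < 0" using neg ereal_dense2[of "d (E 0) q" 0] by (meson not_le)
      then have r0: "r < 0" by simp
      obtain w where w: "w \<in> U" "N (0 - w) \<le> (1 + 1/2) * r + 1/2 * (N 0 + N w)"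
        using \<delta>(2)[OF zero _ _ r(1)] \<delta>(1) r0 norm_zero by auto
      have "N (0 - w) = N w" "N w \<ge> 0" using norm_minus norm_nonneg w U by auto
      then show False using w(2) r0 norm_zero by simp
    qed
  qed
  have sub: "\<xi> \<in> frechet_normal_cone V N {w \<in> U. E w \<in> \<Omega>} 0 \<inter> dual_unit_ball V N"
    if "\<xi> \<in> frechet_subdifferential V N F 0" for \<xi>
  proof -
    have \<xi>: "\<xi> \<in> dual_space V N" and s: "\<And>\<epsilon>. \<epsilon> > 0 \<Longrightarrow> \<exists>\<delta>>0. \<forall>u\<in>V. u \<noteq> 0 \<longrightarrow> N u < \<delta> \<longrightarrow> ereal (\<xi> u - \<epsilon> * N u) \<le> F u"
      using that unfolding frechet_subdifferential_at_zero_iff[of F, OF F0] by auto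
    have "\<exists>\<delta>>0. \<forall>u\<in>{w \<in> U. E w \<in> \<Omega>}. N u < \<delta> \<longrightarrow> \<xi> u \<le> \<epsilon> * N u" if e: "\<epsilon> > 0" for \<epsilon>
    proof -
      \<comment> \<open>One third of \<open>\<epsilon>\<close> pays for the subgradient inequality,
        two thirds for \<open>d (E u) (E u)\<close>, whose bound contains \<open>N u\<close>
        twice.\<close>
      obtain \<delta>1 where d1: "\<delta>1 > 0" "\<And>u. u \<in> V \<Longrightarrow> u \<noteq> 0 \<Longrightarrow> N u < \<delta>1 \<Longrightarrow> ereal (\<xi> u - \<epsilon>/3 * N u) \<le> F u"
        using s[of "\<epsilon>/3"] e by auto
      obtain \<delta>2 where d2: "\<delta>2 > 0" "\<And>u w. u \<in> V \<Longrightarrow> w \<in> V \<Longrightarrow> N u < \<delta>2 \<Longrightarrow> N w < \<delta>2 \<Longrightarrow>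
        d (E u) (E w) \<le> ereal (N (u - w) + \<epsilon>/3 * (N u + N w))"
        using upper[of "\<epsilon>/3"] e by auto
      have "\<xi> u \<le> \<epsilon> * N u" if u: "u \<in> U" "E u \<in> \<Omega>" "N u < min \<delta>1 \<delta>2" for u
      proof (cases "u = 0")
        case True
        then show ?thesis using dual_space_zero[OF \<xi>] norm_zero by simp
      next
        case False
        have uV: "u \<in> V" using u U by blast
        have "ereal (\<xi> u - \<epsilon>/3 * N u) \<le> F u" using d1(2)[OF uV False] u by simp
        also have "\<dots> \<le> d (E u) (E u)" by (rule F_le[OF u(2)])
        also have "\<dots> \<le> ereal (N (u - u) + \<epsilon>/3 * (N u + N u))" using d2(2)[OF uV uV] u by simp
        finally show ?thesis by (simp add: norm_zero)
      qed
      then show ?thesis using d1(1) d2(1) by (intro exI[of _ "min \<delta>1 \<delta>2"]) auto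
    qed
    moreover have "\<xi> v \<le> N v" if v: "v \<in> V" for v
    proof (cases "v = 0")
      case True
      then show ?thesis using dual_space_zero[OF \<xi>] norm_zero by simp
    next
      case False
      have p: "N v > 0" by (rule norm_pos[OF v False])
      show ?thesis
      proof (rule field_le_epsilon)
        fix e :: real assume e: "e > 0"
        \<comment> \<open>Chosen so that \<open>(1 + 2 * \<epsilon>) * N v = N v + e\<close>. The
          inequality is obtained at a short multiple \<open>t *\<^sub>R v\<close> and homogeneity
          removes \<open>t\<close>.\<close>
        define \<epsilon> where "\<epsilon> = e / (2 * N v)"
        have e': "\<epsilon> > 0" using e p by (simp add: \<epsilon>_def)
        obtain \<delta>1 where d1: "\<delta>1 > 0" "\<And>u. u \<in> V \<Longrightarrow> u \<noteq> 0 \<Longrightarrow> N u < \<delta>1 \<Longrightarrow> ereal (\<xi> u - \<epsilon> * N u) \<le> F u"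
          using s[OF e'] by blast
        obtain \<delta>2 where d2: "\<delta>2 > 0" "\<And>u. u \<in> V \<Longrightarrow> N u < \<delta>2 \<Longrightarrow> F u \<le> ereal ((1 + \<epsilon>) * N u)"
          using F_bound[OF e'] by blast
        define t where "t = min \<delta>1 \<delta>2 / (2 * N v)"
        have t: "t > 0" using d1 d2 p by (simp add: t_def)
        have tv: "t *\<^sub>R v \<in> V" using v subspace_scale[OF subspace] by blast
        have Nt: "N (t *\<^sub>R v) = t * N v" using norm_scale[OF v] t by simp
        have "t * N v = min \<delta>1 \<delta>2 / 2" using p by (simp add: t_def)
        then have small: "N (t *\<^sub>R v) < \<delta>1" "N (t *\<^sub>R v) < \<delta>2" using Nt d1 d2 by auto
        have "ereal (\<xi> (t *\<^sub>R v) - \<epsilon> * N (t *\<^sub>R v)) \<le> F (t *\<^sub>R v)"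
          using d1(2)[OF tv _ small(1)] t False by simp
        also have "\<dots> \<le> ereal ((1 + \<epsilon>) * N (t *\<^sub>R v))" by (rule d2(2)[OF tv small(2)])
        finally have "\<xi> (t *\<^sub>R v) \<le> (1 + 2 * \<epsilon>) * N (t *\<^sub>R v)" by (simp add: algebra_simps)
        then have "t * \<xi> v \<le> t * ((1 + 2 * \<epsilon>) * N v)" using Nt dual_space_scale[OF \<xi> v] by (simp add: algebra_simps)
        then have "\<xi> v \<le> (1 + 2 * \<epsilon>) * N v" using t by simp
        also have "\<dots> = N v + e" using p by (simp add: \<epsilon>_def algebra_simps)
        finally show "\<xi> v \<le> N v + e" .
      qed
    qed
    moreover have "{w \<in> U. E w \<in> \<Omega>} \<subseteq> V" using U by blast
    ultimately show ?thesis
      using \<xi> by (simp add: frechet_normal_cone_at_zero_iff dual_unit_ball_def dual_norm_le_1_iff)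
  qed
  have sup: "\<xi> \<in> frechet_subdifferential V N F 0"
    if "\<xi> \<in> frechet_normal_cone V N {w \<in> U. E w \<in> \<Omega>} 0" "\<xi> \<in> dual_unit_ball V N" for \<xi>
  proof -
    have BV: "{w \<in> U. E w \<in> \<Omega>} \<subseteq> V" using U by blast
    have \<xi>: "\<xi> \<in> dual_space V N"
      and n: "\<And>\<epsilon>. \<epsilon> > 0 \<Longrightarrow> \<exists>\<delta>>0. \<forall>u\<in>{w \<in> U. E w \<in> \<Omega>}. N u < \<delta> \<longrightarrow> \<xi> u \<le> \<epsilon> * N u"
      using that(1) unfolding frechet_normal_cone_at_zero_iff[OF BV] by auto
    have ball: "\<And>v. v \<in> V \<Longrightarrow> \<xi> v \<le> N v"
      using that(2) \<xi> by (simp add: dual_unit_ball_def dual_norm_le_1_iff)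
    have "\<exists>\<delta>>0. \<forall>u\<in>V. u \<noteq> 0 \<longrightarrow> N u < \<delta> \<longrightarrow> ereal (\<xi> u - \<epsilon> * N u) \<le> F u" if e: "\<epsilon> > 0" for \<epsilon>
    proof -
      \<comment> \<open>With \<open>k \<le> 1/3\<close> the term \<open>k * N w\<close> is absorbed
        and \<open>N w \<le> 4 * N u\<close> follows. The errors then sum to
        \<open>10 * (k * N u)\<close>: one from \<open>(1 + k) * t\<close>, one from
        \<open>N u\<close> and four from \<open>N w\<close> in the distance bound, four from
        normality. The eleventh makes the contradiction strict.\<close>
      define k where "k = min (1/3) (\<epsilon> / 11)"
      have k: "k > 0" "k \<le> 1/3" "11 * k \<le> \<epsilon>" using e by (auto simp: k_def)
      obtain \<delta>1 where d1: "\<delta>1 > 0" "\<And>u. u \<in> U \<Longrightarrow> E u \<in> \<Omega> \<Longrightarrow> N u < \<delta>1 \<Longrightarrow> \<xi> u \<le> k * N u"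
        using n[OF k(1)] by blast
      obtain \<delta>2 where d2: "\<delta>2 > 0" "\<And>u q r. u \<in> V \<Longrightarrow> N u < \<delta>2 \<Longrightarrow> r < \<delta>2 \<Longrightarrow> d (E u) q < ereal r \<Longrightarrow>
        (\<exists>w\<in>U. E w = q \<and> N (u - w) \<le> (1 + k) * r + k * (N u + N w))"
        using lower[OF k(1)] by blast
      \<comment> \<open>The quarter of \<open>\<delta>1\<close> lets \<open>w\<close>, up to four
        times as long as \<open>u\<close>, still fall under the normality estimate.\<close>
      have "ereal (\<xi> u - \<epsilon> * N u) \<le> F u" if u: "u \<in> V" "u \<noteq> 0" "N u < min (\<delta>1 / 4) \<delta>2" for u
        unfolding F_def
      \<comment> \<open>Any \<open>q\<close> of \<open>\<Omega>\<close> that violates the inequality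
        serves as the almost nearest point, with \<open>t \<le> N u\<close> as strict upper bound
        for its distance.\<close>
      proof (rule INF_greatest, rule ccontr)
        fix q assume q: "q \<in> \<Omega>"
        define t where "t = \<xi> u - \<epsilon> * N u"
        assume "\<not> ereal (\<xi> u - \<epsilon> * N u) \<le> d (E u) q"
        then have lt: "d (E u) q < ereal t" by (simp add: t_def)
        have p: "N u > 0" by (rule norm_pos[OF u(1,2)])
        have tN: "t \<le> N u" using ball[OF u(1)] e p unfolding t_def by (smt (verit) mult_pos_pos)
        obtain w where w: "w \<in> U" "E w = q" "N (u - w) \<le> (1 + k) * t + k * (N u + N w)"
          using d2(2)[OF u(1) _ _ lt] tN u(3) by auto
        have wV: "w \<in> V" using w U by blast
        have uw: "u - w \<in> V" by (rule subspace_diff[OF subspace u(1) wV])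
        have kt: "(1 + k) * t \<le> t + k * N u" using tN k by (simp add: algebra_simps)
        have "N w \<le> N u + N (u - w)"
          using norm_triangle[OF u(1) subspace_neg[OF subspace uw]] norm_minus[OF uw] by simp
        then have "N w \<le> N u + N u + k * N u + k * N u + k * N w"
          using w(3) kt tN by (simp add: algebra_simps)
        moreover have "k * N u \<le> 1/3 * N u" "k * N w \<le> 1/3 * N w"
          using mult_right_mono[OF k(2), of "N u"] mult_right_mono[OF k(2) norm_nonneg[OF wV]] p by simp_all
        ultimately have Nw: "N w \<le> 4 * N u" by simp
        then have "\<xi> w \<le> k * N w" using d1(2)[OF w(1)] w(2) q u(3) by simp
        moreover have kw: "k * N w \<le> k * (4 * N u)" using Nw k by (intro mult_left_mono) auto
        moreover have "\<xi> (u - w) \<le> N (u - w)" by (rule ball[OF uw])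
        moreover have "\<xi> (u - w) = \<xi> u - \<xi> w" by (rule dual_space_diff[OF \<xi> u(1) wV])
        ultimately have "\<xi> u \<le> t + 10 * (k * N u)" using w(3) kt by (simp add: algebra_simps)
        moreover have "11 * (k * N u) \<le> \<epsilon> * N u"
          using mult_right_mono[OF k(3), of "N u"] p by simp
        moreover have "k * N u > 0" using k p by simp
        ultimately show False unfolding t_def by linarith
      qed
      then show ?thesis using d1(1) d2(1) by (intro exI[of _ "min (\<delta>1 / 4) \<delta>2"]) auto
    qed
    then show ?thesis using \<xi> unfolding frechet_subdifferential_at_zero_iff[of F, OF F0] by blast
  qed
  have "frechet_subdifferential V N F 0 = frechet_normal_cone V N {w \<in> U. E w \<in> \<Omega>} 0 \<inter> dual_unit_ball V N"
    using sub sup by blast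
  then show ?thesis unfolding preimage F_def .
qed

end

section \<open>The metric in exponential coordinates\<close>

context riemannian_manifold
begin

lemma norm_on_tangent_space: "norm_on (tangent_space A p) (tangent_norm g p)"
proof -
  obtain c where c: "c \<in> A" "p \<in> chart_dom c" by (rule exists_chart)
  interpret psd_form "metric_form c (chart_map c p)" by (rule metric_form_psd) (use c in auto)
  note N = tangent_norm_eq[OF c]
  note S = subspace_tangent_space[of p]
  show ?thesis
  proof
    show "subspace (tangent_space A p)" by (rule S)
    fix v assume v: "v \<in> tangent_space A p"
    show "0 \<le> tangent_norm g p v" using N[OF v] nonneg by simp
    show "v = 0" if "tangent_norm g p v = 0"
    proof (rule ccontr)
      assume "v \<noteq> 0"
      then have "g p v v > 0" by (rule metric_pos[OF v])
      then show False using that by (simp add: tangent_norm_def)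
    qed
    show "tangent_norm g p (r *\<^sub>R v) = \<bar>r\<bar> * tangent_norm g p v" for r
      unfolding N[OF v] N[OF subspace_scale[OF S v]] scaleR_tvec.rep_eq by (rule sqrt_scale)
    fix w assume w: "w \<in> tangent_space A p"
    show "tangent_norm g p (v + w) \<le> tangent_norm g p v + tangent_norm g p w"
      unfolding N[OF v] N[OF w] N[OF subspace_add[OF S v w]] plus_tvec.rep_eq by (rule sqrt_triangle)
  qed
qed

end

text \<open>The chart \<open>c\<close> at \<open>p\<close> is auxiliary: lengths are compared in it
  with the constant norm \<open>n0\<close>, which is the norm of the tangent space at
  \<open>p\<close> in coordinates.\<close>

locale exp_chart = riemannian_manifold A g
  for A :: "('m::t2_space, 'e::{real_inner, complete_space}) chart set" and g :: "('m, 'e) metric" +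
  fixes p :: 'm and U :: "('m, 'e) tvec set" and c :: "('m, 'e) chart"
  assumes exp_neighborhood: "exp_neighborhood A g p U"
    and c_in_A: "c \<in> A" and p_in_c: "p \<in> chart_dom c"
begin

abbreviation "\<E> \<equiv> riem_exp A g p"
abbreviation "V \<equiv> tangent_space A p"
abbreviation "N \<equiv> tangent_norm g p"
abbreviation "x0 \<equiv> chart_map c p"
abbreviation "n0 v \<equiv> sqrt (metric_form c x0 v v)"

sublocale tangent: norm_on V N
  by (rule norm_on_tangent_space)

lemma x0_image: "x0 \<in> chart_map c ` chart_dom c"
  using p_in_c by blast

sublocale form: psd_form "metric_form c x0"
  by (rule metric_form_psd[OF c_in_A x0_image])

lemma U_sub_domain: "U \<subseteq> exp_domain A g p" and zero_in_U: "0 \<in> U" and inj_exp: "inj_on \<E> U"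
  using exp_neighborhood by (auto simp: exp_neighborhood_def)

lemma U_sub_V: "U \<subseteq> V"
  using U_sub_domain by (auto simp: exp_domain_def)

lemma exp_zero: "\<E> 0 = p"
  using riem_exp_zero U_sub_domain zero_in_U by blast

lemma N_eq: "v \<in> V \<Longrightarrow> N v = n0 (coord v c)"
  by (rule tangent_norm_eq[OF c_in_A p_in_c])

lemma N_diff: "v \<in> V \<Longrightarrow> w \<in> V \<Longrightarrow> N (v - w) = n0 (coord v c - coord w c)"
  using N_eq[OF subspace_diff[OF subspace_tangent_space]] by (simp add: minus_tvec.rep_eq)

lemma norm_bounds:
  obtains a b where "a > 0" "b > 0" "\<And>x. a * norm x \<le> n0 x" "\<And>x. n0 x \<le> b * norm x"
proof -
  obtain a b where ab: "a > 0" "b > 0"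
    "\<forall>v\<in>V. a * norm (coord v c) \<le> N v \<and> N v \<le> b * norm (coord v c)"
    using norm_equivalent[OF c_in_A p_in_c] by blast
  have "a * norm x \<le> n0 x \<and> n0 x \<le> b * norm x" for x
  proof -
    have v: "of_coord A c p x \<in> V" by (rule of_coord_in_tangent_space[OF c_in_A p_in_c])
    show ?thesis using ab(3) v N_eq[OF v] coord_of_coord_self[OF c_in_A p_in_c] by metis
  qed
  then show ?thesis using that ab by blast
qed

text \<open>The exponential map with tangent vectors and points both read in \<open>c\<close>. The
  set \<open>X\<close> below is the domain on which \<open>exp_neighborhood\<close> makes it smooth,
  for \<open>c' = c\<close>.\<close>

definition \<phi> :: "'e \<Rightarrow> 'e" where
  "\<phi> x = chart_map c (\<E> (of_coord A c p x))"

definition X :: "'e set" where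
  "X = (\<lambda>v. coord v c) ` {v \<in> U. \<E> v \<in> chart_dom c}"

lemma smooth_\<phi>: "smooth_on X \<phi>"
  using exp_neighborhood c_in_A p_in_c unfolding exp_neighborhood_def X_def \<phi>_def[abs_def] by blast

lemma of_coord_X:
  assumes "x \<in> X"
  shows "of_coord A c p x \<in> U" "\<E> (of_coord A c p x) \<in> chart_dom c"
proof -
  obtain v where v: "v \<in> U" "\<E> v \<in> chart_dom c" "x = coord v c" using assms by (auto simp: X_def)
  have "of_coord A c p x = v" unfolding v(3) using of_coord_coord[OF _ c_in_A p_in_c] U_sub_V v(1) by blast
  then show "of_coord A c p x \<in> U" "\<E> (of_coord A c p x) \<in> chart_dom c" using v by auto
qed

lemma zero_in_X: "0 \<in> X"
proof -
  have "0 = coord (0 :: ('m, 'e) tvec) c" by (simp add: zero_tvec.rep_eq)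
  then show ?thesis unfolding X_def using zero_in_U exp_zero p_in_c by (intro image_eqI[of _ _ 0]) auto
qed

lemma of_coord_zero: "of_coord A c p 0 = 0"
  using of_coord_scaleR[OF c_in_A p_in_c, of 0 0] by simp

lemma \<phi>_zero: "\<phi> 0 = x0"
  by (simp add: \<phi>_def of_coord_zero exp_zero)

text \<open>Smoothness supplies a linear derivative at \<open>0\<close>. On a ray it must equal the
  initial velocity of the geodesic, that is, the direction of the ray; linearity then extends this
  from short vectors to all.\<close>

lemma \<phi>_has_derivative: "(\<phi> has_derivative (\<lambda>v. v)) (at 0)"
proof -
  let ?D = "frechet_derivative \<phi> (at 0)"
  have D: "(\<phi> has_derivative ?D) (at 0)" by (rule smooth_on_has_derivative[OF smooth_\<phi> zero_in_X])
  then have lin: "linear ?D" by (rule has_derivative_linear)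
  have "?D v = v" for v
  proof -
    have "open X" using smooth_\<phi> by (simp add: smooth_on_def)
    then obtain r where r: "r > 0" "ball 0 r \<subseteq> X" using zero_in_X openE by blast
    \<comment> \<open>The \<open>+ 1\<close> allows \<open>v = 0\<close>; the factor
      \<open>s\<close> shortens \<open>v\<close> into the ball contained in
      \<open>X\<close>.\<close>
    define K where "K = norm v + 1"
    define s where "s = r / 2 / K"
    have K: "K > 0" using norm_ge_zero[of v] unfolding K_def by linarith
    have s: "s > 0" using r K by (simp add: s_def)
    have "s * norm v < r"
    proof -
      have "s * norm v \<le> s * K" using s by (simp add: K_def)
      also have "\<dots> = r / 2" using K by (simp add: s_def)
      finally show ?thesis using r by linarith
    qed
    then have "s *\<^sub>R v \<in> X" using r s by (auto simp: subset_iff)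
    note ofX = of_coord_X(1)[OF this]
    let ?u = "of_coord A c p (s *\<^sub>R v)"
    have "((\<lambda>t. chart_map c (\<E> (t *\<^sub>R ?u))) has_vector_derivative coord ?u c) (at 0 within {0..1})"
      using ofX U_sub_domain by (intro riem_exp_ray_has_vector_derivative c_in_A p_in_c) auto
    then have ray: "((\<lambda>t. \<phi> (t *\<^sub>R (s *\<^sub>R v))) has_vector_derivative s *\<^sub>R v) (at 0 within {0..1})"
      unfolding coord_of_coord_self[OF c_in_A p_in_c]
      by (simp add: \<phi>_def of_coord_scaleR[OF c_in_A p_in_c])
    have "((\<lambda>t. t *\<^sub>R (s *\<^sub>R v)) has_derivative (\<lambda>t. t *\<^sub>R (s *\<^sub>R v))) (at 0 within {0..1})"
      by (auto intro!: derivative_eq_intros)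
    then have "(\<phi> \<circ> (\<lambda>t. t *\<^sub>R (s *\<^sub>R v)) has_derivative ?D \<circ> (\<lambda>t. t *\<^sub>R (s *\<^sub>R v))) (at 0 within {0..1})"
      by (rule diff_chain_within) (use D has_derivative_at_withinI in simp)
    then have "((\<lambda>t. \<phi> (t *\<^sub>R (s *\<^sub>R v))) has_vector_derivative ?D (s *\<^sub>R v)) (at 0 within {0..1})"
      by (simp add: has_vector_derivative_def o_def linear_scale[OF lin])
    from vector_derivative_unit_interval[OF this] vector_derivative_unit_interval[OF ray]
    have "?D (s *\<^sub>R v) = s *\<^sub>R v" by simp
    then show ?thesis using s by (simp add: linear_scale[OF lin])
  qed
  then have "?D = (\<lambda>v. v)" by blast
  then show ?thesis using D by simp
qed

text \<open>The derivative at \<open>0\<close> restated in the norm of the tangent space at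
  \<open>p\<close>. Passing to the model norm and back costs a factor \<open>b / a\<close>, hence
  the tolerance \<open>\<epsilon> * a / b\<close>.\<close>

lemma exp_near_identity:
  assumes "\<epsilon> > 0"
  shows "\<exists>\<delta>>0. \<forall>u\<in>V. N u < \<delta> \<longrightarrow>
    \<E> u \<in> chart_dom c \<and> n0 (chart_map c (\<E> u) - x0 - coord u c) \<le> \<epsilon> * N u"
proof (rule norm_bounds)
  fix a b assume ab: "a > 0" "b > 0" "\<And>x. a * norm x \<le> n0 x" "\<And>x. n0 x \<le> b * norm x"
  have "open X" using smooth_\<phi> by (simp add: smooth_on_def)
  then obtain r where r: "r > 0" "ball 0 r \<subseteq> X" using zero_in_X openE by blast
  have "\<epsilon> * a / b > 0" using assms ab by simp
  then obtain d where d: "d > 0" "\<And>y. norm (y - 0) < d \<Longrightarrow> norm (\<phi> y - \<phi> 0 - (y - 0)) \<le> \<epsilon> * a / b * norm (y - 0)"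
    using \<phi>_has_derivative unfolding has_derivative_at_alt by blast
  show ?thesis
  proof (intro exI[of _ "a * min r d"] conjI ballI impI)
    show "0 < a * min r d" using ab r d by simp
    fix u assume u: "u \<in> V" "N u < a * min r d"
    let ?x = "coord u c"
    have "a * norm ?x \<le> N u" using ab(3) N_eq[OF u(1)] by simp
    moreover from this have "a * norm ?x < a * min r d" using u(2) by simp
    ultimately have x: "norm ?x < r" "norm ?x < d" "a * norm ?x \<le> N u" using ab(1) by simp_all
    have ofu: "of_coord A c p ?x = u" by (rule of_coord_coord[OF u(1) c_in_A p_in_c])
    have "?x \<in> X" using r x by (auto simp: subset_iff)
    then show "\<E> u \<in> chart_dom c" using of_coord_X(2) ofu by metis
    have "norm (chart_map c (\<E> u) - x0 - ?x) \<le> \<epsilon> * a / b * norm ?x"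
      using d(2)[of ?x] x ofu \<phi>_zero by (simp add: \<phi>_def)
    then have "b * norm (chart_map c (\<E> u) - x0 - ?x) \<le> b * (\<epsilon> * a / b * norm ?x)"
      using ab by (intro mult_left_mono) auto
    also have "\<dots> = \<epsilon> * (a * norm ?x)" using ab by simp
    also have "\<dots> \<le> \<epsilon> * N u" using x assms by (intro mult_left_mono) auto
    finally show "n0 (chart_map c (\<E> u) - x0 - ?x) \<le> \<epsilon> * N u"
      using ab(4)[of "chart_map c (\<E> u) - x0 - ?x"] by linarith
  qed
qed

text \<open>Continuity of the inverse exponential map at \<open>p\<close>, read in \<open>c\<close>:
  points with nearby coordinates are exponentials of short vectors in \<open>U\<close>.\<close>

lemma exp_onto_neighborhood:
  assumes "\<delta> > 0"
  shows "\<exists>r>0. \<forall>q\<in>chart_dom c. norm (chart_map c q - x0) < r \<longrightarrow> (\<exists>w\<in>U. \<E> w = q \<and> N w < \<delta>)"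
proof (rule norm_bounds)
  fix a b assume ab: "a > 0" "b > 0" "\<And>x. a * norm x \<le> n0 x" "\<And>x. n0 x \<le> b * norm x"
  define Y where "Y = chart_map c ` (chart_dom c \<inter> \<E> ` U)"
  define \<psi> where "\<psi> y = coord (inv_into U \<E> (chart_inv c y)) c" for y
  have sm: "smooth_on Y \<psi>"
    using exp_neighborhood c_in_A p_in_c unfolding exp_neighborhood_def Y_def \<psi>_def[abs_def] by blast
  have "p \<in> \<E> ` U" using zero_in_U exp_zero by force
  then have x0Y: "x0 \<in> Y" using p_in_c by (auto simp: Y_def)
  have "open Y" using sm by (simp add: smooth_on_def)
  then obtain r1 where r1: "r1 > 0" "ball x0 r1 \<subseteq> Y" using x0Y openE by blast
  have "inv_into U \<E> p = 0" using inv_into_f_f[OF inj_exp zero_in_U] exp_zero by simp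
  then have \<psi>0: "\<psi> x0 = 0" by (simp add: \<psi>_def chart_inv_left[OF c_in_A p_in_c] zero_tvec.rep_eq)
  have "continuous (at x0) \<psi>"
    using smooth_on_has_derivative[OF sm x0Y] by (rule has_derivative_continuous)
  moreover have "\<delta> / b > 0" using assms ab by simp
  ultimately obtain r2 where r2: "r2 > 0" "\<And>y. dist y x0 < r2 \<Longrightarrow> dist (\<psi> y) (\<psi> x0) < \<delta> / b"
    unfolding continuous_at_eps_delta by blast
  show ?thesis
  proof (intro exI[of _ "min r1 r2"] conjI ballI impI)
    fix q assume q: "q \<in> chart_dom c" "norm (chart_map c q - x0) < min r1 r2"
    have "chart_map c q \<in> Y" using q r1 by (auto simp: subset_iff dist_norm norm_minus_commute)
    then obtain q' where q': "q' \<in> chart_dom c" "q' \<in> \<E> ` U" "chart_map c q' = chart_map c q"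
      by (auto simp: Y_def)
    then have "q' = q" using q chart_inj[OF c_in_A] by (simp add: inj_onD)
    then have qU: "q \<in> \<E> ` U" using q' by simp
    let ?w = "inv_into U \<E> q"
    have w: "?w \<in> U" "\<E> ?w = q" using inv_into_into[OF qU] f_inv_into_f[OF qU] by auto
    have "norm (\<psi> (chart_map c q)) < \<delta> / b" using r2(2)[of "chart_map c q"] q \<psi>0 by (simp add: dist_norm)
    then have "norm (coord ?w c) < \<delta> / b" by (simp add: \<psi>_def chart_inv_left[OF c_in_A q(1)])
    then have "b * norm (coord ?w c) < \<delta>" using ab by (simp add: pos_less_divide_eq mult.commute)
    moreover have "N ?w \<le> b * norm (coord ?w c)" using ab(4) N_eq U_sub_V w by force
    ultimately show "\<exists>w\<in>U. \<E> w = q \<and> N w < \<delta>" using w by force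
  qed (use r1 r2 in auto)
qed

section \<open>First-order estimates for the distance between exponentials\<close>

lemma n0_minus: "n0 (- v) = n0 v"
  using form.sqrt_scale[of "-1" v] by simp

text \<open>The straight chart segment between the two points has length at most
  \<open>1 + \<eta>\<close> times the \<open>n0\<close> norm of its displacement, which differs from
  \<open>N (u - w)\<close> by the deviations of the exponential map from the identity at both
  ends.\<close>

lemma riem_dist_exp_upper:
  assumes \<epsilon>: "\<epsilon> > 0"
  shows "\<exists>\<delta>>0. \<forall>u\<in>V. \<forall>w\<in>V. N u < \<delta> \<longrightarrow> N w < \<delta> \<longrightarrow>
     riem_dist A g (\<E> u) (\<E> w) \<le> ereal (N (u - w) + \<epsilon> * (N u + N w))"
proof (rule norm_bounds)
  fix a b assume ab: "a > 0" "b > 0" "\<And>x. a * norm x \<le> n0 x" "\<And>x. n0 x \<le> b * norm x"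
  \<comment> \<open>The product of the two errors leaves \<open>3 * \<eta> * M\<close>, using
    \<open>\<eta> \<le> 1\<close> for the quadratic term; \<open>4 * \<eta> \<le> \<epsilon>\<close>
    covers it.\<close>
  define \<eta> where "\<eta> = min 1 (\<epsilon> / 4)"
  have \<eta>: "\<eta> > 0" "\<eta> \<le> 1" "4 * \<eta> \<le> \<epsilon>" using \<epsilon> by (auto simp: \<eta>_def)
  obtain r where r: "r > 0" "ball x0 r \<subseteq> chart_map c ` chart_dom c"
    "\<And>x v. x \<in> ball x0 r \<Longrightarrow> sqrt (metric_form c x v v) \<le> (1 + \<eta>) * n0 v"
    using metric_comparison[OF c_in_A x0_image, of "1 + \<eta>"] \<eta>(1) by auto
  obtain \<delta>1 where \<delta>1: "\<delta>1 > 0" "\<And>u. u \<in> V \<Longrightarrow> N u < \<delta>1 \<Longrightarrow>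
    \<E> u \<in> chart_dom c \<and> n0 (chart_map c (\<E> u) - x0 - coord u c) \<le> \<eta> * N u"
    using exp_near_identity[OF \<eta>(1)] by blast
  \<comment> \<open>The second bound keeps exponentials in the ball: \<open>\<eta> \<le> 1\<close>
    gives \<open>n0 (chart_map c (\<E> u) - x0) \<le> 2 * N u < a * r\<close>.\<close>
  define \<delta> where "\<delta> = min \<delta>1 (a * r / 2)"
  have inb: "chart_map c (\<E> u) \<in> ball x0 r" if u: "u \<in> V" "N u < \<delta>" for u
  proof -
    let ?y = "chart_map c (\<E> u) - x0"
    have "N u < \<delta>1" "N u < a * r / 2" using u(2) by (auto simp: \<delta>_def)
    have "n0 ?y \<le> n0 (?y - coord u c) + n0 (coord u c)"
      using form.sqrt_triangle[of "?y - coord u c" "coord u c"] by simp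
    also have "\<dots> \<le> \<eta> * N u + N u" using \<delta>1(2)[OF u(1) \<open>N u < \<delta>1\<close>] N_eq[OF u(1)] by simp
    also have "\<dots> \<le> 2 * N u" using mult_right_mono[OF \<eta>(2) tangent.norm_nonneg[OF u(1)]] by simp
    also have "\<dots> < a * r" using \<open>N u < a * r / 2\<close> by simp
    finally have "a * norm ?y < a * r" using ab(3)[of ?y] by linarith
    then show ?thesis using ab(1) by (simp add: dist_norm norm_minus_commute)
  qed
  have "riem_dist A g (\<E> u) (\<E> w) \<le> ereal (N (u - w) + \<epsilon> * (N u + N w))"
    if u: "u \<in> V" "N u < \<delta>" and w: "w \<in> V" "N w < \<delta>" for u w
  proof -
    have u1: "\<E> u \<in> chart_dom c" "n0 (chart_map c (\<E> u) - x0 - coord u c) \<le> \<eta> * N u"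
      using \<delta>1(2)[OF u(1)] u(2) by (auto simp: \<delta>_def)
    have w1: "\<E> w \<in> chart_dom c" "n0 (chart_map c (\<E> w) - x0 - coord w c) \<le> \<eta> * N w"
      using \<delta>1(2)[OF w(1)] w(2) by (auto simp: \<delta>_def)
    define x where "x = chart_map c (\<E> u)"
    define y where "y = chart_map c (\<E> w)"
    define M where "M = N u + N w"
    have M: "M \<ge> 0" using tangent.norm_nonneg u w by (simp add: M_def)
    have Nuw: "N (u - w) \<le> M"
      using tangent.norm_triangle[OF u(1) subspace_neg[OF subspace_tangent_space w(1)]]
        tangent.norm_minus[OF w(1)] by (simp add: M_def)
    have "y - x = (coord w c - coord u c) + ((y - x0 - coord w c) + - (x - x0 - coord u c))" by simp
    then have "n0 (y - x) \<le> n0 (coord w c - coord u c) + n0 ((y - x0 - coord w c) + - (x - x0 - coord u c))"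
      by (metis form.sqrt_triangle)
    also have "n0 ((y - x0 - coord w c) + - (x - x0 - coord u c)) \<le> n0 (y - x0 - coord w c) + n0 (- (x - x0 - coord u c))"
      by (rule form.sqrt_triangle)
    also have "n0 (- (x - x0 - coord u c)) = n0 (x - x0 - coord u c)" by (rule n0_minus)
    also have "n0 (coord w c - coord u c) = N (u - w)"
      using N_diff[OF u(1) w(1)] n0_minus[of "coord u c - coord w c"] by simp
    finally have nyx: "n0 (y - x) \<le> N (u - w) + \<eta> * M"
      using u1 w1 unfolding x_def y_def M_def by (simp add: algebra_simps)
    have "riem_dist A g (chart_inv c x) (chart_inv c y) \<le> ereal ((1 + \<eta>) * n0 (y - x))"
      by (rule riem_dist_chart_upper[OF c_in_A convex_ball r(2)])
         (use inb u w r(3) in \<open>auto simp: x_def y_def\<close>)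
    moreover have "(1 + \<eta>) * n0 (y - x) \<le> N (u - w) + \<epsilon> * M"
    proof -
      have "(1 + \<eta>) * n0 (y - x) \<le> (1 + \<eta>) * (N (u - w) + \<eta> * M)"
        using nyx \<eta> by (intro mult_left_mono) auto
      also have "\<dots> = N (u - w) + \<eta> * N (u - w) + \<eta> * M + \<eta> * (\<eta> * M)" by (simp add: algebra_simps)
      also have "\<dots> \<le> N (u - w) + \<eta> * M + \<eta> * M + 1 * (\<eta> * M)"
        using Nuw \<eta> M by (intro add_mono mult_left_mono mult_right_mono) auto
      also have "\<dots> = N (u - w) + (3 * \<eta>) * M" by simp
      also have "\<dots> \<le> N (u - w) + \<epsilon> * M" using \<eta> M by (intro add_left_mono mult_right_mono) auto
      finally show ?thesis .
    qed
    ultimately show ?thesis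
      unfolding x_def y_def chart_inv_left[OF c_in_A u1(1)] chart_inv_left[OF c_in_A w1(1)] M_def
      by (meson ereal_less_eq(3) order_trans)
  qed
  moreover have "\<delta> > 0" using \<delta>1 ab r by (simp add: \<delta>_def)
  ultimately show ?thesis by blast
qed

text \<open>A curve shorter than \<open>\<rho>\<close> from \<open>\<E> u\<close> ends inside the
  chart, close enough to \<open>p\<close> for its end point to be the exponential of a short
  \<open>w\<close>. The factor \<open>1 + \<epsilon>\<close> is the comparison of norms; the term
  \<open>\<epsilon> * (N u + N w)\<close> is the deviation of the exponential map from the identity
  at \<open>u\<close> and \<open>w\<close>.\<close>

lemma riem_dist_exp_lower:
  assumes \<epsilon>: "\<epsilon> > 0"
  shows "\<exists>\<delta>>0. \<forall>u\<in>V. \<forall>q \<rho>. N u < \<delta> \<longrightarrow> \<rho> < \<delta> \<longrightarrow> riem_dist A g (\<E> u) q < ereal \<rho> \<longrightarrow>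
     (\<exists>w\<in>U. \<E> w = q \<and> N (u - w) \<le> (1 + \<epsilon>) * \<rho> + \<epsilon> * (N u + N w))"
proof (rule norm_bounds)
  fix a b assume ab: "a > 0" "b > 0" "\<And>x. a * norm x \<le> n0 x" "\<And>x. n0 x \<le> b * norm x"
  obtain r where r: "r > 0" "ball x0 r \<subseteq> chart_map c ` chart_dom c"
    "\<And>x v. x \<in> ball x0 r \<Longrightarrow> n0 v \<le> (1 + \<epsilon>) * sqrt (metric_form c x v v)"
    using metric_comparison[OF c_in_A x0_image, of "1 + \<epsilon>"] \<epsilon> by auto
  obtain \<delta>1 where \<delta>1: "\<delta>1 > 0" "\<And>u. u \<in> V \<Longrightarrow> N u < \<delta>1 \<Longrightarrow>
    \<E> u \<in> chart_dom c \<and> n0 (chart_map c (\<E> u) - x0 - coord u c) \<le> \<epsilon> * N u"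
    using exp_near_identity[OF \<epsilon>] by blast
  obtain r2 where r2: "r2 > 0" "\<And>q. q \<in> chart_dom c \<Longrightarrow> norm (chart_map c q - x0) < r2 \<Longrightarrow> (\<exists>w\<in>U. \<E> w = q \<and> N w < \<delta>1)"
    using exp_onto_neighborhood[OF \<delta>1(1)] by blast
  \<comment> \<open>Both \<open>x\<close> from \<open>x0\<close> and \<open>q\<close> from
    \<open>x\<close> are within \<open>s\<close> in coordinates: \<open>x\<close> then lies in the
    half ball, and \<open>q\<close> within \<open>2 * s < r2\<close> of \<open>x0\<close>.\<close>
  define s where "s = min r r2 / 4"
  have s: "s > 0" "s \<le> r / 4" "s \<le> r2 / 4" using r(1) r2(1) by (auto simp: s_def)
  define \<delta> where "\<delta> = min \<delta>1 (a * s / (1 + \<epsilon>))"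
  have \<delta>: "\<delta> > 0" "\<delta> \<le> \<delta>1" "(1 + \<epsilon>) * \<delta> \<le> a * s"
  proof -
    show "\<delta> > 0" "\<delta> \<le> \<delta>1" using \<delta>1(1) ab(1) s(1) \<epsilon> by (simp_all add: \<delta>_def)
    have "(1 + \<epsilon>) * \<delta> \<le> (1 + \<epsilon>) * (a * s / (1 + \<epsilon>))"
      using \<epsilon> by (intro mult_left_mono) (auto simp: \<delta>_def)
    then show "(1 + \<epsilon>) * \<delta> \<le> a * s" using \<epsilon> by simp
  qed
  have "\<exists>w\<in>U. \<E> w = q \<and> N (u - w) \<le> (1 + \<epsilon>) * \<rho> + \<epsilon> * (N u + N w)"
    if u: "u \<in> V" "N u < \<delta>" and \<rho>: "\<rho> < \<delta>" "riem_dist A g (\<E> u) q < ereal \<rho>" for u q \<rho>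
  proof -
    have u1: "\<E> u \<in> chart_dom c" "n0 (chart_map c (\<E> u) - x0 - coord u c) \<le> \<epsilon> * N u"
      using \<delta>1(2)[OF u(1)] u(2) \<delta> by auto
    define x where "x = chart_map c (\<E> u)"
    have "n0 (x - x0) \<le> n0 (x - x0 - coord u c) + n0 (coord u c)"
      using form.sqrt_triangle[of "x - x0 - coord u c" "coord u c"] by simp
    also have "\<dots> \<le> (1 + \<epsilon>) * N u" using u1(2) N_eq[OF u(1)] by (simp add: x_def algebra_simps)
    also have "\<dots> < (1 + \<epsilon>) * \<delta>" using u(2) \<epsilon> by simp
    finally have "a * norm (x - x0) < a * s" using ab(3)[of "x - x0"] \<delta>(3) by linarith
    then have xs: "norm (x - x0) < s" using ab(1) by simp
    then have xb: "x \<in> ball x0 (r / 2)" using s(2) r(1) by (simp add: dist_norm norm_minus_commute)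
    have \<kappa>\<rho>: "(1 + \<epsilon>) * \<rho> \<le> a * s"
    proof -
      have "(1 + \<epsilon>) * \<rho> \<le> (1 + \<epsilon>) * \<delta>" using \<rho>(1) \<epsilon> by (intro mult_left_mono) auto
      then show ?thesis using \<delta>(3) by simp
    qed
    also have "a * s \<le> a * (r / 4)" using s ab(1) by (intro mult_left_mono) auto
    finally have small: "(1 + \<epsilon>) * \<rho> \<le> a * (r / 4)" .
    have ex: "chart_inv c x = \<E> u" unfolding x_def by (rule chart_inv_left[OF c_in_A u1(1)])
    have \<epsilon>1: "1 + \<epsilon> > 0" using \<epsilon> by simp
    have q: "q \<in> chart_dom c" "n0 (chart_map c q - x) \<le> (1 + \<epsilon>) * \<rho>"
      using riem_dist_chart_lower[OF c_in_A x0_image r(1,2) \<epsilon>1 r(3) ab(1,3) xb _ small] \<rho>(2) ex by auto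
    have "a * norm (chart_map c q - x) \<le> a * s" using ab(3)[of "chart_map c q - x"] q(2) \<kappa>\<rho> by linarith
    then have "norm (chart_map c q - x) \<le> s" using ab(1) by simp
    then have "norm (chart_map c q - x0) < r2"
      using norm_triangle_ineq[of "chart_map c q - x" "x - x0"] xs s by simp
    then obtain w where w: "w \<in> U" "\<E> w = q" "N w < \<delta>1" using r2(2)[OF q(1)] by blast
    have wV: "w \<in> V" using w U_sub_V by blast
    have w1: "n0 (chart_map c q - x0 - coord w c) \<le> \<epsilon> * N w" using \<delta>1(2)[OF wV w(3)] w(2) by simp
    have "coord u c - coord w c = - (chart_map c q - x) + ((chart_map c q - x0 - coord w c) + - (x - x0 - coord u c))"
      by simp
    then have "N (u - w) = n0 (- (chart_map c q - x) + ((chart_map c q - x0 - coord w c) + - (x - x0 - coord u c)))"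
      using N_diff[OF u(1) wV] by simp
    also have "\<dots> \<le> n0 (- (chart_map c q - x)) + n0 ((chart_map c q - x0 - coord w c) + - (x - x0 - coord u c))"
      by (rule form.sqrt_triangle)
    also have "n0 ((chart_map c q - x0 - coord w c) + - (x - x0 - coord u c))
      \<le> n0 (chart_map c q - x0 - coord w c) + n0 (- (x - x0 - coord u c))"
      by (rule form.sqrt_triangle)
    finally have "N (u - w) \<le> (1 + \<epsilon>) * \<rho> + \<epsilon> * N w + \<epsilon> * N u"
      unfolding n0_minus using q(2) w1 u1(2) by (simp add: x_def)
    then show ?thesis using w by (intro bexI[of _ w]) (auto simp: algebra_simps)
  qed
  then show ?thesis using \<delta>(1) by blast
qed

text \<open>Closure refers to the topology of the manifold, the conclusion to the norm at
  \<open>p\<close>; the chart, being a homeomorphism, links the two.\<close>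

lemma closure_point_exp:
  assumes "p \<in> closure \<Omega>" "\<delta> > 0"
  shows "\<exists>w\<in>U. N w < \<delta> \<and> \<E> w \<in> \<Omega>"
proof -
  obtain r where r: "r > 0" "\<And>q. q \<in> chart_dom c \<Longrightarrow> norm (chart_map c q - x0) < r \<Longrightarrow> (\<exists>w\<in>U. \<E> w = q \<and> N w < \<delta>)"
    using exp_onto_neighborhood[OF assms(2)] by blast
  define O' where "O' = chart_dom c \<inter> chart_map c -` ball x0 r"
  have "open O'" unfolding O'_def
    by (rule continuous_open_preimage[OF chart_continuous[OF c_in_A] open_chart_dom[OF c_in_A] open_ball])
  moreover have "p \<in> O'" using p_in_c r(1) by (simp add: O'_def)
  ultimately have "\<Omega> \<inter> O' \<noteq> {}" using assms(1) by (auto simp: closure_iff_nhds_not_empty)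
  then obtain q where q: "q \<in> \<Omega>" "q \<in> O'" by blast
  then have "q \<in> chart_dom c" "norm (chart_map c q - x0) < r"
    by (auto simp: O'_def dist_norm norm_minus_commute)
  then obtain w where "w \<in> U" "\<E> w = q" "N w < \<delta>" using r(2) by blast
  then show ?thesis using q(1) by blast
qed

end

theorem theorem4p1:
  fixes A :: "('m::t2_space, 'e::{real_inner, complete_space}) chart set"
    and g :: "('m, 'e) metric"
    and p :: 'm
    and \<Omega> :: "'m set"
    and U :: "('m, 'e) tvec set"
  assumes "riemannian_manifold A g"
    and "p \<in> closure \<Omega>"
    and "exp_neighborhood A g p U"
  shows "riem_subdifferential A g (dist_to_set A g \<Omega>) p =
         riem_normal_cone A g U \<Omega> p \<inter> cotangent_unit_ball A g p"
proof -
  interpret riemannian_manifold A g by (rule assms(1))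
  obtain c where c: "c \<in> A" "p \<in> chart_dom c" by (rule exists_chart)
  interpret exp_chart A g p U c by standard (use assms(3) c in auto)
  have "dist_to_set A g \<Omega> \<circ> \<E> = (\<lambda>u. INF q\<in>\<Omega>. riem_dist A g (\<E> u) q)"
    by (simp add: fun_eq_iff dist_to_set_def)
  then show ?thesis
    unfolding riem_subdifferential_def riem_normal_cone_def cotangent_unit_ball_def
    using tangent.frechet_subdifferential_distance[OF U_sub_V inj_exp riem_dist_exp_upper
        riem_dist_exp_lower closure_point_exp[OF assms(2)]] by simp
qed

end
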